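(* Let $n\geq 2$, $m\geq 1$, and let $W\in C^1(\mathbb{R}^m;\mathbb{R})$ be such that there exists $a\in\mathbb{R}^m$ with $W>0$ in $\mathbb{R}^m\setminus\{a\}$ and $W(a)=0$. Let $u\in C^2(\mathbb{R}^n;\mathbb{R}^m)$ be a bounded, globally minimizing solution of $\Delta u=\nabla W(u)$ in $\mathbb{R}^n$. Then $u\equiv a$, provided that one of the following additional conditions holds: (a) $m=1$ and $W\in C^{1,1}_{loc}(\mathbb{R};\mathbb{R})$; or $u$ is radially symmetric; or $u$ satisfies Modica's gradient bound $\frac12|\nabla u|^2\leq W(u)$ in $\mathbb{R}^n$. (b) $n=2$ and there exists a small $r_0>0$ such that for every $\nu\in\mathbb{S}^{m-1}$ the function $r\mapsto W(a+r\nu)$ is strictly increasing for $r\in(0,r_0]$; or $n=2$, $W\in C^{1,1}_{loc}(\mathbb{R}^m;\mathbb{R})$, and there exists a small $r_0>0$ such that for every $\nu\in\mathbb{S}^{m-1}$ the function $r\mapsto W(a+r\nu)$ is nondecreasing for $r\in(0,r_0]$; or $n=2$ and $m=1$. (c) $W\in C^2(\mathbb{R}^m;\mathbb{R})$ and $W_{uu}(a)\nu\cdot\nu>0$ for all $\nu\in\mathbb{S}^{m-1}$, where $W_{uu}$ is the Hessian of $W$ and $\cdot$ the Euclidean inner product.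
   Context: For a smooth bounded domain $\Omega\subset\mathbb{R}^n$ and $v:\Omega\to\mathbb{R}^m$, the energy is $E(v;\Omega)=\int_\Omega\{\frac12|\nabla v|^2+W(v)\}dx$, where $|\nabla v|^2=\sum_{i=1}^n|v_{x_i}|^2$. A solution $u\in C^2(\mathbb{R}^n;\mathbb{R}^m)$ is called globally minimizing if $E(u;\Omega)\leq E(u+\varphi;\Omega)$ for every smooth bounded domain $\Omega\subset\mathbb{R}^n$ and every $\varphi\in W^{1,2}_0(\Omega;\mathbb{R}^m)\cap L^\infty(\Omega;\mathbb{R}^m)$. *)

theory Defs
  imports "HOL-Analysis.Analysis"
begin

definition partial :: "'n::finite \<Rightarrow> (real^'n \<Rightarrow> 'b::real_normed_vector) \<Rightarrow> real^'n \<Rightarrow> 'b" where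
  "partial i f x = vector_derivative (\<lambda>t. f (x + t *\<^sub>R axis i 1)) (at 0)"

definition has_partials_on :: "(real^'n::finite) set \<Rightarrow> (real^'n \<Rightarrow> 'b::real_normed_vector) \<Rightarrow> bool" where
  "has_partials_on S f \<longleftrightarrow> (\<forall>i. \<forall>x\<in>S. (\<lambda>t. f (x + t *\<^sub>R axis i 1)) differentiable (at 0))"

fun Ck_on :: "nat \<Rightarrow> (real^'n::finite) set \<Rightarrow> (real^'n \<Rightarrow> 'b::real_normed_vector) \<Rightarrow> bool" where
  "Ck_on 0 S f = continuous_on S f"
| "Ck_on (Suc k) S f = (continuous_on S f \<and> has_partials_on S f \<and> (\<forall>i. Ck_on k S (partial i f)))"

definition Cinf_on :: "(real^'n::finite) set \<Rightarrow> (real^'n \<Rightarrow> 'b::real_normed_vector) \<Rightarrow> bool" where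
  "Cinf_on S f \<longleftrightarrow> (\<forall>k. Ck_on k S f)"

definition grad :: "(real^'m::finite \<Rightarrow> real) \<Rightarrow> real^'m \<Rightarrow> real^'m" where
  "grad W y = (\<chi> j. partial j W y)"

definition hessian_form :: "(real^'m::finite \<Rightarrow> real) \<Rightarrow> real^'m \<Rightarrow> real^'m \<Rightarrow> real" where
  "hessian_form W y v = (\<Sum>i\<in>UNIV. \<Sum>j\<in>UNIV. partial j (partial i W) y * (v $ i) * (v $ j))"

definition laplacian :: "(real^'n::finite \<Rightarrow> real^'m::finite) \<Rightarrow> real^'n \<Rightarrow> real^'m" where
  "laplacian u x = (\<Sum>i\<in>UNIV. partial i (partial i u) x)"

definition grad_sq :: "(real^'n::finite \<Rightarrow> real^'m::finite) \<Rightarrow> real^'n \<Rightarrow> real" where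
  "grad_sq u x = (\<Sum>i\<in>UNIV. (norm (partial i u x))\<^sup>2)"

definition C11_loc :: "(real^'m::finite \<Rightarrow> real) \<Rightarrow> bool" where
  "C11_loc W \<longleftrightarrow> Ck_on 1 UNIV W \<and> (\<forall>r. \<exists>L. L-lipschitz_on (cball 0 r) (grad W))"

definition smooth_bounded_domain :: "(real^'n::finite) set \<Rightarrow> bool" where
  "smooth_bounded_domain \<Omega> \<longleftrightarrow> open \<Omega> \<and> connected \<Omega> \<and> bounded \<Omega> \<and> \<Omega> \<noteq> {} \<and>
     (\<forall>p\<in>frontier \<Omega>. \<exists>r>0. \<exists>\<rho> :: real^'n \<Rightarrow> real.
        Cinf_on (ball p r) \<rho> \<and> (\<forall>x\<in>ball p r. grad \<rho> x \<noteq> 0) \<and>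
        \<Omega> \<inter> ball p r = {x\<in>ball p r. \<rho> x < 0})"

definition Cc_inf :: "(real^'n::finite) set \<Rightarrow> (real^'n \<Rightarrow> 'b::real_normed_vector) \<Rightarrow> bool" where
  "Cc_inf \<Omega> \<psi> \<longleftrightarrow> Cinf_on UNIV \<psi> \<and> compact (closure {x. \<psi> x \<noteq> 0}) \<and> closure {x. \<psi> x \<noteq> 0} \<subseteq> \<Omega>"

definition L2_sq :: "(real^'n::finite) set \<Rightarrow> (real^'n \<Rightarrow> 'b::real_normed_vector) \<Rightarrow> ennreal" where
  "L2_sq \<Omega> f = (\<integral>\<^sup>+ x. ennreal ((norm (f x))\<^sup>2) \<partial>(lebesgue_on \<Omega>))"

text \<open>\<phi> \<in> W^{1,2}_0(\<Omega>;R^m) with (weak) partial derivatives g i: \<phi> and the g i are measurable,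
  square integrable on \<Omega>, and (\<phi>, g) is the W^{1,2}-limit of C_c^\<infinity>(\<Omega>) functions.\<close>
definition W120 :: "(real^'n::finite) set \<Rightarrow> (real^'n \<Rightarrow> real^'m::finite) \<Rightarrow> ('n \<Rightarrow> real^'n \<Rightarrow> real^'m) \<Rightarrow> bool" where
  "W120 \<Omega> \<phi> g \<longleftrightarrow>
     \<phi> \<in> borel_measurable (lebesgue_on \<Omega>) \<and> (\<forall>i. g i \<in> borel_measurable (lebesgue_on \<Omega>)) \<and>
     L2_sq \<Omega> \<phi> < \<infinity> \<and> (\<forall>i. L2_sq \<Omega> (g i) < \<infinity>) \<and>
     (\<exists>\<phi>s :: nat \<Rightarrow> real^'n \<Rightarrow> real^'m. (\<forall>k. Cc_inf \<Omega> (\<phi>s k)) \<and>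
        (\<lambda>k. L2_sq \<Omega> (\<lambda>x. \<phi>s k x - \<phi> x)) \<longlonglongrightarrow> 0 \<and>
        (\<forall>i. (\<lambda>k. L2_sq \<Omega> (\<lambda>x. partial i (\<phi>s k) x - g i x)) \<longlonglongrightarrow> 0))"

definition Linf :: "(real^'n::finite) set \<Rightarrow> (real^'n \<Rightarrow> 'b::real_normed_vector) \<Rightarrow> bool" where
  "Linf \<Omega> \<phi> \<longleftrightarrow> (\<exists>B. AE x in lebesgue_on \<Omega>. norm (\<phi> x) \<le> B)"

text \<open>Energy of v with gradient Dv on \<Omega> (as a nonnegative integral; W \<ge> 0 in our setting).\<close>
definition energy :: "(real^'m::finite \<Rightarrow> real) \<Rightarrow> (real^'n::finite) set \<Rightarrow> (real^'n \<Rightarrow> real^'m) \<Rightarrow> ('n \<Rightarrow> real^'n \<Rightarrow> real^'m) \<Rightarrow> ennreal" where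
  "energy W \<Omega> v Dv = (\<integral>\<^sup>+ x. ennreal ((1/2) * (\<Sum>i\<in>UNIV. (norm (Dv i x))\<^sup>2) + W (v x)) \<partial>(lebesgue_on \<Omega>))"

definition globally_minimizing :: "(real^'m::finite \<Rightarrow> real) \<Rightarrow> (real^'n::finite \<Rightarrow> real^'m) \<Rightarrow> bool" where
  "globally_minimizing W u \<longleftrightarrow>
     (\<forall>\<Omega> \<phi> g. smooth_bounded_domain \<Omega> \<and> W120 \<Omega> \<phi> g \<and> Linf \<Omega> \<phi> \<longrightarrow>
        energy W \<Omega> u (\<lambda>i. partial i u) \<le> energy W \<Omega> (\<lambda>x. u x + \<phi> x) (\<lambda>i x. partial i u x + g i x))"

definition radially_symmetric :: "(real^'n::finite \<Rightarrow> 'b) \<Rightarrow> bool" where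
  "radially_symmetric u \<longleftrightarrow> (\<forall>x y. norm x = norm y \<longrightarrow> u x = u y)"

end

theory Submission
  imports Defs
begin

text \<open>
  Write e = |Du|^2/2 + W(u) and F(N) for its integral over the ball of radius N. Comparing u with
  u + \<eta> (a - u), where \<eta> is the square of a cutoff function, bounds F(N) by an integral over the annulus
  between N and N + 1; summing over N, ..., 2N - 1 gives F(N) = O(N^(n-1)), and even o(N^(n-1))
  because W(u) controls the set where u is not close to a.

  If W does not decrease along rays near a, or if m = 1, then for every \<tau> > 0 there are \<sigma> > 0 and a
  contraction T of the target that is the identity where |y - a| \<le> \<sigma> and lowers the energy by a fixed
  proportion where |y - a| > \<tau>. The competitor that interpolates between T u and u in the annulus gives
  A_\<tau>(N) \<le> C (A_\<sigma>(N+1) - A_\<sigma>(N)) for A_\<tau>(N), the integral of 1 + |Du|^2 over the part of the ball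
  where |u - a| > \<tau>. Summation yields A_\<tau>(N) \<le> C A_\<sigma>(2N) / N, and n + 1 such steps force A_\<tau> = 0.
  A positive definite Hessian makes W increasing along rays near a.

  Under Modica's bound, Pohozaev's identity makes N^(1-n) F(N) essentially nondecreasing, and it tends
  to 0. For radial u, the quantity |u'|^2/2 - W(u) is nonincreasing in the radius and W(u) cannot stay
  away from 0 at infinity.
\<close>

section \<open>Partial derivatives\<close>

text \<open>The obstacle is the annulus, where nothing bounds the gradient of u in advance. In the
  comparison with a, squaring the cutoff keeps the coefficient of |Du|^2 at most 1, so the gradient
  there cancels against that of u. In the comparison with T u it is paid, but with the same
  integrand 1 + |Du|^2 that is gained inside, so the cost is an increment of the quantity being
  estimated, as in hole filling. T is the identity below \<sigma> in order to confine this cost to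
  |u - a| > \<sigma>; the definite gain needs a higher level \<tau>, which is why the level changes
  at each step. Minimality is expressed through limits of smooth test functions, while the
  competitors are only C^1; mollification bridges the gap, and truncations are rounded to C^1 maps.
  In the scalar case W may oscillate near a, so T truncates at a minimum point of W above a small
  level rather than retracting towards a; the rounding error, proportional to the volume, is sent to
  0 at fixed N.\<close>

lemma partial_eqI:
  assumes "((\<lambda>t. f (x + t *\<^sub>R axis i 1)) has_vector_derivative d) (at 0)"
  shows "partial i f x = d"
  using assms by (simp add: partial_def vector_derivative_at)

lemma has_vector_derivative_line:
  assumes "(f has_derivative f') (at (x + t *\<^sub>R v))"
  shows "((\<lambda>t. f (x + t *\<^sub>R v)) has_vector_derivative f' v) (at t)"
proof -
  have "((\<lambda>t. x + t *\<^sub>R v) has_derivative (\<lambda>t. t *\<^sub>R v)) (at t)"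
    by (auto intro!: derivative_eq_intros)
  from has_derivative_compose[OF this assms]
  show ?thesis
    using linear_scale[OF has_derivative_linear[OF assms]]
    by (simp add: has_vector_derivative_def)
qed

lemma partial_has_derivative:
  assumes "(f has_derivative f') (at x)"
  shows "partial i f x = f' (axis i 1)"
  using has_vector_derivative_line[of f f' x 0] assms by (intro partial_eqI) simp

lemma has_vector_derivative_partial:
  assumes "has_partials_on UNIV f"
  shows "((\<lambda>t. f (x + t *\<^sub>R axis i 1)) has_vector_derivative partial i f (x + t *\<^sub>R axis i 1)) (at t)"
proof -
  have "((\<lambda>s. f ((x + t *\<^sub>R axis i 1) + s *\<^sub>R axis i 1)) has_vector_derivative
      partial i f (x + t *\<^sub>R axis i 1)) (at (t - t))"
    using assms by (simp add: has_partials_on_def partial_def flip: vector_derivative_works)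
  moreover have "((\<lambda>s. s - t) has_real_derivative 1) (at t)"
    by (auto intro!: derivative_eq_intros)
  ultimately have "((\<lambda>s. f ((x + t *\<^sub>R axis i 1) + s *\<^sub>R axis i 1)) \<circ> (\<lambda>s. s - t) has_vector_derivative
      1 *\<^sub>R partial i f (x + t *\<^sub>R axis i 1)) (at t)"
    by (intro vector_diff_chain_at) (auto simp: has_real_derivative_iff_has_vector_derivative)
  then show ?thesis
    by (simp add: o_def algebra_simps)
qed

lemma sum_axis: "(\<Sum>i\<in>UNIV. (h $ i) *\<^sub>R axis i (1::real)) = h"
  by (simp add: vec_eq_iff axis_def if_distrib[where f = "\<lambda>x. _ * x"] cong: if_cong)

text \<open>Dropping coordinates does not lengthen h, so the corner points visited in
  \<open>has_derivative_partials\<close> stay near x.\<close>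

lemma norm_sum_axis_le:
  fixes h :: "real^'n"
  shows "norm (\<Sum>i\<in>S. (h $ i) *\<^sub>R axis i (1::real)) \<le> norm h"
proof (rule norm_le_componentwise_cart)
  fix j
  have "(\<Sum>i\<in>S. h $ i *\<^sub>R axis i (1::real)) $ j = (\<Sum>i\<in>S. if i = j then h $ i else 0)"
    unfolding sum_component by (intro sum.cong) (auto simp: axis_def)
  also have "\<dots> = (if j \<in> S then h $ j else 0)"
    by simp
  finally have "(\<Sum>i\<in>S. h $ i *\<^sub>R axis i (1::real)) $ j = (if j \<in> S then h $ j else 0)" .
  then show "norm ((\<Sum>i\<in>S. h $ i *\<^sub>R axis i (1::real)) $ j) \<le> norm (h $ j)"
    by simp
qed

text \<open>Mean value inequality for t \<mapsto> f(x + t e_i) - t d. With a fixed vector d in place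
  of the derivative, one estimate serves for total derivatives, kernels, translations and second
  differences.\<close>

lemma partial_increment:
  fixes f :: "real^'n \<Rightarrow> 'b::real_normed_vector"
  assumes "has_partials_on UNIV f"
    and B: "\<And>t. \<bar>t\<bar> \<le> \<bar>c\<bar> \<Longrightarrow> norm (partial i f (x + t *\<^sub>R axis i 1) - d) \<le> e"
  shows "norm (f (x + c *\<^sub>R axis i 1) - f x - c *\<^sub>R d) \<le> e * \<bar>c\<bar>"
proof -
  let ?g = "\<lambda>t. f (x + t *\<^sub>R axis i 1) - t *\<^sub>R d"
  let ?S = "{t. \<bar>t\<bar> \<le> \<bar>c\<bar>}"
  have S: "?S = {- \<bar>c\<bar>..\<bar>c\<bar>}" by auto
  have "norm (?g c - ?g 0) \<le> e * norm (c - 0)"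
  proof (rule differentiable_bound[where S = ?S])
    show "convex ?S" unfolding S by (rule convex_real_interval)
    show "(?g has_derivative (\<lambda>s. s *\<^sub>R (partial i f (x + t *\<^sub>R axis i 1) - d))) (at t within ?S)" for t
    proof -
      have "((\<lambda>t. t *\<^sub>R d) has_vector_derivative d) (at t)"
        by (auto intro!: derivative_eq_intros simp: has_vector_derivative_def)
      from has_vector_derivative_diff[OF has_vector_derivative_partial[OF assms(1), of x i t] this]
      show ?thesis
        unfolding has_vector_derivative_def by (rule has_derivative_at_withinI)
    qed
    show "onorm (\<lambda>s. s *\<^sub>R (partial i f (x + t *\<^sub>R axis i 1) - d)) \<le> e" if "t \<in> ?S" for t
      using B[of t] that by (simp add: onorm_scaleR_left onorm_id)
  qed auto
  then show ?thesis by (simp add: algebra_simps)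
qed

abbreviation total_deriv :: "(real^'n::finite \<Rightarrow> 'b::real_normed_vector) \<Rightarrow> real^'n \<Rightarrow> real^'n \<Rightarrow> 'b" where
  "total_deriv f x h \<equiv> \<Sum>i\<in>UNIV. (h $ i) *\<^sub>R partial i f x"

text \<open>x is joined to x + h by moving one coordinate at a time; continuity of the partial
  derivatives controls the error of each move.\<close>

lemma has_derivative_partials:
  fixes f :: "real^'n \<Rightarrow> 'b::real_normed_vector"
  assumes f: "has_partials_on UNIV f" and cont: "\<And>i. continuous_on UNIV (partial i f)"
  shows "(f has_derivative total_deriv f x) (at x)"
proof -
  let ?R = "\<lambda>S h. norm (f (x + (\<Sum>i\<in>S. (h $ i) *\<^sub>R axis i 1)) - f x - (\<Sum>i\<in>S. (h $ i) *\<^sub>R partial i f x))"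
  \<comment> \<open>S is the set of coordinates already moved. The claim is kept for all e, because
    each new coordinate uses up half of the tolerance.\<close>
  have *: "\<exists>d>0. \<forall>h. norm h < d \<longrightarrow> ?R S h \<le> e * norm h"
    if "e > 0" for e and S :: "'n set"
    using finite[of S] that
  proof (induction S arbitrary: e rule: finite_induct)
    case empty
    then show ?case by (auto intro!: exI[of _ 1])
  next
    case (insert j S)
    from insert.IH[of "e / 2"] insert.prems obtain d1 where d1: "d1 > 0"
      "\<And>h. norm h < d1 \<Longrightarrow> ?R S h \<le> e / 2 * norm h" by auto
    have "isCont (partial j f) x" using cont by (simp add: continuous_on_eq_continuous_at)
    then obtain d2 where d2: "d2 > 0" "\<And>y. dist y x < d2 \<Longrightarrow> dist (partial j f y) (partial j f x) < e / 2"
      using insert.prems unfolding continuous_at_eps_delta by (meson half_gt_zero)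
    show ?case
    \<comment> \<open>The moves in S together and the move along j each have length at most |h|, so
      points up to 2 |h| away from x occur.\<close>
    proof (intro exI[of _ "min d1 (d2 / 2)"] conjI allI impI)
      show "min d1 (d2 / 2) > 0" using d1 d2 by simp
      fix h :: "real^'n" assume h: "norm h < min d1 (d2 / 2)"
      let ?s = "\<Sum>i\<in>S. (h $ i) *\<^sub>R axis i (1::real)"
      have "norm (f ((x + ?s) + (h $ j) *\<^sub>R axis j 1) - f (x + ?s) - (h $ j) *\<^sub>R partial j f x) \<le> e / 2 * \<bar>h $ j\<bar>"
      proof (rule partial_increment[OF f])
        fix t assume t: "\<bar>t\<bar> \<le> \<bar>h $ j\<bar>"
        have "norm (?s + t *\<^sub>R axis j 1) \<le> norm h + norm h"
          using t component_le_norm_cart[of h j]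
          by (intro order_trans[OF norm_triangle_ineq] add_mono norm_sum_axis_le) simp
        then have "dist (x + ?s + t *\<^sub>R axis j 1) x < d2"
          using h by (simp add: dist_norm add.assoc)
        then show "norm (partial j f (x + ?s + t *\<^sub>R axis j 1) - partial j f x) \<le> e / 2"
          using d2(2) by (fastforce simp: dist_norm)
      qed
      also have "\<dots> \<le> e / 2 * norm h"
        using component_le_norm_cart[of h j] insert.prems by (intro mult_left_mono) auto
      finally have 1: "norm (f ((x + ?s) + (h $ j) *\<^sub>R axis j 1) - f (x + ?s) - (h $ j) *\<^sub>R partial j f x) \<le> e / 2 * norm h" .
      have 2: "norm (f (x + ?s) - f x - (\<Sum>i\<in>S. (h $ i) *\<^sub>R partial i f x)) \<le> e / 2 * norm h"
        using d1(2) h by simp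
      have "?R (insert j S) h
        = norm ((f ((x + ?s) + (h $ j) *\<^sub>R axis j 1) - f (x + ?s) - (h $ j) *\<^sub>R partial j f x)
           + (f (x + ?s) - f x - (\<Sum>i\<in>S. (h $ i) *\<^sub>R partial i f x)))"
        using insert.hyps by (simp add: algebra_simps)
      also have "\<dots> \<le> e / 2 * norm h + e / 2 * norm h"
        by (intro order_trans[OF norm_triangle_ineq] add_mono 1 2)
      finally show "?R (insert j S) h \<le> e * norm h" by simp
    qed
  qed
  have bl: "bounded_linear (\<lambda>h::real^'n. \<Sum>i\<in>UNIV. (h $ i) *\<^sub>R partial i f x)"
    by (intro bounded_linear_sum bounded_linear_compose[OF bounded_linear_scaleR_left]
        bounded_linear_vec_nth)
  show ?thesis
    unfolding has_derivative_at_alt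
  proof (intro conjI allI impI bl)
    fix e :: real assume "e > 0"
    from *[OF this, of UNIV] obtain d where d: "d > 0"
      "\<And>h. norm h < d \<Longrightarrow> norm (f (x + h) - f x - (total_deriv f x h)) \<le> e * norm h"
      by (auto simp: sum_axis)
    show "\<exists>d>0. \<forall>y. norm (y - x) < d \<longrightarrow>
        norm (f y - f x - (\<Sum>i\<in>UNIV. ((y - x) $ i) *\<^sub>R partial i f x)) \<le> e * norm (y - x)"
    proof (intro exI[of _ d] conjI allI impI d(1))
      fix y assume "norm (y - x) < d"
      from d(2)[OF this] show "norm (f y - f x - (\<Sum>i\<in>UNIV. ((y - x) $ i) *\<^sub>R partial i f x)) \<le> e * norm (y - x)"
        by simp
    qed
  qed
qed

section \<open>Closure properties of C^k functions\<close>

lemma Ck_on_subset: "Ck_on k S f \<Longrightarrow> T \<subseteq> S \<Longrightarrow> Ck_on k T f"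
  by (induction k arbitrary: f) (auto intro: continuous_on_subset simp: has_partials_on_def)

lemma Ck_on_continuous: "Ck_on k S f \<Longrightarrow> continuous_on S f"
  by (cases k) auto

lemma Ck_on_Suc_imp: "Ck_on (Suc k) S f \<Longrightarrow> Ck_on k S f"
  by (induction k arbitrary: f) auto

lemma Ck_on_partial: "Ck_on (Suc k) S f \<Longrightarrow> Ck_on k S (partial i f)"
  by simp

lemma Ck_on_one_has_derivative:
  assumes "Ck_on (Suc k) UNIV f"
  shows "(f has_derivative total_deriv f x) (at x)"
  using assms by (intro has_derivative_partials) (auto intro: Ck_on_continuous)

text \<open>\<open>Ck_on\<close> speaks only of iterated partials. Through this rule a formula for
  the total derivative delivers continuity, existence of partials and their values at once, which
  carries the inductions below.\<close>

lemma Ck_on_SucI: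
  assumes "\<And>x. (f has_derivative f' x) (at x)" and "\<And>i. Ck_on k UNIV (\<lambda>x. f' x (axis i 1))"
  shows "Ck_on (Suc k) UNIV f"
proof -
  have "continuous_on UNIV f"
    using assms(1) by (auto intro!: has_derivative_continuous_on)
  moreover have "has_partials_on UNIV f"
    unfolding has_partials_on_def
  proof (intro allI ballI)
    fix i x
    show "(\<lambda>t. f (x + t *\<^sub>R axis i 1)) differentiable at 0"
      using has_vector_derivative_line[of f "f' x" x 0 "axis i 1"] assms(1)[of x]
      by (auto simp: differentiable_def has_vector_derivative_def)
  qed
  moreover have "partial i f = (\<lambda>x. f' x (axis i 1))" for i
    using partial_has_derivative[OF assms(1)] by auto
  ultimately show ?thesis using assms(2) by simp
qed

lemma C1I:
  assumes "\<And>x. (f has_derivative f' x) (at x)" and "\<And>i. continuous_on UNIV (\<lambda>x. f' x (axis i 1))"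
  shows "Ck_on 1 UNIV f"
  using Ck_on_SucI[of f f' 0] assms by simp

lemma axis_sum_scaleR [simp]:
  fixes F :: "'n::finite \<Rightarrow> 'b::real_vector"
  shows "(\<Sum>i\<in>UNIV. (axis j (1::real) $ i) *\<^sub>R F i) = F j"
proof -
  have "(\<Sum>i\<in>UNIV. (axis j (1::real) $ i) *\<^sub>R F i) = (\<Sum>i\<in>UNIV. if i = j then F i else 0)"
    by (intro sum.cong) (auto simp: axis_def)
  then show ?thesis by simp
qed

lemma Ck_on_const: "Ck_on k UNIV (\<lambda>x. c)"
proof (induction k arbitrary: c)
  case (Suc k)
  show ?case by (rule Ck_on_SucI[where f' = "\<lambda>_ _. 0"]) (use Suc in auto)
qed auto

lemma Ck_on_add: "Ck_on k UNIV f \<Longrightarrow> Ck_on k UNIV g \<Longrightarrow> Ck_on k UNIV (\<lambda>x. f x + g x)"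
proof (induction k arbitrary: f g)
  case (Suc k)
  show ?case
  proof (rule Ck_on_SucI)
    fix x show "((\<lambda>x. f x + g x) has_derivative (\<lambda>h. total_deriv f x h +
      (total_deriv g x h))) (at x)"
      by (intro has_derivative_add Ck_on_one_has_derivative) (fact Suc.prems)+
  next
    fix i show "Ck_on k UNIV (\<lambda>x. (\<Sum>j\<in>UNIV. (axis i 1 $ j) *\<^sub>R partial j f x) +
      (\<Sum>j\<in>UNIV. (axis i 1 $ j) *\<^sub>R partial j g x))"
      unfolding axis_sum_scaleR
      by (rule Suc.IH[OF Ck_on_partial[OF Suc.prems(1)] Ck_on_partial[OF Suc.prems(2)]])
  qed
qed (simp add: continuous_on_add)

lemma Ck_on_scaleR:
  fixes f :: "real^'n \<Rightarrow> real"
  shows "Ck_on k UNIV f \<Longrightarrow> Ck_on k UNIV g \<Longrightarrow> Ck_on k UNIV (\<lambda>x. f x *\<^sub>R g x)"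
proof (induction k arbitrary: f g)
  case (Suc k)
  show ?case
  proof (rule Ck_on_SucI)
    fix x show "((\<lambda>x. f x *\<^sub>R g x) has_derivative (\<lambda>h. f x *\<^sub>R total_deriv g x h +
      total_deriv f x h *\<^sub>R g x)) (at x)"
      by (intro has_derivative_scaleR Ck_on_one_has_derivative) (fact Suc.prems)+
  next
    fix i show "Ck_on k UNIV (\<lambda>x. f x *\<^sub>R (\<Sum>j\<in>UNIV. (axis i 1 $ j) *\<^sub>R partial j g x) +
      (\<Sum>j\<in>UNIV. (axis i 1 $ j) *\<^sub>R partial j f x) *\<^sub>R g x)"
      unfolding axis_sum_scaleR
      by (intro Ck_on_add Suc.IH Ck_on_Suc_imp[OF Suc.prems(1)] Ck_on_Suc_imp[OF Suc.prems(2)]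
          Ck_on_partial[OF Suc.prems(1)] Ck_on_partial[OF Suc.prems(2)])
  qed
qed (auto intro: continuous_on_scaleR)

lemma Ck_on_linear:
  fixes f :: "real^'n \<Rightarrow> 'b::real_normed_vector"
  assumes "bounded_linear f"
  shows "Ck_on k UNIV f"
proof (cases k)
  case 0
  then show ?thesis using assms by (simp add: linear_continuous_on)
next
  case (Suc l)
  then show ?thesis
    using bounded_linear_imp_has_derivative[OF assms] unfolding Suc by (intro Ck_on_SucI[where f' = "\<lambda>_. f"] Ck_on_const)
qed

lemma norm_sq_has_derivative:
  fixes x b :: "'a::real_inner"
  shows "((\<lambda>x. (norm (x - b))\<^sup>2) has_derivative (\<lambda>h. 2 * ((x - b) \<bullet> h))) (at x)"
  unfolding power2_norm_eq_inner by (auto intro!: derivative_eq_intros simp: inner_commute)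

lemma Ck_on_norm_sq: "Ck_on k UNIV (\<lambda>x::real^'n. (norm x)\<^sup>2)"
proof (cases k)
  case 0
  then show ?thesis by (simp add: continuous_on_power continuous_on_norm continuous_on_id)
next
  case (Suc l)
  have "((\<lambda>x::real^'n. (norm x)\<^sup>2) has_derivative (\<lambda>h. 2 * (x \<bullet> h))) (at x)" for x
    using norm_sq_has_derivative[of 0 x] by simp
  moreover have "bounded_linear (\<lambda>x::real^'n. 2 * (x \<bullet> axis i 1))" for i
    using bounded_linear_mult_right[of 2] by (rule bounded_linear_compose) (rule bounded_linear_inner_left)
  ultimately show ?thesis unfolding Suc
    by (rule Ck_on_SucI[OF _ Ck_on_linear])
qed

section \<open>Mollification\<close>

abbreviation supported :: "real \<Rightarrow> (real^'n::finite \<Rightarrow> 'b::zero) \<Rightarrow> bool" where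
  "supported r f \<equiv> \<forall>x. norm x > r \<longrightarrow> f x = 0"

text \<open>The family p(1/t) exp(-1/t), extended by 0, is closed under differentiation; quantifying
  over p makes smoothness a single induction on the order.\<close>

definition poly_exp :: "real poly \<Rightarrow> real \<Rightarrow> real" where
  "poly_exp p t = (if t > 0 then poly p (1 / t) * exp (- (1 / t)) else 0)"

lemma poly_div_exp_tendsto_0: "((\<lambda>y. poly q y / exp y) \<longlongrightarrow> (0::real)) at_top"
proof -
  have "((\<lambda>y. \<Sum>i\<le>degree q. coeff q i * (y ^ i / exp y)) \<longlongrightarrow> (\<Sum>i\<le>degree q. coeff q i * 0)) at_top"
    by (intro tendsto_sum tendsto_mult tendsto_const tendsto_power_div_exp_0)
  then show ?thesis
    by (simp add: poly_altdef sum_divide_distrib)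
qed

text \<open>In terms of y = 1/t one has dy/dt = -y^2, so p(y) exp(-y) differentiates to y^2 (p -
  p')(y) exp(-y). Only t = 0 needs the decay of the exponential.\<close>

lemma poly_exp_has_derivative:
  "(poly_exp p has_real_derivative poly_exp ([:0, 0, 1:] * (p - pderiv p)) t) (at t)"
proof -
  consider "t > 0" | "t < 0" | "t = 0" by linarith
  then show ?thesis
  proof cases
    case 1
    have "((\<lambda>t. poly p (1 / t) * exp (- (1 / t))) has_real_derivative
        poly_exp ([:0, 0, 1:] * (p - pderiv p)) t) (at t)"
      using 1 by (auto intro!: derivative_eq_intros DERIV_chain2[where f = "poly p"] poly_DERIV
          simp: poly_exp_def field_simps power2_eq_square)
    then show ?thesis
      by (rule has_field_derivative_transform_within_open[of _ _ _ "{0<..}"]) (use 1 in \<open>auto simp: poly_exp_def\<close>)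
  next
    case 2
    have "((\<lambda>t. 0) has_real_derivative poly_exp ([:0, 0, 1:] * (p - pderiv p)) t) (at t)"
      using 2 by (simp add: poly_exp_def)
    then show ?thesis
      by (rule has_field_derivative_transform_within_open[of _ _ _ "{..<0}"]) (use 2 in \<open>auto simp: poly_exp_def\<close>)
  next
    case 3
    \<comment> \<open>\<open>pCons 0 p\<close> absorbs the denominator h of the difference quotient,
      as p(y) / h = y p(y) for y = 1/h.\<close>
    have "((\<lambda>h. poly (pCons 0 p) (inverse h) / exp (inverse h)) \<longlongrightarrow> 0) (at_right 0)"
      by (rule filterlim_compose[OF poly_div_exp_tendsto_0 filterlim_inverse_at_top_right])
    then have "((\<lambda>h. (poly_exp p (0 + h) - poly_exp p 0) / h) \<longlongrightarrow> 0) (at_right 0)"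
      by (rule Lim_transform_eventually)
        (auto simp: eventually_at_filter poly_exp_def exp_minus field_simps)
    moreover have "((\<lambda>h. (poly_exp p (0 + h) - poly_exp p 0) / h) \<longlongrightarrow> 0) (at_left 0)"
      by (rule Lim_transform_eventually[OF tendsto_const])
        (auto simp: eventually_at_filter poly_exp_def)
    ultimately show ?thesis
      using 3 by (simp add: DERIV_def filterlim_split_at poly_exp_def)
  qed
qed

lemma Ck_on_poly_exp_compose:
  fixes g :: "real^'n \<Rightarrow> real"
  assumes "\<And>k. Ck_on k UNIV g"
  shows "Ck_on k UNIV (\<lambda>x. poly_exp p (g x))"
proof (induction k arbitrary: p)
  case 0
  have "isCont (poly_exp p) t" for t
    using poly_exp_has_derivative DERIV_isCont by blast
  then have "continuous_on UNIV (poly_exp p)"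
    by (simp add: continuous_on_eq_continuous_at)
  then show ?case
    using continuous_on_compose2[of UNIV "poly_exp p" UNIV g] assms[of 0] by simp
next
  case (Suc k)
  let ?q = "[:0, 0, 1:] * (p - pderiv p)"
  have 1: "((\<lambda>x. poly_exp p (g x)) has_derivative
      (\<lambda>h. total_deriv g x h * poly_exp ?q (g x))) (at x)" for x
    using has_derivative_compose[OF Ck_on_one_has_derivative[OF assms[of 1, unfolded One_nat_def], of x]
        poly_exp_has_derivative[unfolded has_field_derivative_def, of p "g x"]]
    by (simp add: mult.commute)
  have 2: "Ck_on k UNIV (\<lambda>x. (\<Sum>j\<in>UNIV. (axis i 1 $ j) *\<^sub>R partial j g x) * poly_exp ?q (g x))" for i
    unfolding axis_sum_scaleR real_scaleR_def[symmetric]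
    by (rule Ck_on_scaleR[OF Ck_on_partial[OF assms] Suc.IH])
  show ?case by (rule Ck_on_SucI[OF 1 2])
qed

text \<open>The standard bump exp(-1 / (1 - k^2 |x|^2)); the squared norm keeps it smooth at the
  origin.\<close>

definition bump :: "nat \<Rightarrow> real^'n::finite \<Rightarrow> real" where
  "bump k x = poly_exp 1 (1 - (real k * norm x)\<^sup>2)"

lemma Ck_on_bump: "Ck_on j UNIV (bump k)"
proof -
  have "Ck_on j UNIV (\<lambda>x::real^'n. 1 + (- (real k)\<^sup>2) *\<^sub>R (norm x)\<^sup>2)" for j
    by (intro Ck_on_add Ck_on_scaleR Ck_on_const Ck_on_norm_sq)
  from Ck_on_poly_exp_compose[OF this] show ?thesis
    unfolding bump_def[abs_def] by (simp add: power_mult_distrib)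
qed

lemma bump_nonneg: "bump k x \<ge> 0"
  by (simp add: bump_def poly_exp_def)

lemma bump_eq_0: "k > 0 \<Longrightarrow> norm x \<ge> 1 / real k \<Longrightarrow> bump k x = 0"
  using one_le_power[of "real k * norm x" 2] by (simp add: bump_def poly_exp_def field_simps)

lemma bump_0_pos: "bump k 0 > 0"
  by (simp add: bump_def poly_exp_def)

lemma bump_minus: "bump k (x - y) = bump k (y - x)"
  by (simp add: bump_def norm_minus_commute)

section \<open>Continuous functions with bounded support\<close>

lemma integrable_continuous_compact_support:
  fixes f :: "real^'n \<Rightarrow> 'b::euclidean_space"
  assumes "continuous_on UNIV f" and "supported r f"
  shows "integrable lborel f"
proof -
  have "integrable lborel (\<lambda>x. indicator (cball 0 r) x *\<^sub>R f x)"
    using assms(1) by (intro borel_integrable_compact) (auto intro: continuous_on_subset)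
  also have "(\<lambda>x. indicator (cball 0 r) x *\<^sub>R f x) = f"
    using assms(2) by (force simp: indicator_def not_le)
  finally show ?thesis .
qed

lemma uniformly_continuous_compact_support:
  fixes f :: "real^'n \<Rightarrow> 'b::euclidean_space"
  assumes f: "continuous_on UNIV f" "supported r f" and "e > 0"
  shows "\<exists>d>0. \<forall>x y. norm (x - y) < d \<longrightarrow> norm (f x - f y) < e"
proof -
  \<comment> \<open>The margin 1: two points closer than 1 either both lie in the larger ball or
    both lie outside the support.\<close>
  have "uniformly_continuous_on (cball 0 (r + 1)) f"
    using f(1) by (intro compact_uniformly_continuous) (auto intro: continuous_on_subset)
  then obtain d where d: "d > 0" "\<And>x y. \<lbrakk>norm x \<le> r + 1; norm y \<le> r + 1; norm (x - y) < d\<rbrakk> \<Longrightarrow> norm (f x - f y) < e"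
    using \<open>e > 0\<close> unfolding uniformly_continuous_on_def dist_norm by (metis mem_cball_0 norm_minus_commute)
  show ?thesis
  proof (intro exI[of _ "min d 1"] conjI allI impI)
    fix x y :: "real^'n" assume xy: "norm (x - y) < min d 1"
    show "norm (f x - f y) < e"
    proof (cases "norm x \<le> r \<or> norm y \<le> r")
      case True
      then have "norm x \<le> r + 1 \<and> norm y \<le> r + 1"
        using xy norm_triangle_ineq2[of x y] norm_triangle_ineq2[of y x] norm_minus_commute[of x y] by linarith
      then show ?thesis using d xy by simp
    next
      case False
      then show ?thesis using f(2) \<open>e > 0\<close> by simp
    qed
  qed (use d in auto)
qed

lemma lborel_integral_shift:
  fixes f :: "real^'n \<Rightarrow> 'b::euclidean_space"
  assumes "f \<in> borel_measurable borel"
  shows "(LBINT x. f (c + x)) = (LBINT x. f x)"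
proof -
  have "(LBINT x. f x) = (\<integral>x. f x \<partial>(distr lborel borel ((+) c)))"
    by (simp add: lborel_distr_plus)
  also have "\<dots> = (LBINT x. f (c + x))"
    using assms by (intro integral_distr) auto
  finally show ?thesis by simp
qed

section \<open>Convolution with a smooth kernel\<close>

definition conv :: "(real^'n::finite \<Rightarrow> real) \<Rightarrow> (real^'n \<Rightarrow> 'b::euclidean_space) \<Rightarrow> real^'n \<Rightarrow> 'b" where
  "conv g f x = (LBINT y. g (x - y) *\<^sub>R f y)"

lemma integrable_conv:
  fixes f :: "real^'n \<Rightarrow> 'b::euclidean_space"
  assumes "continuous_on UNIV g" "continuous_on UNIV f" "supported r f"
  shows "integrable lborel (\<lambda>y. g (x - y) *\<^sub>R f y)"
  using assms
  by (intro integrable_continuous_compact_support[of _ r] continuous_on_scaleR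
      continuous_on_compose2[OF assms(1)] continuous_on_diff continuous_on_const continuous_on_id) auto

lemma norm_integral_scaleR_le:
  fixes f :: "real^'n \<Rightarrow> 'b::euclidean_space"
  assumes "continuous_on UNIV f" "supported r f" and "\<And>y. \<bar>h y\<bar> \<le> e"
    and "integrable lborel (\<lambda>y. h y *\<^sub>R f y)"
  shows "norm (LBINT y. h y *\<^sub>R f y) \<le> e * (LBINT y. norm (f y))"
proof -
  have f: "integrable lborel (\<lambda>y. norm (f y))"
    using integrable_continuous_compact_support[OF assms(1,2)] by (rule integrable_norm)
  have "norm (LBINT y. h y *\<^sub>R f y) \<le> (LBINT y. norm (h y *\<^sub>R f y))"
    by (rule integral_norm_bound)
  also have "\<dots> \<le> (LBINT y. e * norm (f y))"
    using integrable_norm[OF assms(4)] f assms(3) by (intro integral_mono) (auto intro: mult_right_mono)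
  finally show ?thesis by simp
qed

lemma continuous_on_conv:
  fixes f :: "real^'n \<Rightarrow> 'b::euclidean_space"
  assumes g: "continuous_on UNIV g" "supported s g"
    and f: "continuous_on UNIV f" "supported r f"
  shows "continuous_on UNIV (conv g f)"
  unfolding continuous_on_iff
proof (intro ballI allI impI)
  fix x and e :: real assume "e > 0"
  let ?I = "LBINT y. norm (f y)"
  have I: "?I \<ge> 0" by simp
  \<comment> \<open>The added 1 covers f = 0 and makes the final estimate strict.\<close>
  then have e': "e / (?I + 1) > 0" using \<open>e > 0\<close> by (intro divide_pos_pos add_nonneg_pos) auto
  obtain d where d: "d > 0" "\<And>x y. norm (x - y) < d \<Longrightarrow> norm (g x - g y) < e / (?I + 1)"
    using uniformly_continuous_compact_support[OF g e'] by blast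
  show "\<exists>d>0. \<forall>x'\<in>UNIV. dist x' x < d \<longrightarrow> dist (conv g f x') (conv g f x) < e"
  proof (intro exI[of _ d] conjI ballI impI d(1))
    fix x' assume "dist x' x < d"
    then have *: "\<bar>g (x' - y) - g (x - y)\<bar> \<le> e / (?I + 1)" for y
      using d(2)[of "x' - y" "x - y"] by (simp add: dist_norm less_imp_le)
    have int: "integrable lborel (\<lambda>y. g (z - y) *\<^sub>R f y)" for z
      by (rule integrable_conv[OF g(1) f])
    have "conv g f x' - conv g f x = (LBINT y. (g (x' - y) - g (x - y)) *\<^sub>R f y)"
      unfolding conv_def scaleR_diff_left by (rule Bochner_Integration.integral_diff[symmetric]) (rule int)+
    also have "norm \<dots> \<le> e / (?I + 1) * ?I"
      by (intro norm_integral_scaleR_le[OF f] *)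
        (unfold scaleR_diff_left, intro Bochner_Integration.integrable_diff int)
    also have "\<dots> = e * (?I / (?I + 1))" by simp
    also have "\<dots> < e * 1"
      using \<open>e > 0\<close> I by (intro mult_strict_left_mono) (auto simp: add_nonneg_pos pos_divide_less_eq)
    finally show "dist (conv g f x') (conv g f x) < e" by (simp add: dist_norm)
  qed
qed

lemma supported_partial:
  fixes g :: "real^'n \<Rightarrow> 'b::real_normed_vector"
  assumes "supported s g"
  shows "supported s (partial i g)"
proof (intro allI impI partial_eqI)
  fix x :: "real^'n" assume "norm x > s"
  have "((\<lambda>t. 0) has_vector_derivative 0) (at (0::real))" by simp
  moreover have "open ((\<lambda>t::real. norm (x + t *\<^sub>R axis i (1::real))) -` {s<..})"
    by (intro open_vimage continuous_intros open_greaterThan)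
  ultimately show "((\<lambda>t. g (x + t *\<^sub>R axis i 1)) has_vector_derivative 0) (at 0)"
    by (rule has_vector_derivative_transform_within_open) (use assms \<open>norm x > s\<close> in auto)
qed

text \<open>The derivative falls on the kernel, so f need only be continuous: the difference
  quotients of g converge uniformly because \<open>partial i g\<close> is uniformly
  continuous.\<close>

lemma has_vector_derivative_conv:
  fixes f :: "real^'n \<Rightarrow> 'b::euclidean_space"
  assumes g: "Ck_on 1 UNIV g" "supported s g"
    and f: "continuous_on UNIV f" "supported r f"
  shows "((\<lambda>t. conv g f (x + t *\<^sub>R axis i 1)) has_vector_derivative conv (partial i g) f x) (at 0)"
  unfolding has_vector_derivative_def has_derivative_at_alt
proof (intro conjI allI impI bounded_linear_scaleR_left)
  fix e :: real assume "e > 0"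
  let ?I = "LBINT y. norm (f y)"
  have I: "?I \<ge> 0" by simp
  then have e': "e / (?I + 1) > 0" using \<open>e > 0\<close> by (intro divide_pos_pos add_nonneg_pos) auto
  have g1: "has_partials_on UNIV g" "continuous_on UNIV (partial i g)" "continuous_on UNIV g"
    using g(1) by auto
  obtain d where d: "d > 0" "\<And>x y. norm (x - y) < d \<Longrightarrow> norm (partial i g x - partial i g y) < e / (?I + 1)"
    using uniformly_continuous_compact_support[OF g1(2) supported_partial[OF g(2)] e'] by blast
  show "\<exists>d>0. \<forall>t. norm (t - 0) < d \<longrightarrow> norm (conv g f (x + t *\<^sub>R axis i 1) - conv g f (x + 0 *\<^sub>R axis i 1) -
      (t - 0) *\<^sub>R conv (partial i g) f x) \<le> e * norm (t - 0)"
  proof (intro exI[of _ d] conjI allI impI d(1))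
    fix t :: real assume "norm (t - 0) < d"
    then have t: "\<bar>t\<bar> < d" by simp
    let ?h = "\<lambda>y. g (x + t *\<^sub>R axis i 1 - y) - g (x - y) - t * partial i g (x - y)"
    have *: "\<bar>?h y\<bar> \<le> e / (?I + 1) * \<bar>t\<bar>" for y
    proof -
      have "norm (g ((x - y) + t *\<^sub>R axis i 1) - g (x - y) - t *\<^sub>R partial i g (x - y)) \<le> e / (?I + 1) * \<bar>t\<bar>"
      proof (rule partial_increment[OF g1(1)])
        fix s assume "\<bar>s\<bar> \<le> \<bar>t\<bar>"
        then show "norm (partial i g (x - y + s *\<^sub>R axis i 1) - partial i g (x - y)) \<le> e / (?I + 1)"
          using t by (intro less_imp_le d(2)) simp
      qed
      then show ?thesis by (simp add: algebra_simps)
    qed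
    have int: "integrable lborel (\<lambda>y. g (z - y) *\<^sub>R f y)" "integrable lborel (\<lambda>y. partial i g (z - y) *\<^sub>R f y)" for z
      using g1 by (auto intro!: integrable_conv[OF _ f])
    have "conv g f (x + t *\<^sub>R axis i 1) - conv g f x - t *\<^sub>R conv (partial i g) f x
        = (LBINT y. g (x + t *\<^sub>R axis i 1 - y) *\<^sub>R f y - g (x - y) *\<^sub>R f y - t *\<^sub>R (partial i g (x - y) *\<^sub>R f y))"
      unfolding conv_def using int by (simp del: scaleR_scaleR)
    also have "\<dots> = (LBINT y. ?h y *\<^sub>R f y)"
      by (simp add: scaleR_diff_left)
    also have "norm \<dots> \<le> e / (?I + 1) * \<bar>t\<bar> * ?I"
      by (intro norm_integral_scaleR_le[OF f] *)
        (unfold scaleR_diff_left scaleR_scaleR[symmetric],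
          intro Bochner_Integration.integrable_diff integrable_scaleR_right int)
    also have "\<dots> = (e * \<bar>t\<bar>) * (?I / (?I + 1))" by simp
    also have "\<dots> \<le> (e * \<bar>t\<bar>) * 1"
      using \<open>e > 0\<close> I by (intro mult_left_mono) (auto simp: add_nonneg_pos pos_divide_le_eq)
    finally show "norm (conv g f (x + t *\<^sub>R axis i 1) - conv g f (x + 0 *\<^sub>R axis i 1) -
        (t - 0) *\<^sub>R conv (partial i g) f x) \<le> e * norm (t - 0)" by simp
  qed
qed

lemma Ck_on_conv:
  fixes f :: "real^'n \<Rightarrow> 'b::euclidean_space"
  assumes "Ck_on k UNIV g" "supported s g"
    and f: "continuous_on UNIV f" "supported r f"
  shows "Ck_on k UNIV (conv g f)"
  using assms(1,2)
proof (induction k arbitrary: g)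
  case 0
  then show ?case using continuous_on_conv[OF _ _ f] by auto
next
  case (Suc k)
  have "Ck_on 1 UNIV g" using Suc.prems(1) by (auto intro: Ck_on_continuous)
  note d = has_vector_derivative_conv[OF this Suc.prems(2) f]
  have "partial i (conv g f) = conv (partial i g) f" for i
    using partial_eqI[OF d] by auto
  moreover have "Ck_on k UNIV (conv (partial i g) f)" for i
    using Suc.prems(1) by (intro Suc.IH supported_partial[OF Suc.prems(2)]) (auto simp del: not_less)
  moreover have "has_partials_on UNIV (conv g f)"
    using differentiableI_vector[OF d] by (simp add: has_partials_on_def)
  moreover have "continuous_on UNIV (conv g f)"
    using Suc.prems continuous_on_conv[OF _ _ f] by auto
  ultimately show ?case by simp
qed

lemma continuous_nonneg_integral_le_0:
  fixes f :: "real^'n \<Rightarrow> real"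
  assumes "continuous_on UNIV f" "\<And>x. f x \<ge> 0" "integrable lborel f" "(LBINT x. f x) \<le> 0"
  shows "f x = 0"
proof (rule ccontr)
  assume "f x \<noteq> 0"
  then have pos: "f x > 0" using assms(2)[of x] by linarith
  have "isCont f x" using assms(1) by (simp add: continuous_on_eq_continuous_at)
  then obtain d where d: "d > 0" "\<And>y. dist y x < d \<Longrightarrow> dist (f y) (f x) < f x / 2"
    using pos unfolding continuous_at_eps_delta by (meson half_gt_zero)
  have "f x / 2 * measure lborel (ball x d) = (LBINT y. f x / 2 * indicator (ball x d) y)"
    by simp
  also have "\<dots> \<le> (LBINT y. f y)"
  proof (rule integral_mono)
    fix y
    show "f x / 2 * indicator (ball x d) y \<le> f y"
    proof (cases "y \<in> ball x d")
      case True
      then have "dist (f y) (f x) < f x / 2" by (intro d(2)) (simp add: dist_commute)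
      then have "\<bar>f y - f x\<bar> < f x / 2" by (simp add: dist_real_def)
      then have "f x / 2 < f y" by arith
      then show ?thesis using True by simp
    qed (use assms(2) in simp)
  next
    show "integrable lborel (\<lambda>y. f x / 2 * indicator (ball x d) y)"
      by (intro integrable_mult_right integrable_real_indicator) (auto intro: emeasure_bounded_finite[unfolded infinity_ennreal_def])
  qed (rule assms(3))
  finally have "f x / 2 * measure lborel (ball x d) \<le> 0" using assms(4) by simp
  moreover have "measure lborel (ball x d) > 0" using content_ball_pos[OF d(1)] by simp
  ultimately show False using pos by (simp add: mult_le_0_iff)
qed

lemma mult_frac_le:
  fixes e V :: real
  assumes "0 \<le> e" "0 \<le> V" shows "e / (V + 1) * V \<le> e"
  using assms by (simp add: field_simps)

text \<open>Translation invariance takes the place of integration along lines: F(x + t e_i) and F(x)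
  have equal integrals, so t times the integral in question is, up to sign, the integral of a
  first-order remainder, which is at most e t and lives on a fixed ball.\<close>

lemma integral_partial_eq_0:
  fixes F :: "real^'n \<Rightarrow> 'b::euclidean_space"
  assumes F: "Ck_on 1 UNIV F" "supported r F"
  shows "(LBINT x. partial i F x) = 0"
proof -
  let ?V = "measure lborel (cball (0::real^'n) (r + 1))"
  have c: "has_partials_on UNIV F" "continuous_on UNIV (partial i F)" "continuous_on UNIV F"
    using F(1) by auto
  note z = supported_partial[OF F(2)]
  have intF: "integrable lborel F" and intP: "integrable lborel (partial i F)"
    using c z F(2) by (auto intro!: integrable_continuous_compact_support[of _ r])
  have le: "norm (LBINT x. partial i F x) \<le> e * ?V" if e: "e > 0" for e
  proof -
    obtain d where d: "d > 0" "\<And>x y. norm (x - y) < d \<Longrightarrow> norm (partial i F x - partial i F y) < e"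
      using uniformly_continuous_compact_support[OF c(2) z e] by blast
    \<comment> \<open>t \<le> 1 keeps the translated support inside the ball of radius r + 1,
      independently of e.\<close>
    define t where "t = min (d / 2) 1"
    have t: "t > 0" "t < d" "t \<le> 1" using d(1) by (auto simp: t_def)
    let ?h = "\<lambda>x. F (t *\<^sub>R axis i 1 + x) - F x - t *\<^sub>R partial i F x"
    have int: "integrable lborel (\<lambda>x. F (t *\<^sub>R axis i 1 + x))"
    proof (rule integrable_continuous_compact_support[of _ "r + 1"])
      show "continuous_on UNIV (\<lambda>x. F (t *\<^sub>R axis i 1 + x))"
        by (intro continuous_on_compose2[OF c(3)] continuous_intros) auto
      show "supported (r + 1) (\<lambda>x. F (t *\<^sub>R axis i 1 + x))"
      proof (intro allI impI)
        fix x :: "real^'n" assume "norm x > r + 1"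
        then have "norm (t *\<^sub>R axis i 1 + x) > r"
          using norm_triangle_ineq4[of "t *\<^sub>R axis i 1 + x" "t *\<^sub>R axis i (1::real)"] t by simp
        then show "F (t *\<^sub>R axis i 1 + x) = 0" using F(2) by blast
      qed
    qed
    have pw: "norm (?h x) \<le> e * t * indicator (cball 0 (r + 1)) x" for x
    proof (cases "norm x \<le> r + 1")
      case True
      have "norm (F (x + t *\<^sub>R axis i 1) - F x - t *\<^sub>R partial i F x) \<le> e * \<bar>t\<bar>"
        by (rule partial_increment[OF c(1)]) (use d(2) t in \<open>auto intro!: less_imp_le\<close>)
      then show ?thesis using True t by (simp add: add.commute)
    next
      case False
      then have "norm (t *\<^sub>R axis i 1 + x) > r"
        using norm_triangle_ineq4[of "t *\<^sub>R axis i 1 + x" "t *\<^sub>R axis i (1::real)"] t by simp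
      then show ?thesis using False F(2) z by simp
    qed
    have "norm (LBINT x. ?h x) \<le> (LBINT x. norm (?h x))"
      by (rule integral_norm_bound)
    also have "\<dots> \<le> (LBINT x. e * t * indicator (cball 0 (r + 1)) (x::real^'n))"
    proof (rule integral_mono)
      show "integrable lborel (\<lambda>x. norm (?h x))"
        by (intro integrable_norm Bochner_Integration.integrable_diff integrable_scaleR_right int intF intP)
      show "integrable lborel (\<lambda>x. e * t * indicator (cball 0 (r + 1)) (x::real^'n))"
        by (intro integrable_mult_right integrable_real_indicator)
          (auto intro: emeasure_bounded_finite[unfolded infinity_ennreal_def])
    qed (rule pw)
    finally have "norm (LBINT x. ?h x) \<le> e * t * ?V" by simp
    moreover have "(LBINT x. ?h x) = - (t *\<^sub>R (LBINT x. partial i F x))"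
      using int intF intP lborel_integral_shift[of F "t *\<^sub>R axis i 1"] c(3)
      by (simp add: borel_measurable_continuous_onI)
    ultimately show ?thesis using t by (simp add: mult.assoc mult.left_commute[of e t])
  qed
  have "norm (LBINT x. partial i F x) \<le> 0"
  proof (rule field_le_epsilon)
    fix e :: real assume "e > 0"
    then have "norm (LBINT x. partial i F x) \<le> e / (?V + 1) * ?V"
      by (intro le divide_pos_pos add_nonneg_pos) auto
    also have "\<dots> \<le> e" using \<open>e > 0\<close> by (intro mult_frac_le) auto
    finally show "norm (LBINT x. partial i F x) \<le> 0 + e" by simp
  qed
  then show ?thesis by simp
qed

text \<open>The y-derivative of g(x - y) f(y) integrates to 0, which moves the derivative from the
  kernel to f. Mollification therefore approximates a function and its partials
  simultaneously.\<close>

lemma partial_conv: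
  fixes f :: "real^'n \<Rightarrow> 'b::euclidean_space"
  assumes g: "Ck_on 1 UNIV g" "supported s g"
    and f: "Ck_on 1 UNIV f" "supported r f"
  shows "partial i (conv g f) x = conv g (partial i f) x"
proof -
  let ?D = "\<lambda>y h. g (x - y) *\<^sub>R total_deriv f y h +
      (- (total_deriv g (x - y) h)) *\<^sub>R f y"
  have cg: "continuous_on UNIV g" "continuous_on UNIV (partial i g)"
    and cf: "continuous_on UNIV f" "continuous_on UNIV (partial i f)" for i
    using f(1) g(1) by auto
  have dg: "((\<lambda>y. g (x - y)) has_derivative (\<lambda>h. - (total_deriv g (x - y) h))) (at y)" for y
  proof -
    have "((\<lambda>y. x - y) has_derivative (\<lambda>h. - h)) (at y)"
      by (auto intro!: derivative_eq_intros)
    from has_derivative_compose[OF this Ck_on_one_has_derivative[OF g(1)[unfolded One_nat_def]]]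
    show ?thesis by (simp add: sum_negf)
  qed
  have D: "((\<lambda>y. g (x - y) *\<^sub>R f y) has_derivative ?D y) (at y)" for y
    by (rule has_derivative_scaleR[OF dg Ck_on_one_has_derivative[OF f(1)[unfolded One_nat_def]]])
  have "Ck_on 1 UNIV (\<lambda>y. g (x - y) *\<^sub>R f y)"
    by (rule C1I[OF D]) (unfold axis_sum_scaleR, intro continuous_intros
        continuous_on_compose2[OF cg(1)] continuous_on_compose2[OF cg(2)] cf subset_UNIV)
  then have "(LBINT y. partial i (\<lambda>y. g (x - y) *\<^sub>R f y) y) = 0"
    by (rule integral_partial_eq_0[where r = r]) (simp add: f(2))
  then have 0: "(LBINT y. g (x - y) *\<^sub>R partial i f y - partial i g (x - y) *\<^sub>R f y) = 0"
    unfolding partial_has_derivative[OF D] axis_sum_scaleR by simp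
  have "(LBINT y. g (x - y) *\<^sub>R partial i f y) = (LBINT y. partial i g (x - y) *\<^sub>R f y)"
  proof -
    have "integrable lborel (\<lambda>y. g (x - y) *\<^sub>R partial i f y)"
      by (rule integrable_conv[OF cg(1) cf(2) supported_partial[OF f(2)]])
    moreover have "integrable lborel (\<lambda>y. partial i g (x - y) *\<^sub>R f y)"
      by (rule integrable_conv[OF cg(2) cf(1) f(2)])
    ultimately show ?thesis using 0 by simp
  qed
  moreover have "partial i (conv g f) x = conv (partial i g) f x"
    by (rule partial_eqI[OF has_vector_derivative_conv[OF g cf(1) f(2)]])
  ultimately show ?thesis by (simp add: conv_def)
qed

section \<open>Mollifiers and the approximation of C^1 functions in W^{1,2}\<close>

definition mollifier :: "nat \<Rightarrow> real^'n::finite \<Rightarrow> real" where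
  "mollifier k x = bump k x / (LBINT y. bump k (y::real^'n))"

lemma continuous_on_bump: "continuous_on UNIV (bump k)"
  using Ck_on_bump by (rule Ck_on_continuous)

lemma integrable_bump:
  assumes "k > 0" shows "integrable lborel (bump k :: real^'n \<Rightarrow> real)"
  by (rule integrable_continuous_compact_support[of _ "1 / real k", OF continuous_on_bump])
    (simp add: bump_eq_0 assms)

lemma integral_bump_pos:
  assumes "k > 0" shows "(LBINT y. bump k (y::real^'n)) > 0"
  using continuous_nonneg_integral_le_0[OF continuous_on_bump bump_nonneg integrable_bump[OF assms], where x = "0::real^'n"]
    bump_0_pos[of k, where 'a = 'n] by (force simp: not_le)

lemma Ck_on_mollifier: "Ck_on j UNIV (mollifier k :: real^'n \<Rightarrow> real)"
  using Ck_on_scaleR[OF Ck_on_const[of j "inverse (LBINT y. bump k (y::real^'n))"] Ck_on_bump]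
  unfolding mollifier_def[abs_def] by (simp add: field_simps)

lemma supported_mollifier: "k > 0 \<Longrightarrow> supported (1 / real k) (mollifier k)"
  by (simp add: mollifier_def bump_eq_0)

lemma mollifier_nonneg: "mollifier k x \<ge> 0"
  by (simp add: mollifier_def bump_nonneg)

lemma integral_mollifier:
  fixes x :: "real^'n"
  assumes "k > 0"
  shows "integrable lborel (\<lambda>y. mollifier k (x - y))" and "(LBINT y. mollifier k (x - y)) = 1"
proof -
  have c: "continuous_on UNIV (mollifier k :: real^'n \<Rightarrow> real)"
    using Ck_on_mollifier by (rule Ck_on_continuous)
  show "integrable lborel (\<lambda>y. mollifier k (x - y))"
  proof (rule integrable_continuous_compact_support[of _ "norm x + 1 / real k"])
    show "continuous_on UNIV (\<lambda>y. mollifier k (x - y))"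
      by (intro continuous_on_compose2[OF c] continuous_intros) auto
    show "supported (norm x + 1 / real k) (\<lambda>y. mollifier k (x - y))"
    proof (intro allI impI)
      fix y :: "real^'n" assume "norm y > norm x + 1 / real k"
      then have "norm (x - y) > 1 / real k"
        using norm_triangle_ineq2[of y x] by (simp add: norm_minus_commute)
      then show "mollifier k (x - y) = 0" using supported_mollifier[OF assms] by blast
    qed
  qed
  have "(LBINT y. mollifier k (x - y)) = (LBINT y. mollifier k (- x + y))"
    by (simp add: mollifier_def bump_minus[of k x])
  also have "\<dots> = (LBINT y. mollifier k (y::real^'n))"
    by (rule lborel_integral_shift) (rule borel_measurable_continuous_onI[OF c])
  also have "\<dots> = 1"
    using integral_bump_pos[OF assms, where 'n = 'n] by (simp add: mollifier_def)
  finally show "(LBINT y. mollifier k (x - y)) = 1" .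
qed

text \<open>The kernel has mass 1, so the difference is an average of f(y) - f(x) over |x - y| \<le>
  1/k; uniform continuity makes it uniformly small.\<close>

lemma conv_mollifier_tendsto:
  fixes f :: "real^'n \<Rightarrow> 'b::euclidean_space"
  assumes f: "continuous_on UNIV f" "supported r f" and "e > 0"
  shows "\<exists>K. \<forall>k\<ge>K. k > 0 \<longrightarrow> (\<forall>x. norm (conv (mollifier k) f x - f x) \<le> e)"
proof -
  obtain d where d: "d > 0" "\<And>x y. norm (x - y) < d \<Longrightarrow> norm (f x - f y) < e"
    using uniformly_continuous_compact_support[OF f \<open>e > 0\<close>] by blast
  obtain K where K: "inverse (real (Suc K)) < d" using reals_Archimedean[OF d(1)] by blast
  have "norm (conv (mollifier k) f x - f x) \<le> e" if k: "k \<ge> Suc K" "k > 0" for k x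
  proof -
    have kd: "1 / real k < d"
      using K k by (smt (verit) frac_le inverse_eq_divide of_nat_0_less_iff of_nat_le_iff zero_less_Suc)
    have i1: "integrable lborel (\<lambda>y. mollifier k (x - y) *\<^sub>R f y)"
      by (rule integrable_conv[OF Ck_on_continuous[OF Ck_on_mollifier] f])
    note m = integral_mollifier[OF k(2), of x]
    have i2: "integrable lborel (\<lambda>y. mollifier k (x - y) *\<^sub>R f x)"
      by (rule integrable_scaleR_left) (rule m(1))
    have eq: "conv (mollifier k) f x - f x = (LBINT y. mollifier k (x - y) *\<^sub>R (f y - f x))"
      unfolding conv_def scaleR_diff_right using i1 i2 m by simp
    have "norm (conv (mollifier k) f x - f x) \<le> (LBINT y. norm (mollifier k (x - y) *\<^sub>R (f y - f x)))"
      unfolding eq by (rule integral_norm_bound)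
    also have "\<dots> \<le> (LBINT y. mollifier k (x - y) * e)"
    proof (rule integral_mono)
      show "integrable lborel (\<lambda>y. norm (mollifier k (x - y) *\<^sub>R (f y - f x)))"
        using i1 i2 by (intro integrable_norm) (simp add: scaleR_diff_right)
      show "integrable lborel (\<lambda>y. mollifier k (x - y) * e)"
        using m(1) by simp
      fix y
      show "norm (mollifier k (x - y) *\<^sub>R (f y - f x)) \<le> mollifier k (x - y) * e"
      proof (cases "norm (x - y) > 1 / real k")
        case True
        then have "mollifier k (x - y) = 0" using supported_mollifier[OF k(2)] by blast
        then show ?thesis by simp
      next
        case False
        then have "norm (f y - f x) < e" using d(2)[of y x] kd by (simp add: norm_minus_commute)
        then show ?thesis using mollifier_nonneg[of k "x - y"] by (simp add: mult_left_mono)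
      qed
    qed
    also have "\<dots> = e" using m by simp
    finally show ?thesis .
  qed
  then show ?thesis by blast
qed

lemma supported_conv:
  fixes f :: "real^'n \<Rightarrow> 'b::euclidean_space"
  assumes "supported s g" "supported r f"
  shows "supported (r + s) (conv g f)"
proof (intro allI impI)
  fix x :: "real^'n" assume x: "norm x > r + s"
  have "g (x - y) *\<^sub>R f y = 0" for y
  proof (cases "norm y > r")
    case False
    then have "norm (x - y) > s" using x norm_triangle_ineq2[of x y] by linarith
    then show ?thesis by (simp add: assms(1))
  qed (simp add: assms(2))
  then have "(\<lambda>y. g (x - y) *\<^sub>R f y) = (\<lambda>_. 0)" by blast
  then show "conv g f x = 0" by (simp add: conv_def)
qed

lemma L2_sq_le:
  assumes "\<And>x. norm (f x) \<le> e" "e \<ge> 0" "\<Omega> \<in> sets lebesgue"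
  shows "L2_sq \<Omega> f \<le> ennreal (e\<^sup>2) * emeasure lebesgue \<Omega>"
proof -
  have "L2_sq \<Omega> f \<le> (\<integral>\<^sup>+ x. ennreal (e\<^sup>2) \<partial>(lebesgue_on \<Omega>))"
    unfolding L2_sq_def using assms(1,2) by (intro nn_integral_mono ennreal_leI power_mono) auto
  also have "\<dots> = ennreal (e\<^sup>2) * emeasure lebesgue \<Omega>"
    using assms(3) by (simp add: emeasure_restrict_space)
  finally show ?thesis .
qed

lemma L2_sq_tendsto_0:
  assumes unif: "\<And>e. e > 0 \<Longrightarrow> \<exists>K. \<forall>k\<ge>K. \<forall>x. norm (f k x) \<le> e"
    and \<Omega>: "\<Omega> \<in> sets lebesgue" "emeasure lebesgue \<Omega> < \<infinity>"
  shows "(\<lambda>k. L2_sq \<Omega> (f k)) \<longlonglongrightarrow> 0"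
proof (rule order_tendstoI)
  fix a :: ennreal assume "a > 0"
  define V where "V = measure lebesgue \<Omega>"
  have V: "emeasure lebesgue \<Omega> = ennreal V"
    using \<Omega>(2) by (simp add: V_def emeasure_eq_ennreal_measure)
  obtain \<delta> where \<delta>: "\<delta> > 0" "ennreal \<delta> < a"
  proof -
    \<comment> \<open>a may be infinite; a value strictly between 0 and a is finite and hence given
      by a real number.\<close>
    obtain b where b: "0 < b" "b < a" using dense[OF \<open>a > 0\<close>] by blast
    then have "b < \<infinity>" using order.strict_trans2[OF b(2), of \<infinity>] by simp
    then obtain c where "b = ennreal c" "c \<ge> 0" by (metis ennreal_cases infinity_ennreal_def less_irrefl)
    then show ?thesis using b that[of c] by simp
  qed
  \<comment> \<open>Chosen so that e^2 V \<le> \<delta>.\<close>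
  define e where "e = sqrt (\<delta> / (V + 1))"
  have V0: "V \<ge> 0" by (simp add: V_def)
  then have e: "e > 0" "e\<^sup>2 = \<delta> / (V + 1)" using \<delta>(1) by (auto simp: e_def)
  obtain K where K: "\<And>k x. k \<ge> K \<Longrightarrow> norm (f k x) \<le> e" using unif[OF e(1)] by blast
  have "L2_sq \<Omega> (f k) < a" if "k \<ge> K" for k
  proof -
    have "L2_sq \<Omega> (f k) \<le> ennreal (e\<^sup>2) * emeasure lebesgue \<Omega>"
      using K that e(1) \<Omega>(1) by (intro L2_sq_le) auto
    also have "\<dots> = ennreal (e\<^sup>2 * V)" using V0 by (simp add: V ennreal_mult)
    also have "\<dots> \<le> ennreal \<delta>" using V0 \<delta>(1) by (intro ennreal_leI) (simp add: e field_simps)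
    finally show ?thesis using \<delta>(2) by simp
  qed
  then show "\<forall>\<^sub>F k in sequentially. L2_sq \<Omega> (f k) < a"
    unfolding eventually_sequentially by blast
qed simp

lemma continuous_compact_support_bounded:
  fixes f :: "real^'n \<Rightarrow> 'b::euclidean_space"
  assumes "continuous_on UNIV f" "supported r f"
  shows "\<exists>B\<ge>0. \<forall>x. norm (f x) \<le> B"
proof -
  have "bounded (f ` cball 0 r)"
    using assms(1) by (intro compact_imp_bounded compact_continuous_image) (auto intro: continuous_on_subset)
  then obtain B where B: "\<And>x. norm x \<le> r \<Longrightarrow> norm (f x) \<le> B"
    unfolding bounded_iff by (metis image_eqI mem_cball_0)
  have "norm (f x) \<le> max B 0" for x
    using B[of x] assms(2) by (cases "norm x > r") auto
  then show ?thesis by (intro exI[of _ "max B 0"]) auto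
qed

lemma borel_measurable_lebesgue_on_continuous:
  fixes f :: "real^'n \<Rightarrow> 'b::euclidean_space"
  assumes "continuous_on UNIV f"
  shows "f \<in> borel_measurable (lebesgue_on \<Omega>)"
  by (intro measurable_restrict_space1 measurable_completion) (simp add: borel_measurable_continuous_onI assms)

text \<open>\<open>W120\<close> admits only limits of smooth test functions, whereas the competitors
  below are C^1; their mollifications supply the approximating sequence.\<close>

lemma W120_C1:
  fixes \<phi> :: "real^'n \<Rightarrow> real^'m"
  assumes \<phi>: "Ck_on 1 UNIV \<phi>" "supported r \<phi>" and "r < R"
  shows "W120 (ball 0 R) \<phi> (\<lambda>i. partial i \<phi>)"
proof -
  \<comment> \<open>Starting the sequence at \<open>k0\<close> keeps the mollified supports,
    enlarged by less than R - r, compactly inside the open ball.\<close>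
  obtain k0 where k0: "inverse (real (Suc k0)) < R - r" using reals_Archimedean[of "R - r"] \<open>r < R\<close> by auto
  define \<psi> where "\<psi> k = conv (mollifier (Suc (k + k0))) \<phi>" for k
  have c: "continuous_on UNIV \<phi>" "\<And>i. continuous_on UNIV (partial i \<phi>)" using \<phi>(1) by auto
  note z = supported_partial[OF \<phi>(2)]
  have \<Omega>: "ball (0::real^'n) R \<in> sets lebesgue" "emeasure lebesgue (ball (0::real^'n) R) < \<infinity>"
    using fmeasurableD2[OF bounded_set_imp_lmeasurable[OF bounded_ball]]
    by (auto simp: top.not_eq_extremum)
  have fin: "L2_sq (ball 0 R) f < \<infinity>" if f: "continuous_on UNIV f" "supported r f"
    for f :: "real^'n \<Rightarrow> real^'m"
  proof -
    obtain B where "B \<ge> 0" "\<And>x. norm (f x) \<le> B" using continuous_compact_support_bounded[OF f] by blast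
    then have "L2_sq (ball 0 R) f \<le> ennreal (B\<^sup>2) * emeasure lebesgue (ball (0::real^'n) R)"
      using \<Omega> by (intro L2_sq_le) auto
    also have "\<dots> < \<infinity>" using \<Omega>(2) by (simp add: ennreal_mult_less_top)
    finally show ?thesis .
  qed
  have unif: "\<exists>K. \<forall>k\<ge>K. \<forall>x. norm (conv (mollifier (Suc (k + k0))) f x - f x) \<le> e"
    if f: "continuous_on UNIV f" "supported r f" and "e > 0" for f :: "real^'n \<Rightarrow> real^'m" and e
  proof -
    obtain K where "\<forall>k\<ge>K. k > 0 \<longrightarrow> (\<forall>x. norm (conv (mollifier k) f x - f x) \<le> e)"
      using conv_mollifier_tendsto[OF f \<open>e > 0\<close>] by blast
    then show ?thesis by (intro exI[of _ K]) auto
  qed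
  have "Cc_inf (ball 0 R) (\<psi> k)" for k
  proof -
    have "{x. \<psi> k x \<noteq> 0} \<subseteq> cball 0 (r + 1 / real (Suc (k + k0)))"
      using supported_conv[OF supported_mollifier[OF zero_less_Suc] \<phi>(2), of "k + k0"] by (force simp: \<psi>_def not_le)
    then have sub: "closure {x. \<psi> k x \<noteq> 0} \<subseteq> cball 0 (r + 1 / real (Suc (k + k0)))"
      by (rule closure_minimal) simp
    have "1 / real (Suc (k + k0)) \<le> inverse (real (Suc k0))" by (simp add: field_simps)
    then have "cball 0 (r + 1 / real (Suc (k + k0))) \<subseteq> ball (0::real^'n) R" using k0 by auto
    moreover have "Cinf_on UNIV (\<psi> k)"
      unfolding Cinf_on_def \<psi>_def
      using Ck_on_conv[OF Ck_on_mollifier supported_mollifier[OF zero_less_Suc] c(1) \<phi>(2)] by blast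
    moreover have "compact (closure {x. \<psi> k x \<noteq> 0})"
      using sub by (metis bounded_cball bounded_subset closed_closure compact_eq_bounded_closed)
    ultimately show ?thesis using sub unfolding Cc_inf_def by blast
  qed
  moreover have "(\<lambda>k. L2_sq (ball 0 R) (\<lambda>x. \<psi> k x - \<phi> x)) \<longlonglongrightarrow> 0"
    using unif[OF c(1) \<phi>(2)] unfolding \<psi>_def by (rule L2_sq_tendsto_0[OF _ \<Omega>])
  moreover have "(\<lambda>k. L2_sq (ball 0 R) (\<lambda>x. partial i (\<psi> k) x - partial i \<phi> x)) \<longlonglongrightarrow> 0" for i
    unfolding \<psi>_def partial_conv[OF Ck_on_mollifier supported_mollifier[OF zero_less_Suc] \<phi>]
    using unif[OF c(2) z] by (rule L2_sq_tendsto_0[OF _ \<Omega>])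
  ultimately show ?thesis
    unfolding W120_def using c fin[OF c(1) \<phi>(2)] fin[OF c(2) z]
    by (auto intro!: borel_measurable_lebesgue_on_continuous)
qed

lemma smooth_bounded_domain_ball:
  assumes "R > 0" shows "smooth_bounded_domain (ball (0::real^'n) R)"
  unfolding smooth_bounded_domain_def
proof (intro conjI ballI)
  fix p :: "real^'n" assume "p \<in> frontier (ball 0 R)"
  then have p: "norm p = R" using assms by simp
  let ?\<rho> = "\<lambda>x::real^'n. (norm x)\<^sup>2 + - (R\<^sup>2)"
  have "((\<lambda>x::real^'n. (norm x)\<^sup>2 + - (R\<^sup>2)) has_derivative (\<lambda>h. 2 * (x \<bullet> h))) (at x)" for x
    unfolding power2_norm_eq_inner by (auto intro!: derivative_eq_intros simp: inner_commute)
  from partial_has_derivative[OF this] have g: "grad ?\<rho> x = 2 *\<^sub>R x" for x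
    by (simp add: grad_def vec_eq_iff inner_axis)
  show "\<exists>r>0. \<exists>\<rho>. Cinf_on (ball p r) \<rho> \<and> (\<forall>x\<in>ball p r. grad \<rho> x \<noteq> 0) \<and>
      ball 0 R \<inter> ball p r = {x \<in> ball p r. \<rho> x < 0}"
  \<comment> \<open>The gradient 2 x of the defining function vanishes only at the origin, which the
    ball of radius R about p leaves out.\<close>
  proof (intro exI[of _ R] exI[of _ ?\<rho>] conjI ballI assms)
    show "Cinf_on (ball p R) ?\<rho>"
      unfolding Cinf_on_def by (intro allI Ck_on_subset[OF Ck_on_add[OF Ck_on_norm_sq Ck_on_const]]) auto
    show "grad ?\<rho> x \<noteq> 0" if "x \<in> ball p R" for x
      using that p unfolding g by auto
    have "norm x < R \<longleftrightarrow> (norm x)\<^sup>2 + - (R\<^sup>2) < 0" for x :: "real^'n"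
    proof -
      have "norm x < R \<longleftrightarrow> (norm x)\<^sup>2 < R\<^sup>2"
        using assms power_mono_iff[of R "norm x" 2] by (meson less_imp_le not_le norm_ge_zero zero_less_numeral)
      then show ?thesis by linarith
    qed
    then show "ball 0 R \<inter> ball p R = {x \<in> ball p R. ?\<rho> x < 0}" by (simp add: set_eq_iff conj_commute)
  qed
qed (use assms in auto)

section \<open>Competitors and minimality\<close>

definition energy_density :: "(real^'m::finite \<Rightarrow> real) \<Rightarrow> (real^'n::finite \<Rightarrow> real^'m) \<Rightarrow> real^'n \<Rightarrow> real" where
  "energy_density W v x = (1/2) * grad_sq v x + W (v x)"

lemma continuous_on_grad_sq:
  assumes "Ck_on 1 UNIV v" shows "continuous_on UNIV (grad_sq v)"
  unfolding grad_sq_def[abs_def] using assms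
  by (auto intro!: continuous_on_sum continuous_on_power continuous_on_norm)

lemma continuous_on_energy_density:
  assumes "continuous_on UNIV W" "Ck_on 1 UNIV v"
  shows "continuous_on UNIV (energy_density W v)"
  unfolding energy_density_def[abs_def]
  by (intro continuous_on_add continuous_on_mult continuous_on_const continuous_on_grad_sq assms
      continuous_on_compose2[OF assms(1) Ck_on_continuous[OF assms(2)]]) auto

lemma grad_sq_nonneg: "grad_sq v x \<ge> 0"
  by (simp add: grad_sq_def sum_nonneg)

lemma integrable_indicator_continuous:
  fixes f :: "real^'n \<Rightarrow> real"
  assumes "continuous_on UNIV f" "S \<subseteq> cball 0 r" "S \<in> sets borel"
  shows "integrable lborel (\<lambda>x. indicator S x * f x)"
proof -
  have "integrable lborel (\<lambda>x. indicator (cball 0 r) x *\<^sub>R f x)"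
    using assms(1) by (intro borel_integrable_compact) (auto intro: continuous_on_subset)
  then have "integrable lborel (\<lambda>x. indicator S x *\<^sub>R (indicator (cball 0 r) x *\<^sub>R f x))"
    using assms(3) by (intro integrable_mult_indicator[where M = lborel and A = S]) simp_all
  also have "(\<lambda>x. indicator S x *\<^sub>R (indicator (cball 0 r) x *\<^sub>R f x)) = (\<lambda>x. indicator S x * f x)"
    using assms(2) by (auto simp: indicator_def fun_eq_iff)
  finally show ?thesis .
qed

lemma energy_eq_integral:
  assumes W: "continuous_on UNIV W" "\<And>y. W y \<ge> 0" and v: "Ck_on 1 UNIV v"
    and Dv: "\<And>i x. Dv i x = partial i v x"
  shows "energy W (ball 0 R) v Dv = ennreal (LBINT x. indicator (ball 0 R) x * energy_density W v x)"
proof -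
  have "energy W (ball 0 R) v Dv = (\<integral>\<^sup>+ x. ennreal (energy_density W v x) \<partial>(lebesgue_on (ball 0 R)))"
    by (simp add: energy_def energy_density_def grad_sq_def Dv)
  also have "\<dots> = (\<integral>\<^sup>+ x. ennreal (energy_density W v x) * indicator (ball 0 R) x \<partial>lebesgue)"
    by (intro nn_integral_restrict_space) auto
  also have "\<dots> = (\<integral>\<^sup>+ x. ennreal (indicator (ball 0 R) x * energy_density W v x) \<partial>lborel)"
    unfolding nn_integral_completion by (intro nn_integral_cong) (auto simp: indicator_def)
  also have "\<dots> = ennreal (LBINT x. indicator (ball 0 R) x * energy_density W v x)"
    using W(2) by (intro nn_integral_eq_integral integrable_indicator_continuous[of _ _ R]
        continuous_on_energy_density W v)
      (auto simp: energy_density_def grad_sq_nonneg intro!: AE_I2)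
  finally show ?thesis .
qed

lemma partial_add:
  assumes "Ck_on 1 UNIV f" "Ck_on 1 UNIV g"
  shows "partial i (\<lambda>x. f x + g x) x = partial i f x + partial i g x"
  using partial_has_derivative[OF has_derivative_add[OF Ck_on_one_has_derivative[of 0 f x]
        Ck_on_one_has_derivative[of 0 g x]], of i] assms by simp

section \<open>C^1 cutoffs between the radii N and N + 1\<close>

definition sqpos :: "real \<Rightarrow> real" where "sqpos t = (max 0 t)\<^sup>2"

lemma sqpos_has_derivative: "(sqpos has_real_derivative 2 * max 0 t) (at t)"
proof -
  consider "t > 0" | "t < 0" | "t = 0" by linarith
  then show ?thesis
  proof cases
    case 1
    have "((\<lambda>t. t\<^sup>2) has_real_derivative 2 * max 0 t) (at t)"
      using 1 by (auto intro!: derivative_eq_intros)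
    then show ?thesis
      by (rule has_field_derivative_transform_within_open[of _ _ _ "{0<..}"]) (use 1 in \<open>auto simp: sqpos_def\<close>)
  next
    case 2
    have "((\<lambda>t. 0) has_real_derivative 2 * max 0 t) (at t)" using 2 by simp
    then show ?thesis
      by (rule has_field_derivative_transform_within_open[of _ _ _ "{..<0}"]) (use 2 in \<open>auto simp: sqpos_def\<close>)
  next
    case 3
    have "((\<lambda>h. max 0 h) \<longlongrightarrow> 0) (at (0::real))"
      using tendsto_max[OF tendsto_const tendsto_ident_at, of "0::real" 0 UNIV] by simp
    then have "((\<lambda>h. (sqpos (0 + h) - sqpos 0) / h) \<longlongrightarrow> 0) (at 0)"
      by (rule Lim_transform_eventually)
        (auto simp: sqpos_def eventually_at_filter max_def power2_eq_square)
    then show ?thesis using 3 by (simp add: DERIV_def)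
  qed
qed

lemma sqpos_bounds: "0 \<le> sqpos t" "t \<le> 0 \<Longrightarrow> sqpos t = 0" "t \<ge> 1 \<Longrightarrow> sqpos t \<ge> 1"
  "t \<le> 1 \<Longrightarrow> sqpos t \<le> 1"
  by (auto simp: sqpos_def max_def abs_square_le_1 one_le_power)

text \<open>Using the squared positive part twice gives a C^1 step from 1 to 0: the inner copy
  flattens it at t = 0, the outer one at t = 1.\<close>

definition step_fun :: "real \<Rightarrow> real" where "step_fun t = sqpos (1 - sqpos t)"
definition step_fun' :: "real \<Rightarrow> real" where "step_fun' t = - (4 * max 0 (1 - sqpos t) * max 0 t)"

lemma step_fun_has_derivative: "(step_fun has_real_derivative step_fun' t) (at t)"
proof -
  have "((\<lambda>t. 1 - sqpos t) has_real_derivative - (2 * max 0 t)) (at t)"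
    by (auto intro!: derivative_eq_intros sqpos_has_derivative)
  from DERIV_chain2[OF sqpos_has_derivative this]
  show ?thesis unfolding step_fun_def[abs_def] step_fun'_def by (simp add: mult_ac)
qed

lemma continuous_on_sqpos: "continuous_on UNIV sqpos"
  unfolding sqpos_def[abs_def] by (intro continuous_intros)

lemma continuous_on_step_fun: "continuous_on UNIV step_fun" "continuous_on UNIV step_fun'"
  unfolding step_fun_def[abs_def] step_fun'_def[abs_def]
  by (intro continuous_intros continuous_on_compose2[OF continuous_on_sqpos] subset_UNIV continuous_on_sqpos)+

lemma step_fun_bounds:
  "0 \<le> step_fun t" "step_fun t \<le> 1" "\<bar>step_fun' t\<bar> \<le> 4" "step_fun' t \<le> 0"
  "t \<le> 0 \<Longrightarrow> step_fun t = 1" "t \<ge> 1 \<Longrightarrow> step_fun t = 0" "t \<le> 0 \<or> t \<ge> 1 \<Longrightarrow> step_fun' t = 0"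
proof -
  show "0 \<le> step_fun t" "step_fun t \<le> 1"
    by (auto simp: step_fun_def sqpos_bounds)
  show "t \<le> 0 \<Longrightarrow> step_fun t = 1" by (simp add: step_fun_def sqpos_bounds) (simp add: sqpos_def)
  show "t \<ge> 1 \<Longrightarrow> step_fun t = 0" using sqpos_bounds(3)[of t] by (simp add: step_fun_def sqpos_bounds)
  show z: "t \<le> 0 \<or> t \<ge> 1 \<Longrightarrow> step_fun' t = 0" using sqpos_bounds(3)[of t] by (auto simp: step_fun'_def)
  show "step_fun' t \<le> 0" by (simp add: step_fun'_def)
  show "\<bar>step_fun' t\<bar> \<le> 4"
  proof (cases "t \<le> 0 \<or> t \<ge> 1")
    case False
    then have "max 0 (1 - sqpos t) * max 0 t \<le> 1 * 1"
      using sqpos_bounds(1)[of t] by (intro mult_mono) auto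
    then show ?thesis by (simp add: step_fun'_def abs_mult)
  qed (use z in simp)
qed

text \<open>The step is taken in |x|^2 so that the cutoff is differentiable at the origin; (N + 1)^2
  - N^2 = 2 N + 1 normalises the transition.\<close>

definition cutoff :: "nat \<Rightarrow> real^'n::finite \<Rightarrow> real" where
  "cutoff N x = step_fun (((norm x)\<^sup>2 - (real N)\<^sup>2) / (2 * real N + 1))"
definition cutoff' :: "nat \<Rightarrow> real^'n::finite \<Rightarrow> real^'n \<Rightarrow> real" where
  "cutoff' N x h = step_fun' (((norm x)\<^sup>2 - (real N)\<^sup>2) / (2 * real N + 1)) * (2 * (x \<bullet> h) / (2 * real N + 1))"

lemma cutoff_has_derivative: "(cutoff N has_derivative cutoff' N x) (at x)"
proof -
  have "((\<lambda>x. ((norm x)\<^sup>2 - (real N)\<^sup>2) / (2 * real N + 1)) has_derivative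
      (\<lambda>h. 2 * (x \<bullet> h) / (2 * real N + 1))) (at x)"
    unfolding power2_norm_eq_inner by (auto intro!: derivative_eq_intros simp: inner_commute)
  from has_derivative_compose[OF this step_fun_has_derivative[unfolded has_field_derivative_def]]
  show ?thesis unfolding cutoff_def[abs_def] cutoff'_def[abs_def] by simp
qed

lemma continuous_on_cutoff:
  fixes h :: "real^'n"
  shows "continuous_on UNIV (cutoff N :: real^'n \<Rightarrow> real)" "continuous_on UNIV (\<lambda>x. cutoff' N x h)"
proof -
  have c: "continuous_on UNIV (\<lambda>x::real^'n. ((norm x)\<^sup>2 - (real N)\<^sup>2) / (2 * real N + 1))"
    by (intro continuous_intros) auto
  show "continuous_on UNIV (cutoff N :: real^'n \<Rightarrow> real)"
    unfolding cutoff_def[abs_def] by (intro continuous_on_compose2[OF continuous_on_step_fun(1) c]) auto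
  show "continuous_on UNIV (\<lambda>x::real^'n. cutoff' N x h)"
    unfolding cutoff'_def
    by (intro continuous_on_mult continuous_on_compose2[OF continuous_on_step_fun(2) c])
      (auto intro!: continuous_intros)
qed

lemma cutoff_props:
  fixes x :: "real^'n"
  shows "0 \<le> cutoff N x" "cutoff N x \<le> 1"
    "norm x \<le> real N \<Longrightarrow> cutoff N x = 1 \<and> cutoff' N x h = 0"
    "norm x \<ge> real N + 1 \<Longrightarrow> cutoff N x = 0 \<and> cutoff' N x h = 0"
    "\<bar>cutoff' N x h\<bar> \<le> 8 * norm h"
proof -
  show "0 \<le> cutoff N x" "cutoff N x \<le> 1" by (auto simp: cutoff_def step_fun_bounds)
  let ?t = "((norm x)\<^sup>2 - (real N)\<^sup>2) / (2 * real N + 1)"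
  show 1: "norm x \<le> real N \<Longrightarrow> cutoff N x = 1 \<and> cutoff' N x h = 0"
  proof -
    assume "norm x \<le> real N"
    then have "(norm x)\<^sup>2 \<le> (real N)\<^sup>2" by (intro power_mono) auto
    then have "?t \<le> 0" by (simp add: divide_le_0_iff)
    then show ?thesis by (simp add: cutoff_def cutoff'_def step_fun_bounds)
  qed
  show 2: "norm x \<ge> real N + 1 \<Longrightarrow> cutoff N x = 0 \<and> cutoff' N x h = 0"
  proof -
    assume "norm x \<ge> real N + 1"
    then have "(real N + 1)\<^sup>2 \<le> (norm x)\<^sup>2" by (intro power_mono) auto
    then have "?t \<ge> 1" by (simp add: pos_le_divide_eq power2_eq_square algebra_simps)
    then show ?thesis by (simp add: cutoff_def cutoff'_def step_fun_bounds)
  qed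
  show "\<bar>cutoff' N x h\<bar> \<le> 8 * norm h"
  proof (cases "norm x \<ge> real N + 1")
    case False
    have "\<bar>cutoff' N x h\<bar> = \<bar>step_fun' ?t\<bar> * (2 * \<bar>x \<bullet> h\<bar> / (2 * real N + 1))"
      by (simp add: cutoff'_def abs_mult)
    \<comment> \<open>Only |x| < N + 1 matters; (N + 1) / (2 N + 1) \<le> 1 then makes the bound 8
      |h| independent of N.\<close>
    also have "\<dots> \<le> 4 * (2 * ((real N + 1) * norm h) / (2 * real N + 1))"
    proof (intro mult_mono step_fun_bounds divide_right_mono)
      have "\<bar>x \<bullet> h\<bar> \<le> norm x * norm h" by (rule Cauchy_Schwarz_ineq2)
      also have "\<dots> \<le> (real N + 1) * norm h" using False by (intro mult_right_mono) auto
      finally show "\<bar>x \<bullet> h\<bar> \<le> (real N + 1) * norm h" .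
    qed auto
    also have "\<dots> \<le> 4 * (2 * norm h)"
      by (simp add: pos_divide_le_eq algebra_simps)
    finally show ?thesis by simp
  qed (use 2 in simp)
qed

text \<open>Covers every competitor: T is the constant a for the energy growth and a contraction for
  the level sets. \<open>DT\<close> is continuous jointly in base point and direction because both u
  and its partials vary with x.\<close>

lemma cutoff_competitor:
  fixes u :: "real^'n \<Rightarrow> real^'m"
  assumes u: "Ck_on 1 UNIV u"
    and \<eta>: "\<And>x. (\<eta> has_derivative \<eta>' x) (at x)" "\<And>h. continuous_on UNIV (\<lambda>x. \<eta>' x h)"
    and T: "\<And>y. (T has_derivative DT y) (at y)" "continuous_on UNIV (\<lambda>p. DT (fst p) (snd p))"
  shows "Ck_on 1 UNIV (\<lambda>x. \<eta> x *\<^sub>R (T (u x) - u x))" (is "Ck_on 1 UNIV ?\<phi>")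
    and "partial i (\<lambda>x. u x + \<eta> x *\<^sub>R (T (u x) - u x)) x
      = (1 - \<eta> x) *\<^sub>R partial i u x + \<eta> x *\<^sub>R DT (u x) (partial i u x) + \<eta>' x (axis i 1) *\<^sub>R (T (u x) - u x)"
proof -
  have du: "(u has_derivative total_deriv u x) (at x)" for x
    using Ck_on_one_has_derivative[of 0 u x] u by simp
  have d: "(?\<phi> has_derivative (\<lambda>h. \<eta> x *\<^sub>R (DT (u x) (total_deriv u x h) - total_deriv u x h) + \<eta>' x h *\<^sub>R (T (u x) - u x))) (at x)" for x
    by (intro has_derivative_scaleR \<eta> has_derivative_diff has_derivative_compose[OF du T(1)] du)
  have c: "continuous_on UNIV u" "continuous_on UNIV (partial i u)" for i using u by auto
  have cT: "continuous_on UNIV T" using T(1) by (auto intro!: has_derivative_continuous_on)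
  have c\<eta>: "continuous_on UNIV \<eta>" using \<eta>(1) by (auto intro!: has_derivative_continuous_on)
  have cDT: "continuous_on UNIV (\<lambda>x. DT (u x) (partial i u x))" for i
    using continuous_on_compose2[OF T(2) continuous_on_Pair[OF c(1) c(2)[of i]]] by simp
  show C1: "Ck_on 1 UNIV ?\<phi>"
    by (rule C1I[OF d]) (unfold axis_sum_scaleR, intro continuous_intros c\<eta> c cDT \<eta>(2)
        continuous_on_compose2[OF cT c(1)] subset_UNIV)
  show "partial i (\<lambda>x. u x + \<eta> x *\<^sub>R (T (u x) - u x)) x
      = (1 - \<eta> x) *\<^sub>R partial i u x + \<eta> x *\<^sub>R DT (u x) (partial i u x) + \<eta>' x (axis i 1) *\<^sub>R (T (u x) - u x)"
    unfolding partial_add[OF u C1] partial_has_derivative[OF d] axis_sum_scaleR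
    by (simp add: algebra_simps)
qed

locale single_well_minimizer =
  fixes W :: "real^'m::finite \<Rightarrow> real" and u :: "real^'n::finite \<Rightarrow> real^'m" and a :: "real^'m" and M :: real
  assumes W_C1: "Ck_on 1 UNIV W" and W_pos: "y \<noteq> a \<Longrightarrow> W y > 0" and W_a: "W a = 0"
    and u_C2: "Ck_on 2 UNIV u" and u_bdd: "norm (u x - a) \<le> M"
    and u_min: "globally_minimizing W u"
begin

lemma W_nonneg: "W y \<ge> 0"
  using W_pos[of y] W_a by (cases "y = a") auto

lemma W_cont: "continuous_on UNIV W"
  using W_C1 by (rule Ck_on_continuous)

lemma u_C1: "Ck_on 1 UNIV u"
  using u_C2 Ck_on_Suc_imp[of 1 UNIV u] by (simp add: numeral_2_eq_2)

lemma u_cont: "continuous_on UNIV u"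
  using u_C1 by (rule Ck_on_continuous)

lemma M_nonneg: "M \<ge> 0"
  using u_bdd[of 0] norm_ge_zero order_trans by blast

abbreviation e where "e \<equiv> energy_density W u"

lemma e_cont: "continuous_on UNIV e"
  by (rule continuous_on_energy_density[OF W_cont u_C1])

lemma e_nonneg: "e x \<ge> 0"
  by (simp add: energy_density_def grad_sq_nonneg W_nonneg)

text \<open>The energy of u over the whole space may be infinite, so the densities are subtracted
  before integrating; their difference vanishes off the support of the perturbation.\<close>

lemma minimality:
  assumes \<phi>: "Ck_on 1 UNIV \<phi>" "supported r \<phi>"
  defines "d \<equiv> \<lambda>x. e x - energy_density W (\<lambda>x. u x + \<phi> x) x"
  shows "integrable lborel d" and "(LBINT x. d x) \<le> 0"
proof -
  \<comment> \<open>The radius has to be positive even if r is negative, and strictly larger than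
    r.\<close>
  define R where "R = max r 0 + 1"
  let ?v = "\<lambda>x. u x + \<phi> x"
  have v: "Ck_on 1 UNIV ?v" by (rule Ck_on_add[OF u_C1 \<phi>(1)])
  have pv: "partial i ?v x = partial i u x + partial i \<phi> x" for i x
    by (rule partial_add[OF u_C1 \<phi>(1)])
  have R: "R > 0" "r < R" by (auto simp: R_def)
  have "W120 (ball 0 R) \<phi> (\<lambda>i. partial i \<phi>)" using \<phi> R by (intro W120_C1)
  moreover have "Linf (ball 0 R) \<phi>"
    using continuous_compact_support_bounded[OF Ck_on_continuous[OF \<phi>(1)] \<phi>(2)] unfolding Linf_def by auto
  ultimately have "energy W (ball 0 R) u (\<lambda>i. partial i u) \<le>
      energy W (ball 0 R) ?v (\<lambda>i x. partial i u x + partial i \<phi> x)"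
    using u_min smooth_bounded_domain_ball[OF R(1)] unfolding globally_minimizing_def by blast
  then have le: "(LBINT x. indicator (ball 0 R) x * e x) \<le>
      (LBINT x. indicator (ball 0 R) x * energy_density W ?v x)"
    using energy_eq_integral[OF W_cont W_nonneg u_C1, of "\<lambda>i. partial i u" R]
      energy_eq_integral[OF W_cont W_nonneg v, of "\<lambda>i x. partial i u x + partial i \<phi> x" R]
    by (simp add: pv ennreal_le_iff Bochner_Integration.integral_nonneg energy_density_def grad_sq_nonneg W_nonneg)
  have eq: "d x = indicator (ball 0 R) x * e x - indicator (ball 0 R) x * energy_density W ?v x" for x
  proof (cases "x \<in> ball 0 R")
    case False
    then have "norm x > r" using R by simp
    then have "\<phi> x = 0" "partial i \<phi> x = 0" for i using \<phi>(2) supported_partial[OF \<phi>(2)] by blast+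
    then show ?thesis using False by (simp add: d_def energy_density_def grad_sq_def pv)
  qed (simp add: d_def)
  have int: "integrable lborel (\<lambda>x. indicator (ball 0 R) x * e x)"
    "integrable lborel (\<lambda>x. indicator (ball 0 R) x * energy_density W ?v x)"
    by (auto intro!: integrable_indicator_continuous[of _ _ R] continuous_on_energy_density W_cont u_C1 v)
  show "integrable lborel d" unfolding eq using int by simp
  show "(LBINT x. d x) \<le> 0" unfolding eq using int le by simp
qed

end

section \<open>Energy growth\<close>

lemma measure_cball_nat:
  "measure lborel (cball (0::real^'n) (real N)) = measure lborel (cball (0::real^'n) 1) * real N ^ CARD('n)"
  using content_ball_conv_unit_ball[of "real N" "0::real^'n"] by (simp add: content_cball_conv_ball)

text \<open>The factor N on the left is the whole gain: N consecutive annuli are compared with one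
  and the same inner ball.\<close>

lemma telescoping_mono:
  fixes A B :: "nat \<Rightarrow> real"
  assumes "incseq A" "\<And>N. A N \<le> B (Suc N) - B N" "\<And>N. B N \<ge> 0"
  shows "real N * A N \<le> B (2 * N)"
proof -
  have "real N * A N = (\<Sum>j<N. A N)" by simp
  also have "\<dots> \<le> (\<Sum>j<N. B (Suc (N + j)) - B (N + j))"
    using assms(1,2) by (intro sum_mono) (meson incseqD le_add1 order_trans)
  also have "\<dots> = B (N + N) - B N"
    using sum_lessThan_telescope[of "\<lambda>j. B (N + j)" N] by simp
  also have "\<dots> \<le> B (2 * N)" using assms(3)[of N] by (simp add: mult_2)
  finally show ?thesis .
qed

text \<open>Each passage from one level to the next gains one power of N.\<close>

lemma level_iteration:
  fixes A :: "real \<Rightarrow> nat \<Rightarrow> real"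
  assumes mono: "\<And>\<tau>. incseq (A \<tau>)" and nonneg: "\<And>\<tau> N. A \<tau> N \<ge> 0"
    and growth: "\<And>\<tau>. \<exists>C. \<forall>N\<ge>1. A \<tau> N \<le> C * real N ^ n"
    and step: "\<And>\<tau>. \<tau> > 0 \<Longrightarrow> \<exists>\<sigma>>0. \<exists>C. \<forall>N. A \<tau> N \<le> C * (A \<sigma> (Suc N) - A \<sigma> N)"
    and "\<tau> > 0"
  shows "A \<tau> N = 0"
proof -
  \<comment> \<open>Multiplying by N^k instead of dividing by it keeps the exponents natural
    numbers.\<close>
  have *: "\<exists>C\<ge>0. \<forall>N\<ge>1. A \<tau> N * real N ^ k \<le> C * real N ^ n" if "\<tau> > 0" for k \<tau>
    using that
  proof (induction k arbitrary: \<tau>)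
    case 0
    from growth[of \<tau>] obtain C where C: "\<And>N. N \<ge> 1 \<Longrightarrow> A \<tau> N \<le> C * real N ^ n" by blast
    have "C \<ge> 0" using C[of 1] nonneg[of \<tau> 1] by simp
    then show ?case using C by auto
  next
    case (Suc k)
    obtain \<sigma> C where \<sigma>: "\<sigma> > 0" and C: "\<And>N. A \<tau> N \<le> C * (A \<sigma> (Suc N) - A \<sigma> N)"
      using step[OF Suc.prems] by blast
    obtain D where D: "D \<ge> 0" "\<And>N. N \<ge> 1 \<Longrightarrow> A \<sigma> N * real N ^ k \<le> D * real N ^ n"
      using Suc.IH[OF \<sigma>] by blast
    \<comment> \<open>The sign of C is not known, but the increment that it multiplies is
      nonnegative.\<close>
    have C': "A \<tau> N \<le> \<bar>C\<bar> * A \<sigma> (Suc N) - \<bar>C\<bar> * A \<sigma> N" for N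
    proof -
      have "C * (A \<sigma> (Suc N) - A \<sigma> N) \<le> \<bar>C\<bar> * (A \<sigma> (Suc N) - A \<sigma> N)"
        using mono[of \<sigma>] by (intro mult_right_mono) (auto simp: incseq_SucD)
      then show ?thesis using C[of N] by (simp add: algebra_simps)
    qed
    have "A \<tau> N * real N ^ Suc k \<le> (\<bar>C\<bar> * D * 2 ^ n) * real N ^ n" if "N \<ge> 1" for N
    proof -
      have "A \<tau> N * real N ^ Suc k = (real N * A \<tau> N) * real N ^ k" by simp
      also have "\<dots> \<le> (\<bar>C\<bar> * A \<sigma> (2 * N)) * real N ^ k"
        using telescoping_mono[OF mono[of \<tau>] C'] nonneg by (intro mult_right_mono) auto
      also have "\<dots> \<le> (\<bar>C\<bar> * A \<sigma> (2 * N)) * real (2 * N) ^ k"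
        using nonneg by (intro mult_left_mono power_mono) auto
      also have "\<dots> = \<bar>C\<bar> * (A \<sigma> (2 * N) * real (2 * N) ^ k)" by simp
      also have "\<dots> \<le> \<bar>C\<bar> * (D * real (2 * N) ^ n)"
        using D(2)[of "2 * N"] that by (intro mult_left_mono) auto
      finally show ?thesis by (simp add: power_mult_distrib mult_ac)
    qed
    then show ?case using D(1) by (intro exI[of _ "\<bar>C\<bar> * D * 2 ^ n"]) auto
  qed
  \<comment> \<open>With k = n + 1 the product A(K) K is bounded in K; as A increases, A(N) K is
    bounded too, which forces A(N) = 0.\<close>
  obtain C where C: "C \<ge> 0" "\<And>N. N \<ge> 1 \<Longrightarrow> A \<tau> N * real N ^ Suc n \<le> C * real N ^ n"
    using *[OF \<open>\<tau> > 0\<close>, of "Suc n"] by blast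
  have le: "A \<tau> N * real K \<le> C" if K: "K \<ge> max N 1" for K
  proof -
    have "A \<tau> N * real K \<le> A \<tau> K * real K"
      using mono[of \<tau>] K by (intro mult_right_mono) (auto simp: incseqD)
    also have "\<dots> \<le> C"
    proof -
      have "(A \<tau> K * real K) * real K ^ n \<le> C * real K ^ n" using C(2)[of K] K by (simp add: mult_ac)
      then show ?thesis using K by (subst (asm) mult_le_cancel_right) auto
    qed
    finally show ?thesis .
  qed
  show ?thesis
  proof (rule ccontr)
    assume "A \<tau> N \<noteq> 0"
    then have pos: "A \<tau> N > 0" using nonneg[of \<tau> N] by simp
    obtain K where K: "real K > C / A \<tau> N" using reals_Archimedean2 by blast
    have "C < A \<tau> N * real K" using K pos by (simp add: field_simps)
    also have "\<dots> \<le> A \<tau> N * real (max K (max N 1))" using pos by (intro mult_left_mono) auto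
    also have "\<dots> \<le> C" by (rule le) simp
    finally show False by simp
  qed
qed

lemma incseq_integral_cball:
  fixes g :: "real^'n \<Rightarrow> real"
  assumes "continuous_on UNIV g" "\<And>x. g x \<ge> 0" "S \<in> sets borel"
  shows "incseq (\<lambda>N. LBINT x. indicator (cball 0 (real N) \<inter> S) x * g x)"
  unfolding incseq_def
proof (intro allI impI integral_mono)
  fix N show "integrable lborel (\<lambda>x. indicator (cball 0 (real N) \<inter> S) x * g x)"
    using assms(3) by (intro integrable_indicator_continuous[of _ _ "real N"] assms(1)) auto
  then show "integrable lborel (\<lambda>x. indicator (cball 0 (real N) \<inter> S) x * g x)" .
  fix K x assume "N \<le> K"
  then show "indicator (cball 0 (real N) \<inter> S) x * g x \<le> indicator (cball 0 (real K) \<inter> S) x * g x"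
    using assms(2) by (intro mult_right_mono) (auto simp: indicator_def)
qed

context single_well_minimizer
begin

text \<open>W attains a positive minimum on the compact shell, unless the shell is empty.\<close>

lemma W_lower:
  assumes "\<delta> > 0"
  shows "\<exists>c>0. \<forall>y. \<delta> \<le> norm (y - a) \<and> norm (y - a) \<le> r \<longrightarrow> c \<le> W y"
proof -
  let ?S = "cball a r - ball a \<delta>"
  have S: "y \<in> ?S \<longleftrightarrow> \<delta> \<le> norm (y - a) \<and> norm (y - a) \<le> r" for y
    by (auto simp: dist_norm norm_minus_commute)
  show ?thesis
  proof (cases "?S = {}")
    case True
    then have "\<not> (\<delta> \<le> norm (y - a) \<and> norm (y - a) \<le> r)" for y using S[of y] by blast
    then show ?thesis by (intro exI[of _ 1]) auto
  next
    case False
    have "compact ?S" by (intro compact_diff compact_cball open_ball)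
    then obtain y0 where y0: "y0 \<in> ?S" "\<And>y. y \<in> ?S \<Longrightarrow> W y0 \<le> W y"
      using continuous_attains_inf[OF _ False continuous_on_subset[OF W_cont]] by blast
    have "W y0 > 0" using y0(1) \<open>\<delta> > 0\<close> by (intro W_pos) auto
    then show ?thesis using y0(2) S by (intro exI[of _ "W y0"]) auto
  qed
qed

lemma W_upper: "\<exists>K\<ge>0. \<forall>y. norm (y - a) \<le> r \<longrightarrow> W y \<le> K"
proof -
  have "bounded (W ` cball a r)"
    by (intro compact_imp_bounded compact_continuous_image continuous_on_subset[OF W_cont]) auto
  then obtain K where "\<forall>y\<in>cball a r. norm (W y) \<le> K" unfolding bounded_iff by blast
  then have "W y \<le> max K 0" if "norm (y - a) \<le> r" for y
    using that by (force simp: dist_norm norm_minus_commute)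
  then show ?thesis by (intro exI[of _ "max K 0"]) auto
qed

section \<open>Comparison of u with the constant a\<close>

definition F :: "nat \<Rightarrow> real" where
  "F N = (LBINT x. indicator (cball 0 (real N)) x * e x)"

definition ball_volume :: "nat \<Rightarrow> real" where
  "ball_volume N = measure lborel (cball (0::real^'n) (real N))"

lemma integrable_e: "integrable lborel (\<lambda>x. indicator (cball 0 (real N)) x * e x)"
  by (intro integrable_indicator_continuous[of _ _ "real N"] e_cont) auto

lemma F_nonneg: "F N \<ge> 0"
  unfolding F_def by (intro Bochner_Integration.integral_nonneg) (simp add: e_nonneg)

lemma incseq_F: "incseq F"
  using incseq_integral_cball[OF e_cont e_nonneg, of UNIV] by (simp add: F_def[abs_def])

lemma ball_volume_eq: "ball_volume N = ball_volume 1 * real N ^ CARD('n)"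
  unfolding ball_volume_def using measure_cball_nat[of N, where 'n = 'n] by simp

lemma ball_volume_nonneg: "ball_volume N \<ge> 0"
  by (simp add: ball_volume_def)

lemma integral_indicator_cball: "(LBINT x. indicator (cball (0::real^'n) (real N)) x * c) = c * ball_volume N"
  by (simp add: ball_volume_def)

text \<open>Bounds the energy added in the annulus when the squared cutoff has the value s. Each of
  its n partials is at most 2 * 8 = 16 in size, and n * 16^2 / 2 = 128 n.\<close>

definition cutoff_cost :: "real \<Rightarrow> real^'n \<Rightarrow> real" where
  "cutoff_cost s x = 128 * real CARD('n) * (norm (u x - a))\<^sup>2 + W (u x + s *\<^sub>R (a - u x))"

lemma integrable_indicator_cball:
  fixes c :: real
  shows "integrable lborel (\<lambda>x. indicator (cball (0::real^'n) (real N)) x * c)"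
  by (intro integrable_indicator_continuous[of _ _ "real N"]) auto

text \<open>The majorant k is left open: a constant gives the growth bound, and \<epsilon> + C e
  gives the decay.\<close>

lemma linear_cutoff:
  assumes k: "continuous_on UNIV k"
    and le: "\<And>x s. 0 \<le> s \<Longrightarrow> s \<le> 1 \<Longrightarrow> cutoff_cost s x \<le> k x"
  shows "F N \<le> (LBINT x. indicator (cball 0 (real (Suc N))) x * k x)
    - (LBINT x. indicator (cball 0 (real N)) x * k x)"
proof -
  \<comment> \<open>Squaring puts the factor \<open>cutoff N x\<close> into the gradient of \<eta>,
    which makes the completed square below possible.\<close>
  define \<eta> where "\<eta> x = (cutoff N x)\<^sup>2" for x :: "real^'n"
  define \<eta>' where "\<eta>' x h = 2 * cutoff N x * cutoff' N x h" for x h :: "real^'n"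
  define \<phi> where "\<phi> x = \<eta> x *\<^sub>R (a - u x)" for x
  have \<eta>: "(\<eta> has_derivative \<eta>' x) (at x)" for x
    unfolding \<eta>_def[abs_def] \<eta>'_def[abs_def]
    by (auto intro!: derivative_eq_intros cutoff_has_derivative)
  have c\<eta>': "continuous_on UNIV (\<lambda>x. \<eta>' x h)" for h
    unfolding \<eta>'_def by (intro continuous_intros continuous_on_cutoff)
  have T: "((\<lambda>y. a) has_derivative (\<lambda>h. 0)) (at y)" for y :: "real^'m" by simp
  note cc = cutoff_competitor[OF u_C1 \<eta> c\<eta>' T continuous_on_const]
  have \<phi>_C1: "Ck_on 1 UNIV \<phi>" using cc(1) unfolding \<phi>_def .
  have supp: "supported (real N + 1) \<phi>"
  proof (intro allI impI)
    fix x :: "real^'n" assume "norm x > real N + 1"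
    then have "cutoff N x = 0" using cutoff_props(4)[of N x] by simp
    then show "\<phi> x = 0" by (simp add: \<phi>_def \<eta>_def)
  qed
  let ?v = "\<lambda>x. u x + \<phi> x"
  have pv: "partial i ?v x = (1 - \<eta> x) *\<^sub>R partial i u x - \<eta>' x (axis i 1) *\<^sub>R (u x - a)" for i x
    using cc(2)[of i x] unfolding \<phi>_def by (simp add: scaleR_diff_right)
  note min = minimality[OF \<phi>_C1 supp]
  have pw: "indicator (cball 0 (real N)) x * e x
      - (indicator (cball 0 (real (Suc N))) x * k x - indicator (cball 0 (real N)) x * k x)
      \<le> e x - energy_density W ?v x" for x
  proof -
    consider "norm x \<le> real N" | "real N < norm x" "norm x \<le> real N + 1" | "norm x > real N + 1" by linarith
    then show ?thesis
    proof cases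
      case 1
      then have "cutoff N x = 1" "cutoff' N x h = 0" for h using cutoff_props(3)[of x N] by auto
      then have "energy_density W ?v x = 0"
        by (simp add: energy_density_def grad_sq_def pv \<eta>_def \<eta>'_def W_a) (simp add: \<phi>_def \<eta>_def W_a)
      then show ?thesis using 1 by simp
    next
      case 2
      let ?s = "cutoff N x"
      have s: "0 \<le> ?s" "?s \<le> 1" by (rule cutoff_props)+
      have s2: "0 \<le> ?s\<^sup>2" "?s\<^sup>2 \<le> 1" using s by (auto simp: power_le_one)
      have b: "(norm (partial i ?v x))\<^sup>2 \<le> (norm (partial i u x))\<^sup>2 + 256 * (norm (u x - a))\<^sup>2" for i
      proof -
        let ?X = "partial i u x" and ?Z = "(2 * cutoff' N x (axis i 1)) *\<^sub>R (u x - a)"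
        have eq: "partial i ?v x = (1 - ?s\<^sup>2) *\<^sub>R ?X - ?s *\<^sub>R ?Z"
          by (simp add: pv \<eta>_def \<eta>'_def mult_ac)
        \<comment> \<open>Identity |(1 - s^2) X - s Z|^2 = (1 - s^2) |X|^2 + |Z|^2 - (1 - s^2) |s X
          + Z|^2. The coefficient of |X|^2 does not exceed 1, so no gradient of u is paid in the
          annulus.\<close>
        have "(norm (partial i ?v x))\<^sup>2 = (1 - ?s\<^sup>2) * (norm ?X)\<^sup>2 + (norm ?Z)\<^sup>2
            - (1 - ?s\<^sup>2) * (norm (?s *\<^sub>R ?X + ?Z))\<^sup>2"
          unfolding eq power2_norm_eq_inner
          by (simp add: inner_simps inner_commute power2_eq_square) (simp add: algebra_simps)
        also have "\<dots> \<le> 1 * (norm ?X)\<^sup>2 + (norm ?Z)\<^sup>2 - 0"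
          using s2 by (intro diff_mono add_mono mult_right_mono) auto
        also have "(norm ?Z)\<^sup>2 \<le> (16 * norm (u x - a))\<^sup>2"
          using mult_right_mono[OF cutoff_props(5)[of N x "axis i 1"] norm_ge_zero[of "u x - a"]]
          by (intro power_mono) (auto simp: abs_mult mult.commute)
        finally show ?thesis by (simp add: power_mult_distrib)
      qed
      have "grad_sq ?v x \<le> grad_sq u x + real CARD('n) * (256 * (norm (u x - a))\<^sup>2)"
        unfolding grad_sq_def using sum_mono[of UNIV, OF b] by (simp add: sum.distrib)
      moreover have "128 * real CARD('n) * (norm (u x - a))\<^sup>2 + W (?v x) \<le> k x"
        using le[OF s2, of x] by (simp add: cutoff_cost_def \<phi>_def \<eta>_def)
      ultimately have "energy_density W ?v x - e x \<le> k x"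
        using W_nonneg[of "u x"] by (simp add: energy_density_def)
      then show ?thesis using 2 by (simp add: indicator_def add.commute)
    next
      case 3
      then have "cutoff N x = 0" "cutoff' N x h = 0" for h using cutoff_props(4)[of N x] by auto
      then have "energy_density W ?v x = e x"
        by (simp add: energy_density_def grad_sq_def pv \<eta>_def \<eta>'_def) (simp add: \<phi>_def \<eta>_def)
      then show ?thesis using 3 by (simp add: indicator_def)
    qed
  qed
  have intk: "integrable lborel (\<lambda>x. indicator (cball 0 (real K)) x * k x)" for K
    by (intro integrable_indicator_continuous[of _ _ "real K"] k) auto
  have "(LBINT x. indicator (cball 0 (real N)) x * e x
      - (indicator (cball 0 (real (Suc N))) x * k x - indicator (cball 0 (real N)) x * k x))
      \<le> (LBINT x. e x - energy_density W ?v x)"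
    using pw by (intro integral_mono Bochner_Integration.integrable_diff integrable_e intk min(1))
  also note min(2)
  finally show ?thesis
    using integrable_e[of N] intk[of N] intk[of "Suc N"] by (simp add: F_def del: of_nat_Suc)
qed

lemma cutoff_cost_bounded:
  "\<exists>C\<ge>0. \<forall>x s. 0 \<le> s \<longrightarrow> s \<le> 1 \<longrightarrow> cutoff_cost s x \<le> C"
proof -
  obtain K where K: "K \<ge> 0" "\<And>y. norm (y - a) \<le> M \<Longrightarrow> W y \<le> K" using W_upper by blast
  have "cutoff_cost s x \<le> 128 * real CARD('n) * M\<^sup>2 + K" if "0 \<le> s" "s \<le> 1" for x s
    unfolding cutoff_cost_def
  proof (intro add_mono mult_left_mono power_mono u_bdd K(2))
    have "u x + s *\<^sub>R (a - u x) - a = (1 - s) *\<^sub>R (u x - a)" by (simp add: algebra_simps)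
    then have "norm (u x + s *\<^sub>R (a - u x) - a) = (1 - s) * norm (u x - a)" using that by simp
    also have "\<dots> \<le> 1 * M" using that u_bdd M_nonneg by (intro mult_mono) auto
    finally show "norm (u x + s *\<^sub>R (a - u x) - a) \<le> M" by simp
  qed auto
  then show ?thesis using K(1) by (intro exI[of _ "128 * real CARD('n) * M\<^sup>2 + K"]) auto
qed

text \<open>Where u is close to a the cost is small by continuity; elsewhere W(u) has a positive
  lower bound, so a multiple of e dominates the bounded cost.\<close>

lemma cutoff_cost_small:
  assumes "\<epsilon> > 0"
  shows "\<exists>C\<ge>0. \<forall>x s. 0 \<le> s \<longrightarrow> s \<le> 1 \<longrightarrow> cutoff_cost s x \<le> \<epsilon> + C * e x"
proof -
  define n where "n = 128 * real CARD('n)"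
  have n: "n > 0" by (simp add: n_def)
  have "isCont W a" using W_cont by (simp add: continuous_on_eq_continuous_at)
  then obtain \<delta>0 where \<delta>0: "\<delta>0 > 0" "\<And>y. dist y a < \<delta>0 \<Longrightarrow> dist (W y) (W a) < \<epsilon> / 2"
    using assms unfolding continuous_at_eps_delta by (meson half_gt_zero)
  \<comment> \<open>Each of the two terms of the cost gets \<epsilon>/2.\<close>
  define \<delta> where "\<delta> = min \<delta>0 (sqrt (\<epsilon> / (2 * n)))"
  have \<delta>: "\<delta> > 0" using \<delta>0(1) assms n by (simp add: \<delta>_def)
  have "\<delta>\<^sup>2 \<le> (sqrt (\<epsilon> / (2 * n)))\<^sup>2" using \<delta> by (intro power_mono) (auto simp: \<delta>_def)
  then have \<delta>2: "n * \<delta>\<^sup>2 \<le> \<epsilon> / 2" using n assms by (simp add: field_simps)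
  obtain c where c: "c > 0" "\<And>y. \<delta> \<le> norm (y - a) \<Longrightarrow> norm (y - a) \<le> M \<Longrightarrow> c \<le> W y"
    using W_lower[OF \<delta>] by blast
  obtain K where K: "K \<ge> 0" "\<And>x s. 0 \<le> s \<Longrightarrow> s \<le> 1 \<Longrightarrow> cutoff_cost s x \<le> K"
    using cutoff_cost_bounded by blast
  have "cutoff_cost s x \<le> \<epsilon> + K / c * e x" if s: "0 \<le> s" "s \<le> 1" for x s
  proof (cases "norm (u x - a) < \<delta>")
    case True
    have "norm (u x + s *\<^sub>R (a - u x) - a) = norm ((1 - s) *\<^sub>R (u x - a))" by (simp add: algebra_simps)
    also have "\<dots> \<le> 1 * norm (u x - a)" using s by (simp add: mult_left_le_one_le)
    finally have "dist (u x + s *\<^sub>R (a - u x)) a < \<delta>0" using True by (simp add: dist_norm \<delta>_def)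
    from \<delta>0(2)[OF this] have "W (u x + s *\<^sub>R (a - u x)) \<le> \<epsilon> / 2" by (simp add: W_a dist_real_def)
    moreover have "n * (norm (u x - a))\<^sup>2 \<le> n * \<delta>\<^sup>2"
      using True n by (intro mult_left_mono power_mono) auto
    moreover have "0 \<le> K / c * e x" using K(1) c(1) e_nonneg[of x] by simp
    ultimately show ?thesis using \<delta>2 unfolding cutoff_cost_def n_def by linarith
  next
    case False
    then have "c \<le> W (u x)" using u_bdd by (intro c(2)) auto
    also have "\<dots> \<le> e x" by (simp add: energy_density_def grad_sq_nonneg)
    finally have "K \<le> K / c * e x" using K(1) c(1) by (simp add: field_simps mult_left_mono)
    then show ?thesis using K(2)[OF s, of x] assms by linarith
  qed
  then show ?thesis using K(1) c(1) by (intro exI[of _ "K / c"]) auto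
qed

text \<open>The factor N stands on the left to avoid the exponent n - 1 and a division by N.\<close>

lemma energy_growth: "\<exists>C\<ge>0. \<forall>N. real N * F N \<le> C * real N ^ CARD('n)"
proof -
  obtain C where C: "C \<ge> 0" "\<And>x s. 0 \<le> s \<Longrightarrow> s \<le> 1 \<Longrightarrow> cutoff_cost s x \<le> C"
    using cutoff_cost_bounded by blast
  have "F N \<le> C * ball_volume (Suc N) - C * ball_volume N" for N
    using linear_cutoff[of "\<lambda>_. C", OF continuous_on_const C(2), of N]
    by (simp add: ball_volume_def mult.commute del: of_nat_Suc)
  from telescoping_mono[OF incseq_F this] have "real N * F N \<le> C * ball_volume (2 * N)" for N
    using C(1) ball_volume_nonneg by simp
  also have "C * ball_volume (2 * N) = (C * ball_volume 1 * 2 ^ CARD('n)) * real N ^ CARD('n)" for N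
    by (subst ball_volume_eq) (simp add: power_mult_distrib)
  finally show ?thesis
    using C(1) ball_volume_nonneg by (intro exI[of _ "C * ball_volume 1 * 2 ^ CARD('n)"]) auto
qed

lemma energy_decay:
  assumes "\<epsilon> > 0"
  shows "\<exists>N0. \<forall>N\<ge>N0. real N * F N \<le> \<epsilon> * real N ^ CARD('n)"
proof -
  let ?n = "CARD('n)"
  define V where "V = ball_volume 1 * 2 ^ ?n"
  have V: "V \<ge> 0" by (simp add: V_def ball_volume_nonneg)
  define \<epsilon>' where "\<epsilon>' = \<epsilon> / (2 * (V + 1))"
  have \<epsilon>': "\<epsilon>' > 0" "\<epsilon>' * V \<le> \<epsilon> / 2"
    using V assms mult_frac_le[of "\<epsilon> / 2" V] by (auto simp: \<epsilon>'_def)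
  obtain C where C: "C \<ge> 0" "\<And>x s. 0 \<le> s \<Longrightarrow> s \<le> 1 \<Longrightarrow> cutoff_cost s x \<le> \<epsilon>' + C * e x"
    using cutoff_cost_small[OF \<epsilon>'(1)] by blast
  obtain D where D: "D \<ge> 0" "\<And>N. real N * F N \<le> D * real N ^ ?n" using energy_growth by blast
  have int: "(LBINT x. indicator (cball 0 (real N)) x * (\<epsilon>' + C * e x)) = \<epsilon>' * ball_volume N + C * F N" for N
  proof -
    have "(LBINT x. indicator (cball 0 (real N)) x * (\<epsilon>' + C * e x))
      = (LBINT x. indicator (cball 0 (real N)) x * \<epsilon>' + C * (indicator (cball 0 (real N)) x * e x))"
      by (simp add: algebra_simps)
    also have "\<dots> = (LBINT x. indicator (cball (0::real^'n) (real N)) x * \<epsilon>') + C * F N"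
    proof -
      show ?thesis unfolding F_def using integrable_indicator_cball[of N \<epsilon>'] integrable_e[of N]
        by (simp only: Bochner_Integration.integral_add integrable_mult_right integral_mult_right_zero)
    qed
    finally show ?thesis by (simp only: integral_indicator_cball)
  qed
  have "continuous_on UNIV (\<lambda>x. \<epsilon>' + C * e x)" by (intro continuous_intros e_cont)
  from linear_cutoff[OF this C(2)]
  have step: "F N \<le> (\<epsilon>' * ball_volume (Suc N) + C * F (Suc N)) - (\<epsilon>' * ball_volume N + C * F N)" for N
    unfolding int .
  \<comment> \<open>The volume term is of order N^n with a small constant; F(2 N) is only O(N^(n-1))
    by \<open>energy_growth\<close> and is absorbed for large N.\<close>
  have main: "real N * F N \<le> \<epsilon>' * ball_volume (2 * N) + C * F (2 * N)" for N
    by (rule telescoping_mono[OF incseq_F step]) (use \<epsilon>' C F_nonneg ball_volume_nonneg in auto)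
  obtain N0 where N0: "real N0 > C * D * 2 ^ ?n / \<epsilon>" using reals_Archimedean2 by blast
  have "real N * F N \<le> \<epsilon> * real N ^ ?n" if N: "N \<ge> max N0 1" for N
  proof -
    have pos: "real N > 0" using N by simp
    have "C * D * 2 ^ ?n / \<epsilon> < real N" using N0 N by linarith
    then have "C * D * 2 ^ ?n \<le> \<epsilon> * real N" using assms by (simp add: field_simps)
    then have "C * D * 2 ^ ?n * real N ^ ?n \<le> \<epsilon> * real N * real N ^ ?n" by (intro mult_right_mono) auto
    moreover have "C * (real (2 * N) * F (2 * N)) \<le> C * (D * real (2 * N) ^ ?n)"
      using D(2)[of "2 * N"] C(1) by (rule mult_left_mono)
    ultimately have "real N * (2 * (C * F (2 * N))) \<le> real N * (\<epsilon> * real N ^ ?n)"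
      by (simp add: power_mult_distrib mult_ac)
    then have "C * F (2 * N) \<le> \<epsilon> / 2 * real N ^ ?n" using pos by (simp add: mult_le_cancel_left_pos)
    moreover have "\<epsilon>' * ball_volume (2 * N) \<le> \<epsilon> / 2 * real N ^ ?n"
    proof -
      have "\<epsilon>' * ball_volume (2 * N) = \<epsilon>' * V * real N ^ ?n"
        by (subst ball_volume_eq) (simp add: V_def power_mult_distrib)
      also have "\<dots> \<le> \<epsilon> / 2 * real N ^ ?n" using \<epsilon>'(2) by (intro mult_right_mono) auto
      finally show ?thesis .
    qed
    ultimately show ?thesis using main[of N] by simp
  qed
  then show ?thesis by blast
qed

section \<open>Level sets\<close>

text \<open>f is the distance to a for wells monotone along rays and a signed coordinate of y - a in
  the scalar case, where the two sides of a are treated separately.\<close>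

definition level_mass :: "(real^'m \<Rightarrow> real) \<Rightarrow> real \<Rightarrow> nat \<Rightarrow> real" where
  "level_mass f \<tau> N = (LBINT x. indicator (cball 0 (real N) \<inter> {x. f (u x) > \<tau>}) x * (1 + grad_sq u x))"

lemma open_level:
  fixes f :: "real^'m \<Rightarrow> real"
  assumes "continuous_on UNIV f" shows "open {x. f (u x) > \<tau>}"
  by (rule open_Collect_less[OF continuous_on_const continuous_on_compose2[OF assms u_cont]]) simp

lemma level_in_borel:
  fixes f :: "real^'m \<Rightarrow> real"
  shows "continuous_on UNIV f \<Longrightarrow> {x. f (u x) > \<tau>} \<in> sets borel"
  by (rule borel_open[OF open_level])

lemma integrable_level:
  fixes f :: "real^'m \<Rightarrow> real"
  assumes "continuous_on UNIV f"
  shows "integrable lborel (\<lambda>x. indicator (cball 0 (real N) \<inter> {x. f (u x) > \<tau>}) x * (1 + grad_sq u x))"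
  using level_in_borel[OF assms] by (intro integrable_indicator_continuous[of _ _ "real N"]
      continuous_on_add continuous_on_const continuous_on_grad_sq u_C1) auto

lemma level_mass_nonneg: "level_mass f \<tau> N \<ge> 0"
  unfolding level_mass_def by (intro Bochner_Integration.integral_nonneg) (simp add: grad_sq_nonneg)

lemma incseq_level_mass: "continuous_on UNIV f \<Longrightarrow> incseq (level_mass f \<tau>)"
  unfolding level_mass_def[abs_def]
  by (intro incseq_integral_cball level_in_borel continuous_on_add continuous_on_const continuous_on_grad_sq u_C1
      add_nonneg_nonneg grad_sq_nonneg zero_le_one)

lemma level_mass_growth:
  assumes f: "continuous_on UNIV f"
  shows "\<exists>C. \<forall>N\<ge>1. level_mass f \<tau> N \<le> C * real N ^ CARD('n)"
proof -
  obtain C where C: "C \<ge> 0" "\<And>N. real N * F N \<le> C * real N ^ CARD('n)" using energy_growth by blast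
  have "level_mass f \<tau> N \<le> (ball_volume 1 + 2 * C) * real N ^ CARD('n)" if "N \<ge> 1" for N
  proof -
    note i1 = integrable_indicator_cball[of _ "1"]
    have "level_mass f \<tau> N \<le> (LBINT x. indicator (cball 0 (real N)) x * 1 + 2 * (indicator (cball 0 (real N)) x * e x))"
      unfolding level_mass_def
    proof (rule integral_mono[OF integrable_level[OF f]])
      show "integrable lborel (\<lambda>x. indicator (cball 0 (real N)) x * 1 + 2 * (indicator (cball 0 (real N)) x * e x))"
        by (rule Bochner_Integration.integrable_add[OF i1 integrable_mult_right[OF integrable_e]])
      fix x show "indicator (cball 0 (real N) \<inter> {x. f (u x) > \<tau>}) x * (1 + grad_sq u x)
          \<le> indicator (cball 0 (real N)) x * 1 + 2 * (indicator (cball 0 (real N)) x * e x)"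
        using W_nonneg[of "u x"] grad_sq_nonneg[of u x] by (auto simp: indicator_def energy_density_def)
    qed
    also have "\<dots> = 1 * ball_volume N + 2 * F N"
      unfolding Bochner_Integration.integral_add[OF i1 integrable_mult_right[OF integrable_e]]
        integral_indicator_cball F_def by simp
    also have "\<dots> \<le> ball_volume 1 * real N ^ CARD('n) + 2 * (C * real N ^ CARD('n))"
    proof -
      have "1 * F N \<le> real N * F N" using that F_nonneg by (intro mult_right_mono) auto
      then show ?thesis using C(2)[of N] ball_volume_eq[of N] by simp
    qed
    finally show ?thesis by (simp add: algebra_simps)
  qed
  then show ?thesis by blast
qed

text \<open>In the annulus the 1 of the integrand pays for the cutoff gradient and the potential,
  and |Du|^2 pays for the gradient of u. The tolerance \<epsilon> is the rounding error of a
  truncation: it is sent to 0 in the scalar case and equals 0 for wells monotone along rays.\<close>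

lemma level_step:
  assumes f: "continuous_on UNIV f" and "\<sigma> \<le> \<tau>" and "\<epsilon> \<ge> 0"
    and T: "\<And>y. (T has_derivative DT y) (at y)" "continuous_on UNIV (\<lambda>p. DT (fst p) (snd p))"
    and contraction: "\<And>x h. norm (DT (u x) h) \<le> norm h"
    and id: "\<And>x. f (u x) \<le> \<sigma> \<Longrightarrow> T (u x) = u x" "\<And>x h. f (u x) \<le> \<sigma> \<Longrightarrow> DT (u x) h = h"
    and B: "\<And>x. norm (T (u x) - u x) \<le> B"
    and K: "\<And>y. norm (y - a) \<le> M + B \<Longrightarrow> W y \<le> K"
    and W_le: "\<And>x. W (T (u x)) \<le> W (u x) + \<epsilon>"
    and gap: "\<And>x. f (u x) > \<tau> \<Longrightarrow> W (T (u x)) \<le> W (u x) - c + \<epsilon>"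
      "\<And>x h. f (u x) > \<tau> \<Longrightarrow> (norm (DT (u x) h))\<^sup>2 \<le> 1/2 * (norm h)\<^sup>2"
  shows "min c (1/4) * level_mass f \<tau> N \<le>
    (1 + 64 * real CARD('n) * B\<^sup>2 + K) * (level_mass f \<sigma> (Suc N) - level_mass f \<sigma> N) + \<epsilon> * ball_volume N"
proof -
  define \<phi> where "\<phi> x = cutoff N x *\<^sub>R (T (u x) - u x)" for x
  define C where "C = 1 + 64 * real CARD('n) * B\<^sup>2 + K"
  define g where "g x = 1 + grad_sq u x" for x
  note cc = cutoff_competitor[OF u_C1 cutoff_has_derivative continuous_on_cutoff(2) T]
  have \<phi>_C1: "Ck_on 1 UNIV \<phi>" using cc(1) unfolding \<phi>_def .
  have supp: "supported (real N + 1) \<phi>"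
  proof (intro allI impI)
    fix x :: "real^'n" assume "norm x > real N + 1"
    then have "cutoff N x = 0" using cutoff_props(4)[of N x] by simp
    then show "\<phi> x = 0" by (simp add: \<phi>_def)
  qed
  let ?v = "\<lambda>x. u x + \<phi> x" and ?z = "\<lambda>x. cutoff N x"
  let ?d = "\<lambda>x. e x - energy_density W ?v x"
  have pv: "partial i ?v x = (1 - ?z x) *\<^sub>R partial i u x + ?z x *\<^sub>R DT (u x) (partial i u x)
      + cutoff' N x (axis i 1) *\<^sub>R (T (u x) - u x)" for i x
    using cc(2)[of i] unfolding \<phi>_def .
  note min = minimality[OF \<phi>_C1 supp]
  have B0: "B \<ge> 0" using B[of 0] norm_ge_zero order_trans by blast
  have K0: "K \<ge> 0" using K[of a] B0 M_nonneg by (simp add: W_a)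
  have C: "C \<ge> 1" using K0 by (simp add: C_def)
  let ?P = "\<lambda>N. cball 0 (real N) \<inter> {x. f (u x) > \<tau>}" and ?Q = "\<lambda>N. cball 0 (real N) \<inter> {x. f (u x) > \<sigma>}"
  have pw: "min c (1/4) * (indicator (?P N) x * g x)
      - C * (indicator (?Q (Suc N)) x * g x - indicator (?Q N) x * g x)
      - \<epsilon> * (indicator (cball 0 (real N)) x * 1) \<le> ?d x" for x
  proof -
    have g: "g x \<ge> 1" by (simp add: g_def grad_sq_nonneg)
    \<comment> \<open>Where T is the identity the competitor equals u even in the annulus; this
      restricts the cost to the level set above \<sigma>.\<close>
    have same: "?d x = 0" if "f (u x) \<le> \<sigma>"
    proof -
      have "partial i ?v x = partial i u x" for i
        unfolding pv using id[OF that] by (simp add: scaleR_diff_left)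
      moreover have "?v x = u x" using id[OF that] by (simp add: \<phi>_def)
      ultimately show ?thesis by (simp add: energy_density_def grad_sq_def)
    qed
    consider "f (u x) \<le> \<sigma>" | "f (u x) > \<sigma>" "norm x \<le> real N"
      | "f (u x) > \<sigma>" "real N < norm x" "norm x \<le> real N + 1" | "norm x > real N + 1" by linarith
    then show ?thesis
    proof cases
      case 1
      then show ?thesis using same \<open>\<sigma> \<le> \<tau>\<close> \<open>\<epsilon> \<ge> 0\<close> by (simp add: indicator_def)
    next
      case 2
      then have z: "?z x = 1" "cutoff' N x h = 0" for h using cutoff_props(3)[of x N] by auto
      then have v: "?v x = T (u x)" by (simp add: \<phi>_def)
      have pv: "partial i ?v x = DT (u x) (partial i u x)" for i unfolding pv by (simp add: z)
      have gv: "grad_sq ?v x \<le> grad_sq u x"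
        unfolding grad_sq_def pv using contraction by (intro sum_mono power_mono) auto
      have ge: "- \<epsilon> \<le> ?d x"
        using gv W_le[of x] by (simp add: energy_density_def v)
      have "min c (1/4) * g x - \<epsilon> \<le> ?d x" if t: "f (u x) > \<tau>"
      proof -
        \<comment> \<open>Halving |Du|^2 saves |Du|^2 / 4 of the density, the origin of the 1/4 in
          \<open>min c (1/4)\<close>.\<close>
        have "grad_sq ?v x \<le> 1/2 * grad_sq u x"
          unfolding grad_sq_def pv sum_distrib_left using gap(2)[OF t] by (intro sum_mono)
        then have "1/4 * grad_sq u x + c - \<epsilon> \<le> ?d x"
          using gap(1)[OF t] by (simp add: energy_density_def v)
        moreover have "min c (1/4) * grad_sq u x \<le> 1/4 * grad_sq u x"
          by (intro mult_right_mono) (auto simp: grad_sq_nonneg)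
        ultimately show ?thesis by (simp add: g_def algebra_simps)
      qed
      then show ?thesis using 2 ge by (auto simp: indicator_def)
    next
      case 3
      have z: "0 \<le> ?z x" "?z x \<le> 1" by (rule cutoff_props)+
      have b: "(norm (partial i ?v x))\<^sup>2 \<le> 2 * (norm (partial i u x))\<^sup>2 + 128 * B\<^sup>2" for i
      proof -
        have "norm (partial i ?v x) \<le> (1 - ?z x) * norm (partial i u x) + ?z x * norm (partial i u x) + 8 * B"
          unfolding pv
        proof (intro order_trans[OF norm_triangle_ineq] add_mono)
          show "norm ((1 - ?z x) *\<^sub>R partial i u x) \<le> (1 - ?z x) * norm (partial i u x)" using z by simp
          show "norm (?z x *\<^sub>R DT (u x) (partial i u x)) \<le> ?z x * norm (partial i u x)"
            using z contraction by (simp add: mult_left_mono)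
          show "norm (cutoff' N x (axis i 1) *\<^sub>R (T (u x) - u x)) \<le> 8 * B"
            using mult_mono[OF cutoff_props(5)[of N x "axis i 1"] B[of x]] by simp
        qed
        also have "\<dots> = norm (partial i u x) + 8 * B" by (simp add: algebra_simps)
        finally have "(norm (partial i ?v x))\<^sup>2 \<le> (norm (partial i u x) + 8 * B)\<^sup>2" by (intro power_mono) auto
        \<comment> \<open>(X + Y)^2 \<le> 2 X^2 + 2 Y^2 with Y = 8 B; half of 128, summed over n
          partials, is the 64 n in the statement.\<close>
        also have "\<dots> \<le> 2 * (norm (partial i u x))\<^sup>2 + 128 * B\<^sup>2"
          using zero_le_power2[of "norm (partial i u x) - 8 * B"]
          by (simp add: power2_eq_square algebra_simps)
        finally show ?thesis .
      qed
      have "grad_sq ?v x \<le> 2 * grad_sq u x + real CARD('n) * (128 * B\<^sup>2)"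
        unfolding grad_sq_def using sum_mono[of UNIV, OF b] by (simp add: sum.distrib sum_distrib_left)
      moreover have "W (?v x) \<le> K"
      proof (rule K)
        have "norm (?v x - a) \<le> norm (u x - a) + norm (\<phi> x)"
          using norm_triangle_ineq[of "u x - a" "\<phi> x"] by (simp add: algebra_simps)
        also have "\<dots> \<le> M + 1 * B"
          unfolding \<phi>_def norm_scaleR using z B[of x] u_bdd[of x] by (intro add_mono mult_mono) auto
        finally show "norm (?v x - a) \<le> M + B" by simp
      qed
      ultimately have "energy_density W ?v x \<le> grad_sq u x + 64 * real CARD('n) * B\<^sup>2 + K"
        by (simp add: energy_density_def)
      also have "\<dots> \<le> C * g x"
      proof -
        have "1 * grad_sq u x \<le> C * grad_sq u x" using C by (intro mult_right_mono grad_sq_nonneg)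
        moreover have "64 * real CARD('n) * B\<^sup>2 + K \<le> C" by (simp add: C_def)
        ultimately show ?thesis by (simp add: g_def algebra_simps)
      qed
      finally have "energy_density W ?v x \<le> C * g x" .
      then have "- (C * g x) \<le> ?d x" using e_nonneg[of x] by linarith
      then show ?thesis using 3 by (simp add: indicator_def add.commute)
    next
      case 4
      then have z: "?z x = 0" "cutoff' N x h = 0" for h using cutoff_props(4)[of N x] by auto
      then have v: "?v x = u x" by (simp add: \<phi>_def)
      have "partial i ?v x = partial i u x" for i unfolding pv by (simp add: z)
      then have "?d x = 0" using v by (simp add: energy_density_def grad_sq_def)
      then show ?thesis using 4 by (simp add: indicator_def)
    qed
  qed
  note int = integrable_level[OF f, of _ \<tau>, folded g_def] integrable_level[OF f, of _ \<sigma>, folded g_def]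
  note i1 = integrable_indicator_cball[of _ "1"]
  let ?L = "\<lambda>x. min c (1/4) * (indicator (?P N) x * g x)
      - C * (indicator (?Q (Suc N)) x * g x - indicator (?Q N) x * g x)
      - \<epsilon> * (indicator (cball 0 (real N)) x * 1)"
  have intL: "integrable lborel ?L"
    by (intro Bochner_Integration.integrable_diff integrable_mult_right int i1)
  have eqL: "(LBINT x. ?L x) = min c (1/4) * level_mass f \<tau> N
      - C * (level_mass f \<sigma> (Suc N) - level_mass f \<sigma> N) - \<epsilon> * (1 * ball_volume N)"
    unfolding level_mass_def g_def[symmetric] integral_indicator_cball[symmetric]
    by (simp only: Bochner_Integration.integral_diff Bochner_Integration.integrable_diff
        integrable_mult_right int i1 integral_mult_right_zero)
  have "(LBINT x. ?L x) \<le> (LBINT x. ?d x)"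
    using pw by (rule integral_mono[OF intL min(1)])
  also note min(2)
  finally show ?thesis unfolding eqL by (simp add: C_def)
qed

text \<open>A positive value of f(u) would persist, up to a factor 1/2, on a ball around x and make
  a level mass positive.\<close>

lemma level_conclusion:
  assumes f: "continuous_on UNIV f"
    and step: "\<And>\<tau>. \<tau> > 0 \<Longrightarrow> \<exists>\<sigma>>0. \<exists>C. \<forall>N. level_mass f \<tau> N \<le> C * (level_mass f \<sigma> (Suc N) - level_mass f \<sigma> N)"
  shows "f (u x) \<le> 0"
proof (rule ccontr)
  assume "\<not> f (u x) \<le> 0"
  define \<tau> where "\<tau> = f (u x) / 2"
  have \<tau>: "\<tau> > 0" "f (u x) > \<tau>" using \<open>\<not> f (u x) \<le> 0\<close> by (auto simp: \<tau>_def)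
  have zero: "level_mass f \<tau> N = 0" for N
    by (rule level_iteration[OF incseq_level_mass[OF f] level_mass_nonneg level_mass_growth[OF f] step \<tau>(1)])
  obtain d where d: "d > 0" "ball x d \<subseteq> {x. f (u x) > \<tau>}"
    using open_level[OF f, of \<tau>] \<tau>(2) unfolding open_contains_ball by blast
  obtain N where N: "real N > norm x + d" using reals_Archimedean2 by blast
  have sub: "ball x d \<subseteq> cball 0 (real N) \<inter> {x. f (u x) > \<tau>}"
  proof
    fix y assume y: "y \<in> ball x d"
    then have "norm y \<le> real N" using N norm_triangle_ineq2[of y x] by (simp add: dist_norm norm_minus_commute)
    then show "y \<in> cball 0 (real N) \<inter> {x. f (u x) > \<tau>}" using y d(2) by auto
  qed
  have "measure lborel (ball x d) = (LBINT y. indicator (ball x d) y)" by simp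
  also have "\<dots> \<le> level_mass f \<tau> N"
    unfolding level_mass_def
  proof (rule integral_mono[OF _ integrable_level[OF f]])
    show "integrable lborel (\<lambda>y. indicator (ball x d) y :: real)"
      by (intro integrable_real_indicator) (auto intro: emeasure_bounded_finite[unfolded infinity_ennreal_def])
    fix y show "indicator (ball x d) y \<le> indicator (cball 0 (real N) \<inter> {x. f (u x) > \<tau>}) y * (1 + grad_sq u y)"
      using sub grad_sq_nonneg[of u y] by (auto simp: indicator_def)
  qed
  finally show False using content_ball_pos[OF d(1), of x] zero by simp
qed

end

lemma le_of_le_add_eps:
  fixes X Y V :: real
  assumes "V \<ge> 0" "\<And>\<epsilon>. \<epsilon> > 0 \<Longrightarrow> X \<le> Y + \<epsilon> * V"
  shows "X \<le> Y"
proof (rule field_le_epsilon)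
  fix e :: real assume "e > 0"
  then have "X \<le> Y + e / (V + 1) * V" using assms by (intro assms(2)) auto
  also have "e / (V + 1) * V \<le> e" using \<open>e > 0\<close> assms(1) by (intro mult_frac_le) auto
  finally show "X \<le> Y + e" by simp
qed

section \<open>Scalar minimizers\<close>

text \<open>A C^1 form of min(s, s0): the identity up to s0, and above it s0 + r / sqrt(1 + (r/k)^2)
  with r = s - s0, which does not exceed s0 + k.\<close>

definition soft_min :: "real \<Rightarrow> real \<Rightarrow> real \<Rightarrow> real" where
  "soft_min k s0 s = s0 + (s - s0) / sqrt (1 + sqpos (s - s0) / k\<^sup>2)"
definition soft_min' :: "real \<Rightarrow> real \<Rightarrow> real \<Rightarrow> real" where
  "soft_min' k s0 s = 1 / sqrt (1 + sqpos (s - s0) / k\<^sup>2) ^ 3"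

lemma soft_min_has_derivative:
  assumes "k > 0"
  shows "(soft_min k s0 has_real_derivative soft_min' k s0 s) (at s)"
proof -
  define q where "q = 1 + sqpos (s - s0) / k\<^sup>2"
  define p where "p = sqrt q"
  have q: "q \<ge> 1" using assms by (simp add: q_def sqpos_bounds)
  then have p: "p \<ge> 1" "p\<^sup>2 = q" by (auto simp: p_def)
  have dq: "((\<lambda>s. 1 + sqpos (s - s0) / k\<^sup>2) has_real_derivative 2 * max 0 (s - s0) / k\<^sup>2) (at s)"
  proof -
    have "((\<lambda>s. s - s0) has_real_derivative 1) (at s)" by (auto intro!: derivative_eq_intros)
    from DERIV_add[OF DERIV_const DERIV_cdivide[OF DERIV_chain2[OF sqpos_has_derivative this]]]
    show ?thesis by simp
  qed
  have "((\<lambda>s. sqrt (1 + sqpos (s - s0) / k\<^sup>2)) has_real_derivative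
      (inverse (sqrt q) / 2) * (2 * max 0 (s - s0) / k\<^sup>2)) (at s)"
    unfolding q_def by (rule DERIV_chain2[OF DERIV_real_sqrt dq]) (use q in \<open>simp add: q_def\<close>)
  then have dp: "((\<lambda>s. sqrt (1 + sqpos (s - s0) / k\<^sup>2)) has_real_derivative max 0 (s - s0) / (k\<^sup>2 * p)) (at s)"
    by (simp add: p_def field_simps)
  have "((\<lambda>s. s0 + (s - s0) / sqrt (1 + sqpos (s - s0) / k\<^sup>2)) has_real_derivative
      (1 * p - (s - s0) * (max 0 (s - s0) / (k\<^sup>2 * p))) / (p * p)) (at s)"
  proof -
    have "((\<lambda>s. s - s0) has_real_derivative 1) (at s)" by (auto intro!: derivative_eq_intros)
    from DERIV_add[OF DERIV_const DERIV_divide[OF this dp]]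
    show ?thesis using p(1) by (simp add: p_def q_def)
  qed
  moreover have "(s - s0) * max 0 (s - s0) = sqpos (s - s0)"
    by (auto simp: sqpos_def max_def power2_eq_square)
  then have "(s - s0) * (max 0 (s - s0) / (k\<^sup>2 * p)) = (q - 1) / p"
    using assms p by (simp add: q_def field_simps)
  ultimately have "(soft_min k s0 has_real_derivative (p - (q - 1) / p) / (p * p)) (at s)"
    by (simp add: soft_min_def[abs_def])
  \<comment> \<open>By p^2 = q the numerator is 1 / p.\<close>
  moreover have "(p - (q - 1) / p) / (p * p) = 1 / p ^ 3"
    using p by (simp add: field_simps power2_eq_square power3_eq_cube flip: p(2))
  ultimately show ?thesis by (simp add: soft_min'_def p_def q_def)
qed

lemma continuous_on_soft_min':
  assumes "k > 0" shows "continuous_on UNIV (soft_min' k s0)"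
proof -
  have "sqrt (1 + sqpos (s - s0) / k\<^sup>2) \<noteq> 0" for s
    using sqpos_bounds(1)[of "s - s0"] assms by (simp add: add_nonneg_eq_0_iff)
  then show ?thesis
    unfolding soft_min'_def[abs_def] using assms
    by (intro continuous_intros continuous_on_compose2[OF continuous_on_sqpos]) auto
qed

lemma soft_min_props:
  assumes "k > 0"
  shows "0 \<le> soft_min' k s0 s" "soft_min' k s0 s \<le> 1"
    "s \<le> s0 \<Longrightarrow> soft_min k s0 s = s" "s \<le> s0 \<Longrightarrow> soft_min' k s0 s = 1"
    "s > s0 \<Longrightarrow> s0 \<le> soft_min k s0 s" "s > s0 \<Longrightarrow> soft_min k s0 s \<le> s0 + k"
    "s > s0 \<Longrightarrow> soft_min k s0 s \<le> s"
    "s \<ge> s0 + k \<Longrightarrow> (soft_min' k s0 s)\<^sup>2 \<le> 1 / 2"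
proof -
  define p where "p = sqrt (1 + sqpos (s - s0) / k\<^sup>2)"
  have q: "1 + sqpos (s - s0) / k\<^sup>2 \<ge> 1" using assms by (simp add: sqpos_bounds)
  then have p: "p \<ge> 1" "p\<^sup>2 = 1 + sqpos (s - s0) / k\<^sup>2" by (auto simp: p_def)
  have d: "soft_min' k s0 s = 1 / p ^ 3" "soft_min k s0 s = s0 + (s - s0) / p"
    by (simp_all add: p_def soft_min_def soft_min'_def)
  have p3: "p ^ 3 \<ge> p\<^sup>2" "p\<^sup>2 \<ge> 1" using p(1) by (auto intro: power_increasing one_le_power)
  show "0 \<le> soft_min' k s0 s" "soft_min' k s0 s \<le> 1" using p3 p by (auto simp: d divide_le_eq)
  show "s \<le> s0 \<Longrightarrow> soft_min k s0 s = s" "s \<le> s0 \<Longrightarrow> soft_min' k s0 s = 1"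
    by (simp_all add: soft_min_def soft_min'_def sqpos_bounds)
  show "s > s0 \<Longrightarrow> s0 \<le> soft_min k s0 s" using p by (simp add: d)
  show "s > s0 \<Longrightarrow> soft_min k s0 s \<le> s0 + k"
  proof -
    assume s: "s > s0"
    then have "p\<^sup>2 = 1 + (s - s0)\<^sup>2 / k\<^sup>2" by (simp add: p(2) sqpos_def)
    then have "((s - s0) / k)\<^sup>2 \<le> p\<^sup>2" by (simp only: power_divide)
    from power2_le_imp_le[OF this] have "(s - s0) / k \<le> p" using p(1) by simp
    then have "s - s0 \<le> k * p" using assms by (simp add: pos_divide_le_eq mult.commute)
    then have "(s - s0) / p \<le> k" using p(1) by (simp add: pos_divide_le_eq)
    then show ?thesis by (simp add: d)
  qed
  show "s > s0 \<Longrightarrow> soft_min k s0 s \<le> s"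
  proof -
    assume s: "s > s0"
    then have "(s - s0) / p \<le> (s - s0) / 1" using p(1) by (intro divide_left_mono) auto
    then show ?thesis by (simp add: d)
  qed
  show "s \<ge> s0 + k \<Longrightarrow> (soft_min' k s0 s)\<^sup>2 \<le> 1 / 2"
  proof -
    assume s: "s \<ge> s0 + k"
    then have "p\<^sup>2 = 1 + (s - s0)\<^sup>2 / k\<^sup>2" using assms by (simp add: p(2) sqpos_def)
    moreover have "k\<^sup>2 \<le> (s - s0)\<^sup>2" using s assms by (intro power_mono) auto
    \<comment> \<open>Once s - s0 reaches k, the root p is at least sqrt 2 and the slope 1 / p^3 at
      most 1/2; this provides the gradient gap asked for in \<open>level_step\<close>.\<close>
    ultimately have "p\<^sup>2 \<ge> 2" using assms by (simp add: le_divide_eq)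
    then have "p ^ 3 \<ge> 2" using p3 by simp
    then have "1 / p ^ 3 \<le> 1 / 2" using p(1) by (intro divide_left_mono) auto
    then have "(1 / p ^ 3)\<^sup>2 \<le> (1 / 2)\<^sup>2" using p(1) by (intro power_mono) auto
    then show ?thesis by (simp add: d power2_eq_square)
  qed
qed

context single_well_minimizer
begin

lemma W_small_near:
  assumes "\<epsilon> > 0" shows "\<exists>\<delta>>0. \<forall>y. norm (y - a) < \<delta> \<longrightarrow> W y < \<epsilon>"
proof -
  have "isCont W a" using W_cont by (simp add: continuous_on_eq_continuous_at)
  then obtain \<delta> where "\<delta> > 0" "\<And>y. dist y a < \<delta> \<Longrightarrow> dist (W y) (W a) < \<epsilon>"
    using assms unfolding continuous_at_eps_delta by blast
  then show ?thesis by (force simp: W_a dist_norm intro!: exI[of _ \<delta>])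
qed

text \<open>The level s0 minimises W over the levels above t1; truncating there lowers the potential up to
  the error caused by smoothing the truncation.\<close>

lemma scalar_one_sided:
  assumes d: "norm d = 1" "\<And>v::real^'m. (v \<bullet> d) *\<^sub>R d = v"
  shows "(u x - a) \<bullet> d \<le> 0"
proof -
  define f where "f y = (y - a) \<bullet> d" for y
  have f: "continuous_on UNIV f" unfolding f_def[abs_def] by (intro continuous_intros)
  have y_f: "y = a + f y *\<^sub>R d" for y using d(2)[of "y - a"] by (simp add: f_def algebra_simps)
  have f_le: "\<bar>f (u x)\<bar> \<le> M" for x
    using Cauchy_Schwarz_ineq2[of "u x - a" d] u_bdd[of x] d(1) by (simp add: f_def)
  define w where "w s = W (a + s *\<^sub>R d)" for s
  have w_cont: "continuous_on UNIV w"
    unfolding w_def[abs_def] by (intro continuous_on_compose2[OF W_cont] continuous_intros) auto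
  have Ww: "W y = w (f y)" for y using y_f[of y] by (simp add: w_def)
  obtain K where K: "K \<ge> 0" "\<And>y. norm (y - a) \<le> 2 * M \<Longrightarrow> W y \<le> K" using W_upper by blast
  have "f (u x) \<le> 0"
  proof (rule level_conclusion[OF f])
    fix \<tau> :: real assume "\<tau> > 0"
    \<comment> \<open>The maximum with \<tau> keeps the interval of minimisation nonempty.\<close>
    define M' where "M' = max M \<tau>"
    obtain c0 where c0: "c0 > 0" "\<And>y. \<tau> \<le> norm (y - a) \<Longrightarrow> norm (y - a) \<le> M' \<Longrightarrow> c0 \<le> W y"
      using W_lower[OF \<open>\<tau> > 0\<close>] by blast
    have w_c0: "c0 \<le> w s" if "\<tau> \<le> s" "s \<le> M'" for s
      using c0(2)[of "a + s *\<^sub>R d"] that d(1) \<open>\<tau> > 0\<close> by (simp add: w_def)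
    obtain \<delta> where \<delta>: "\<delta> > 0" "\<And>y. norm (y - a) < \<delta> \<Longrightarrow> W y < c0" using W_small_near[OF c0(1)] by blast
    \<comment> \<open>w is below c0 at t1 and at least c0 on [\<tau>, M'], so the minimum over
      [t1, M'] is attained at some s0 < \<tau>.\<close>
    define t1 where "t1 = min (\<delta> / 2) (\<tau> / 2)"
    have t1: "t1 > 0" "t1 < \<delta>" "t1 < \<tau>" using \<delta>(1) \<open>\<tau> > 0\<close> by (auto simp: t1_def)
    have w_t1: "w t1 < c0" unfolding w_def using t1 d(1) by (intro \<delta>(2)) simp
    have "{t1..M'} \<noteq> {}" using t1 by (simp add: M'_def)
    then obtain s0 where s0: "s0 \<in> {t1..M'}" "\<And>s. s \<in> {t1..M'} \<Longrightarrow> w s0 \<le> w s"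
      using continuous_attains_inf[OF compact_Icc _ continuous_on_subset[OF w_cont]] by blast
    have w_s0: "w s0 < c0" using s0(2)[of t1] w_t1 t1 by (simp add: M'_def le_max_iff_disj)
    have s0_lt: "s0 < \<tau>" using w_c0[of s0] w_s0 s0(1) by force
    have s0_pos: "s0 > 0" using s0(1) t1 by simp
    define c where "c = c0 - w s0"
    have c: "c > 0" using w_s0 by (simp add: c_def)
    define C where "C = 1 + 64 * real CARD('n) * M\<^sup>2 + K"
    have main: "min c (1/4) * level_mass f \<tau> N \<le> C * (level_mass f s0 (Suc N) - level_mass f s0 N)" for N
    \<comment> \<open>s0, c and C do not depend on \<epsilon>; only the smoothing width k does, so
      \<epsilon> can tend to 0 with the levels fixed.\<close>
    proof (rule le_of_le_add_eps[OF ball_volume_nonneg[of N]])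
      fix \<epsilon> :: real assume "\<epsilon> > 0"
      have "isCont w s0" using w_cont by (simp add: continuous_on_eq_continuous_at)
      then obtain \<rho> where \<rho>: "\<rho> > 0" "\<And>s. dist s s0 < \<rho> \<Longrightarrow> dist (w s) (w s0) < \<epsilon>"
        using \<open>\<epsilon> > 0\<close> unfolding continuous_at_eps_delta by blast
      \<comment> \<open>The first bound keeps w within \<epsilon> of w(s0) on the truncated values;
        the second completes the transition before level \<tau>, above which the slope must be
        small.\<close>
      define k where "k = min (\<rho> / 2) (\<tau> - s0)"
      have k: "k > 0" "k < \<rho>" "s0 + k \<le> \<tau>" using \<rho>(1) s0_lt by (auto simp: k_def)
      define T where "T y = a + soft_min k s0 (f y) *\<^sub>R d" for y
      define DT where "DT y h = (soft_min' k s0 (f y) * (h \<bullet> d)) *\<^sub>R d" for y h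
      note sm = soft_min_props[OF k(1), where ?s0.0 = s0]
      have fT: "f (T y) = soft_min k s0 (f y)" for y
        using d(1) by (simp add: T_def f_def norm_eq_1)
      have W_T: "W (T y) \<le> w s0 + \<epsilon>" if "f y > s0" for y
      proof -
        have "dist (soft_min k s0 (f y)) s0 < \<rho>"
          using sm(5,6)[OF that] k by (simp add: dist_real_def)
        from \<rho>(2)[OF this] show ?thesis by (simp add: Ww fT dist_real_def)
      qed
      have w_above: "w s0 \<le> W (u x)" if "f (u x) > s0" for x
        unfolding Ww using that f_le[of x] s0(1) by (intro s0(2)) (auto simp: M'_def)
      have T_u: "T (u x) - u x = (soft_min k s0 (f (u x)) - f (u x)) *\<^sub>R d" for x
        using y_f[of "u x"] by (simp add: T_def algebra_simps)
      have B: "norm (T (u x) - u x) \<le> M" for x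
      proof (cases "f (u x) \<le> s0")
        case True
        then show ?thesis unfolding T_u using sm(3) M_nonneg by simp
      next
        case False
        then have "s0 \<le> soft_min k s0 (f (u x))" "soft_min k s0 (f (u x)) \<le> f (u x)"
          using sm(5,7)[of "f (u x)"] by auto
        then show ?thesis unfolding T_u using f_le[of x] s0_pos d(1) by simp
      qed
      show "min c (1/4) * level_mass f \<tau> N \<le>
          C * (level_mass f s0 (Suc N) - level_mass f s0 N) + \<epsilon> * ball_volume N"
        unfolding C_def
      proof (rule level_step[where T = T and DT = DT, OF f])
        show "s0 \<le> \<tau>" "0 \<le> \<epsilon>" using s0_lt \<open>\<epsilon> > 0\<close> by auto
        show "(T has_derivative DT y) (at y)" for y
        proof -
          have "(f has_derivative (\<lambda>h. h \<bullet> d)) (at y)"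
            unfolding f_def[abs_def] by (auto intro!: derivative_eq_intros)
          from has_derivative_compose[OF this soft_min_has_derivative[OF k(1), unfolded has_field_derivative_def]]
          show ?thesis unfolding T_def[abs_def] DT_def[abs_def]
            by (auto intro!: derivative_eq_intros)
        qed
        show "continuous_on UNIV (\<lambda>p. DT (fst p) (snd p))"
          unfolding DT_def
          by (intro continuous_intros continuous_on_compose2[OF continuous_on_soft_min'[OF k(1)]]
              continuous_on_compose2[OF f]) auto
        show "norm (DT (u x) h) \<le> norm h" for x h
        proof -
          have "norm (DT (u x) h) = soft_min' k s0 (f (u x)) * \<bar>h \<bullet> d\<bar>"
            using sm(1) d(1) by (simp add: DT_def abs_mult)
          also have "\<dots> \<le> 1 * norm h"
            using sm(2) Cauchy_Schwarz_ineq2[of h d] d(1) by (intro mult_mono) auto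
          finally show ?thesis by simp
        qed
        show "T (u x) = u x" if "f (u x) \<le> s0" for x using T_u[of x] sm(3)[OF that] by simp
        show "DT (u x) h = h" if "f (u x) \<le> s0" for x h
          using sm(4)[OF that] d(2)[of h] by (simp add: DT_def)
        show "norm (T (u x) - u x) \<le> M" for x by (rule B)
        show "W y \<le> K" if "norm (y - a) \<le> M + M" for y using that by (intro K(2)) simp
        show "W (T (u x)) \<le> W (u x) + \<epsilon>" for x
        proof (cases "f (u x) \<le> s0")
          case True
          then show ?thesis using T_u[of x] sm(3)[OF True] \<open>\<epsilon> > 0\<close> by simp
        next
          case False
          then show ?thesis using W_T[of "u x"] w_above[of x] by simp
        qed
        fix x assume x: "f (u x) > \<tau>"
        show "W (T (u x)) \<le> W (u x) - c + \<epsilon>"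
        proof -
          have "c0 \<le> W (u x)" unfolding Ww using x f_le[of x] by (intro w_c0) (auto simp: M'_def)
          then show ?thesis using W_T[of "u x"] x s0_lt by (simp add: c_def)
        qed
        show "(norm (DT (u x) h))\<^sup>2 \<le> 1/2 * (norm h)\<^sup>2" for h
        proof -
          have "(norm (DT (u x) h))\<^sup>2 = (soft_min' k s0 (f (u x)))\<^sup>2 * \<bar>h \<bullet> d\<bar>\<^sup>2"
            using d(1) by (simp add: DT_def abs_mult power_mult_distrib)
          also have "\<dots> \<le> 1/2 * (norm h)\<^sup>2"
            using sm(8)[of "f (u x)"] x k(3) Cauchy_Schwarz_ineq2[of h d] d(1)
            by (intro mult_mono power_mono) auto
          finally show ?thesis .
        qed
      qed
    qed
    have "level_mass f \<tau> N \<le> C / min c (1/4) * (level_mass f s0 (Suc N) - level_mass f s0 N)" for N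
      using main[of N] c by (simp add: field_simps)
    then show "\<exists>\<sigma>>0. \<exists>C. \<forall>N. level_mass f \<tau> N \<le> C * (level_mass f \<sigma> (Suc N) - level_mass f \<sigma> N)"
      using s0_pos by blast
  qed
  then show ?thesis by (simp add: f_def)
qed

lemma scalar_minimizer_constant:
  assumes "CARD('m) = 1"
  shows "u x = a"
proof -
  obtain i :: 'm where i: "UNIV = {i}" using assms by (metis card_1_singletonE)
  have all_i: "j = i" for j using i by auto
  define d :: "real^'m" where "d = axis i 1"
  have eq: "(v \<bullet> d) *\<^sub>R d = v" for v :: "real^'m"
    unfolding vec_eq_iff
  proof
    fix j
    have "d $ j = 1" "v $ j = v $ i" using all_i[of j] by (simp_all add: d_def)
    then show "((v \<bullet> d) *\<^sub>R d) $ j = v $ j" by (simp add: d_def inner_axis)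
  qed
  have "(u x - a) \<bullet> d \<le> 0" by (rule scalar_one_sided) (simp_all add: eq, simp add: d_def)
  \<comment> \<open>Reversing d exchanges the two sides of a.\<close>
  moreover have "(u x - a) \<bullet> (- d) \<le> 0" by (rule scalar_one_sided) (simp_all add: eq, simp add: d_def)
  ultimately have "(u x - a) \<bullet> d = 0" by simp
  then show ?thesis using eq[of "u x - a"] by simp
qed

end

section \<open>Wells that are monotone along rays\<close>

text \<open>The shrinking factor k is chosen so that k(s) is nonincreasing while s k(s) is nondecreasing;
  this makes the map y \<mapsto> a + k(|y - a|^2) (y - a) contract at the rate k in all directions.\<close>

definition shrink :: "real \<Rightarrow> real \<Rightarrow> real" where
  "shrink s0 s = 1 - sqpos (s - s0) / (max s0 s)\<^sup>2"
definition shrink' :: "real \<Rightarrow> real \<Rightarrow> real" where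
  "shrink' s0 s = - (2 * s0 * max 0 (s - s0) / (max s0 s) ^ 3)"

text \<open>On s > 0 the maximum in the denominator may be replaced by s: the two differ only below
  s0, where the numerator vanishes.\<close>

lemma shrink_has_derivative:
  assumes "s0 > 0"
  shows "(shrink s0 has_real_derivative shrink' s0 s) (at s)"
proof (cases "s > 0")
  case True
  have ds: "((\<lambda>s. s - s0) has_real_derivative 1) (at s)" by (auto intro!: derivative_eq_intros)
  have "((\<lambda>s. s\<^sup>2) has_real_derivative 2 * s) (at s)" by (auto intro!: derivative_eq_intros)
  from DERIV_diff[OF DERIV_const DERIV_divide[OF DERIV_chain2[OF sqpos_has_derivative ds] this]]
  have D: "((\<lambda>s. 1 - sqpos (s - s0) / s\<^sup>2) has_real_derivative
      0 - (2 * max 0 (s - s0) * 1 * s\<^sup>2 - sqpos (s - s0) * (2 * s)) / (s\<^sup>2 * s\<^sup>2)) (at s)"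
    using True by simp
  have "0 - (2 * max 0 (s - s0) * 1 * s\<^sup>2 - sqpos (s - s0) * (2 * s)) / (s\<^sup>2 * s\<^sup>2) = shrink' s0 s"
  proof (cases "s \<le> s0")
    case False
    then show ?thesis using True by (simp add: shrink'_def sqpos_def divide_simps) algebra
  qed (simp add: shrink'_def sqpos_bounds)
  with D have "((\<lambda>s. 1 - sqpos (s - s0) / s\<^sup>2) has_real_derivative shrink' s0 s) (at s)" by simp
  then show ?thesis
  proof (rule has_field_derivative_transform_within_open[of _ _ _ "{0<..}"])
    fix r :: real assume "r \<in> {0<..}"
    then show "1 - sqpos (r - s0) / r\<^sup>2 = shrink s0 r"
      by (cases "r \<le> s0") (simp_all add: shrink_def sqpos_bounds)
  qed (use True in auto)
next
  case False
  have "((\<lambda>s. 1) has_real_derivative shrink' s0 s) (at s)"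
    using False assms by (simp add: shrink'_def)
  then show ?thesis
    by (rule has_field_derivative_transform_within_open[of _ _ _ "{..<s0}"])
      (use False assms in \<open>auto simp: shrink_def sqpos_bounds\<close>)
qed

lemma continuous_on_shrink':
  assumes "s0 > 0" shows "continuous_on UNIV (shrink' s0)"
  unfolding shrink'_def[abs_def] using assms by (intro continuous_intros) auto

lemma shrink_props:
  assumes "s0 > 0"
  shows "s \<le> s0 \<Longrightarrow> shrink s0 s = 1" "s \<le> s0 \<Longrightarrow> shrink' s0 s = 0"
    "0 < shrink s0 s" "shrink s0 s \<le> 1" "shrink' s0 s \<le> 0"
    "s \<ge> 0 \<Longrightarrow> 0 \<le> shrink s0 s + shrink' s0 s * s"
    "s > s0 \<Longrightarrow> shrink s0 s * s \<le> 2 * s0"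
proof -
  show a: "s \<le> s0 \<Longrightarrow> shrink s0 s = 1" and b: "s \<le> s0 \<Longrightarrow> shrink' s0 s = 0"
    by (simp_all add: shrink_def shrink'_def sqpos_bounds)
  show "shrink s0 s \<le> 1" by (simp add: shrink_def sqpos_bounds)
  show "shrink' s0 s \<le> 0" using assms by (simp add: shrink'_def)
  \<comment> \<open>Above s0 the product of s and \<open>shrink s0 s\<close> is 2 s0 - s0^2 / s,
    with derivative s0^2 / s^2 and limit 2 s0; this explains the last two bounds.\<close>
  have e: "shrink s0 s = s0 * (2 * s - s0) / s\<^sup>2" "shrink' s0 s = - (2 * s0 * (s - s0) / s ^ 3)" if "s > s0"
    using that assms by (simp_all add: shrink_def shrink'_def sqpos_def field_simps power2_eq_square)
  show "0 < shrink s0 s"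
  proof (cases "s \<le> s0")
    case False then show ?thesis using assms by (simp add: e)
  qed (simp add: a)
  show "0 \<le> shrink s0 s + shrink' s0 s * s" if "s \<ge> 0"
  proof (cases "s \<le> s0")
    case False
    then have "shrink s0 s + shrink' s0 s * s = s0\<^sup>2 / s\<^sup>2"
      using assms by (simp add: e divide_simps) algebra
    then show ?thesis by simp
  qed (simp add: a b)
  show "shrink s0 s * s \<le> 2 * s0" if "s > s0"
  proof -
    have "shrink s0 s * s = 2 * s0 - s0\<^sup>2 / s" using that assms by (simp add: e field_simps power2_eq_square)
    then show ?thesis using that assms by simp
  qed
qed

lemma norm_sq_lincomb:
  fixes h w :: "'a::real_inner"
  shows "(norm (k *\<^sub>R h + c *\<^sub>R w))\<^sup>2 = k\<^sup>2 * (norm h)\<^sup>2 + 2 * k * c * (w \<bullet> h) + c\<^sup>2 * (norm w)\<^sup>2"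
  unfolding power2_norm_eq_inner
  by (simp add: inner_add_left inner_add_right inner_commute[of h w] power2_eq_square algebra_simps)

context single_well_minimizer
begin

text \<open>T moves points towards a along their rays, which does not increase W within distance r0;
  from further out it lands where W < c0 / 2, although W was at least c0 before.\<close>

lemma monotone_well_minimizer_constant:
  assumes r0: "r0 > 0" and mono: "\<And>\<nu>. \<nu> \<in> sphere 0 1 \<Longrightarrow> mono_on {0<..r0} (\<lambda>r. W (a + r *\<^sub>R \<nu>))"
  shows "u x = a"
proof -
  define f where "f y = norm (y - a)" for y
  have f: "continuous_on UNIV f" unfolding f_def[abs_def] by (intro continuous_intros)
  obtain K where K: "K \<ge> 0" "\<And>y. norm (y - a) \<le> 2 * M \<Longrightarrow> W y \<le> K" using W_upper by blast
  have "f (u x) \<le> 0"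
  proof (rule level_conclusion[OF f])
    fix \<tau> :: real assume "\<tau> > 0"
    \<comment> \<open>The lower bound is used twice: beyond \<tau> for the gap, and beyond r0 where
      monotonicity along rays gives no information.\<close>
    obtain c0 where c0: "c0 > 0" "\<And>y. min \<tau> r0 \<le> norm (y - a) \<Longrightarrow> norm (y - a) \<le> M \<Longrightarrow> c0 \<le> W y"
      using W_lower[of "min \<tau> r0" M] \<open>\<tau> > 0\<close> r0 by auto
    obtain \<delta> where \<delta>: "\<delta> > 0" "\<And>y. norm (y - a) < \<delta> \<Longrightarrow> W y < c0 / 2"
      using W_small_near[of "c0 / 2"] c0(1) by auto
    \<comment> \<open>2 \<sigma> < \<delta> puts the image of T where W < c0 / 2; 4 \<sigma> \<le>
      \<tau> makes the shrinking factor at most 1/2 above level \<tau>.\<close>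
    define \<sigma> where "\<sigma> = min (\<delta> / 3) (\<tau> / 4)"
    have \<sigma>: "\<sigma> > 0" "2 * \<sigma> < \<delta>" "\<sigma> \<le> \<tau> / 4" using \<delta>(1) \<open>\<tau> > 0\<close> by (auto simp: \<sigma>_def)
    define s0 where "s0 = \<sigma>\<^sup>2"
    have s0: "s0 > 0" using \<sigma>(1) by (simp add: s0_def)
    note sh = shrink_props[OF s0]
    define k where "k y = shrink s0 ((norm (y - a))\<^sup>2)" for y
    define k' where "k' y = shrink' s0 ((norm (y - a))\<^sup>2)" for y
    define T where "T y = a + k y *\<^sub>R (y - a)" for y
    define DT where "DT y h = k y *\<^sub>R h + (k' y * (2 * ((y - a) \<bullet> h))) *\<^sub>R (y - a)" for y h
    have small: "(norm (y - a))\<^sup>2 \<le> s0 \<longleftrightarrow> f y \<le> \<sigma>" for y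
      using \<sigma>(1) abs_le_square_iff[of "norm (y - a)" \<sigma>] by (simp add: s0_def f_def)
    have k01: "0 < k y" "k y \<le> 1" for y unfolding k_def by (rule sh)+
    have id: "k y = 1" "k' y = 0" if "f y \<le> \<sigma>" for y
      using that small[of y] sh(1,2) by (simp_all add: k_def k'_def)
    have T_u: "T y - y = (k y - 1) *\<^sub>R (y - a)" for y by (simp add: T_def algebra_simps)
    have contr: "(norm (DT y h))\<^sup>2 \<le> (k y)\<^sup>2 * (norm h)\<^sup>2" for y h
    proof -
      let ?w = "y - a" and ?s = "(norm (y - a))\<^sup>2"
      \<comment> \<open>With s = |y - a|^2 the extra term is 4 k' (s k)' ((y - a) . h)^2, which is
        nonpositive because k decreases and s k increases.\<close>
      have "(norm (DT y h))\<^sup>2 = (k y)\<^sup>2 * (norm h)\<^sup>2 + 4 * k' y * (k y + k' y * ?s) * (?w \<bullet> h)\<^sup>2"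
        unfolding DT_def norm_sq_lincomb by algebra
      also have "\<dots> \<le> (k y)\<^sup>2 * (norm h)\<^sup>2"
        using sh(5)[of ?s] sh(6)[of ?s] by (simp add: k_def k'_def mult_nonpos_nonneg mult_nonneg_nonneg)
      finally show ?thesis .
    qed
    have T_norm: "norm (T y - a) \<le> 2 * \<sigma>" for y
    proof (cases "f y \<le> \<sigma>")
      case True
      then show ?thesis using id[OF True] \<sigma>(1) by (simp add: T_def f_def)
    next
      case False
      let ?s = "(norm (y - a))\<^sup>2"
      have s: "?s > s0" using small[of y] False by linarith
      \<comment> \<open>The outer factor is at most 1, the inner product at most 2 s0 = 2
        \<sigma>^2.\<close>
      have "(norm (T y - a))\<^sup>2 = k y * (k y * ?s)"
        by (simp add: T_def power_mult_distrib power2_eq_square)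
      also have "\<dots> \<le> 1 * (2 * s0)"
        using mult_mono[OF k01(2)[of y] sh(7)[OF s, folded k_def]] k01[of y] by simp
      also have "\<dots> \<le> (2 * \<sigma>)\<^sup>2" by (simp add: s0_def power_mult_distrib)
      finally show ?thesis by (rule power2_le_imp_le) (use \<sigma>(1) in simp)
    qed
    have W_T: "W (T y) < c0 / 2" for y using T_norm[of y] \<sigma>(2) by (intro \<delta>(2)) simp
    define C where "C = 1 + 64 * real CARD('n) * M\<^sup>2 + K"
    have main: "min (c0 / 2) (1/4) * level_mass f \<tau> N \<le>
        C * (level_mass f \<sigma> (Suc N) - level_mass f \<sigma> N) + 0 * ball_volume N" for N
      unfolding C_def
    proof (rule level_step[where T = T and DT = DT, OF f])
      show "\<sigma> \<le> \<tau>" "(0::real) \<le> 0" using \<sigma> \<open>\<tau> > 0\<close> by auto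
      show "(T has_derivative DT y) (at y)" for y
      proof -
        from has_derivative_compose[OF norm_sq_has_derivative shrink_has_derivative[OF s0, unfolded has_field_derivative_def]]
        have dk: "(k has_derivative (\<lambda>h. k' y * (2 * ((y - a) \<bullet> h)))) (at y)"
          unfolding k_def[abs_def] k'_def .
        have "((\<lambda>y. y - a) has_derivative (\<lambda>h. h)) (at y)" by (auto intro!: derivative_eq_intros)
        from has_derivative_add[OF has_derivative_const has_derivative_scaleR[OF dk this]]
        show ?thesis unfolding T_def[abs_def] DT_def[abs_def] by simp
      qed
      show "continuous_on UNIV (\<lambda>p. DT (fst p) (snd p))"
      proof -
        have "continuous_on UNIV (shrink s0)"
          using DERIV_isCont[OF shrink_has_derivative[OF s0]] by (simp add: continuous_on_eq_continuous_at)
        moreover have c: "continuous_on UNIV (\<lambda>p::(real^'m) \<times> (real^'m). (norm (fst p - a))\<^sup>2)"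
          by (intro continuous_intros)
        ultimately have "continuous_on UNIV (\<lambda>p::(real^'m) \<times> (real^'m). k (fst p))"
          unfolding k_def by (rule continuous_on_compose2) simp
        moreover have "continuous_on UNIV (\<lambda>p::(real^'m) \<times> (real^'m). k' (fst p))"
          unfolding k'_def by (rule continuous_on_compose2[OF continuous_on_shrink'[OF s0] c]) simp
        ultimately show ?thesis
          unfolding DT_def
          by (intro continuous_on_add continuous_on_scaleR continuous_on_mult continuous_on_inner
              continuous_on_diff continuous_on_fst continuous_on_snd continuous_on_id continuous_on_const)
      qed
      show "norm (DT (u x) h) \<le> norm h" for x h
      proof -
        have "(k (u x))\<^sup>2 * (norm h)\<^sup>2 \<le> 1 * (norm h)\<^sup>2"
          using k01[of "u x"] by (intro mult_right_mono) (auto simp: power_le_one)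
        then have "(norm (DT (u x) h))\<^sup>2 \<le> (norm h)\<^sup>2" using contr[of "u x" h] by linarith
        then show ?thesis by (rule power2_le_imp_le) simp
      qed
      show "T (u x) = u x" if "f (u x) \<le> \<sigma>" for x using T_u[of "u x"] id(1)[OF that] by simp
      show "DT (u x) h = h" if "f (u x) \<le> \<sigma>" for x h using id[OF that] by (simp add: DT_def)
      show B: "norm (T (u x) - u x) \<le> M" for x
      proof -
        have "norm (T (u x) - u x) = (1 - k (u x)) * norm (u x - a)"
          unfolding T_u using k01[of "u x"] by simp
        also have "\<dots> \<le> 1 * M" using k01[of "u x"] u_bdd[of x] by (intro mult_mono) auto
        finally show ?thesis by simp
      qed
      show "W y \<le> K" if "norm (y - a) \<le> M + M" for y using that by (intro K(2)) simp
      show "W (T (u x)) \<le> W (u x) + 0" for x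
      proof -
        consider "f (u x) \<le> \<sigma>" | "f (u x) > \<sigma>" "f (u x) \<le> r0" | "f (u x) > r0" by linarith
        then show ?thesis
        proof cases
          case 1
          then show ?thesis using T_u[of "u x"] id(1)[OF 1] by simp
        next
          case 2
          define \<nu> where "\<nu> = (1 / f (u x)) *\<^sub>R (u x - a)"
          have pos: "f (u x) > 0" using 2 \<sigma>(1) by simp
          then have \<nu>: "\<nu> \<in> sphere 0 1" "f (u x) *\<^sub>R \<nu> = u x - a" by (auto simp: \<nu>_def f_def)
          have "W (a + (k (u x) * f (u x)) *\<^sub>R \<nu>) \<le> W (a + f (u x) *\<^sub>R \<nu>)"
          proof (rule mono_onD[OF mono[OF \<nu>(1)]])
            show kf: "k (u x) * f (u x) \<le> f (u x)"
              using mult_right_mono[OF k01(2)[of "u x"], of "f (u x)"] pos by linarith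
            have "0 < k (u x) * f (u x)" using k01(1)[of "u x"] pos by (rule mult_pos_pos)
            with kf 2 show "k (u x) * f (u x) \<in> {0<..r0}" unfolding greaterThanAtMost_iff by linarith
            show "f (u x) \<in> {0<..r0}" using pos 2 by simp
          qed
          moreover have "a + (k (u x) * f (u x)) *\<^sub>R \<nu> = T (u x)"
            using \<nu>(2) by (simp add: T_def flip: scaleR_scaleR)
          ultimately show ?thesis using \<nu>(2) by simp
        next
          case 3
          then have "c0 \<le> W (u x)" using u_bdd[of x] by (intro c0(2)) (auto simp: f_def)
          then show ?thesis using W_T[of "u x"] c0(1) by simp
        qed
      qed
      fix x assume x: "f (u x) > \<tau>"
      show "W (T (u x)) \<le> W (u x) - c0 / 2 + 0"
      proof -
        have "c0 \<le> W (u x)" using x u_bdd[of x] by (intro c0(2)) (auto simp: f_def)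
        then show ?thesis using W_T[of "u x"] by simp
      qed
      show "(norm (DT (u x) h))\<^sup>2 \<le> 1/2 * (norm h)\<^sup>2" for h
      proof -
        let ?s = "(norm (u x - a))\<^sup>2"
        have "(4 * \<sigma>)\<^sup>2 \<le> ?s" using x \<sigma> by (intro power_mono) (auto simp: f_def)
        then have s16: "16 * s0 \<le> ?s" by (simp add: s0_def power_mult_distrib)
        then have s: "?s > s0" "16 * s0 \<le> ?s" using s0 by linarith+
        have "k (u x) * (16 * s0) \<le> k (u x) * ?s" using k01[of "u x"] s by (intro mult_left_mono) auto
        also have "\<dots> \<le> 2 * s0" using sh(7)[OF s(1)] by (simp add: k_def)
        finally have "k (u x) \<le> 1 / 2" using s0 by simp
        then have "(k (u x))\<^sup>2 \<le> (1 / 2)\<^sup>2" using k01[of "u x"] by (intro power_mono) auto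
        then have "(k (u x))\<^sup>2 \<le> 1 / 2" by (simp add: power2_eq_square)
        then have "(k (u x))\<^sup>2 * (norm h)\<^sup>2 \<le> 1 / 2 * (norm h)\<^sup>2" by (intro mult_right_mono) auto
        then show ?thesis using contr[of "u x" h] by linarith
      qed
    qed
    have "level_mass f \<tau> N \<le> C / min (c0 / 2) (1/4) * (level_mass f \<sigma> (Suc N) - level_mass f \<sigma> N)" for N
      using main[of N] c0(1) by (simp add: field_simps)
    then show "\<exists>\<sigma>>0. \<exists>C. \<forall>N. level_mass f \<tau> N \<le> C * (level_mass f \<sigma> (Suc N) - level_mass f \<sigma> N)"
      using \<sigma>(1) by blast
  qed
  then show ?thesis by (simp add: f_def)
qed

text \<open>On a short segment from a the second derivative of W is nonnegative and the first
  vanishes at a, so W does not decrease along it. Compactness of the sphere makes the length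
  independent of the direction.\<close>

lemma nondegenerate_well_monotone:
  assumes W_C2: "Ck_on 2 UNIV W" and hess: "\<And>\<nu>. \<nu> \<in> sphere 0 1 \<Longrightarrow> hessian_form W a \<nu> > 0"
  shows "\<exists>r0>0. \<forall>\<nu>\<in>sphere 0 1. mono_on {0<..r0} (\<lambda>r. W (a + r *\<^sub>R \<nu>))"
proof -
  have C1: "Ck_on 1 UNIV (partial i W)" for i using W_C2 Ck_on_partial[of 1 UNIV W] by (simp add: numeral_2_eq_2)
  have cP: "continuous_on UNIV (partial j (partial i W))" for i j using C1[of i] by simp
  obtain c where c: "c > 0" "\<And>\<nu>. \<nu> \<in> sphere 0 1 \<Longrightarrow> c \<le> hessian_form W a \<nu>"
  proof -
    have "continuous_on (sphere 0 1) (hessian_form W a)"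
      unfolding hessian_form_def[abs_def] by (intro continuous_intros)
    moreover have "sphere 0 1 \<noteq> ({} :: (real^'m) set)" by simp
    ultimately obtain \<nu>0 where "\<nu>0 \<in> sphere 0 1" "\<And>\<nu>. \<nu> \<in> sphere 0 1 \<Longrightarrow> hessian_form W a \<nu>0 \<le> hessian_form W a \<nu>"
      using continuous_attains_inf[OF compact_sphere] by blast
    then show ?thesis using hess that by blast
  qed
  \<comment> \<open>The sum of the entrywise differences dominates the change of the quadratic form
    on unit vectors, whose coordinates are at most 1 in size.\<close>
  define D where "D y = (\<Sum>i\<in>UNIV. \<Sum>j\<in>UNIV. \<bar>partial j (partial i W) y - partial j (partial i W) a\<bar>)" for y
  have "continuous_on UNIV D" unfolding D_def[abs_def] by (intro continuous_intros cP)
  then have "isCont D a" by (simp add: continuous_on_eq_continuous_at)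
  then obtain \<delta> where \<delta>: "\<delta> > 0" "\<And>y. dist y a < \<delta> \<Longrightarrow> dist (D y) (D a) < c"
    using c(1) unfolding continuous_at_eps_delta by blast
  have D_small: "D y < c" if "norm (y - a) < \<delta>" for y
  proof -
    have "dist (D y) (D a) < c" using that by (intro \<delta>(2)) (simp add: dist_norm)
    then show ?thesis by (simp add: D_def dist_real_def)
  qed
  have pos: "hessian_form W y \<nu> \<ge> 0" if \<nu>: "\<nu> \<in> sphere 0 1" and y: "norm (y - a) < \<delta>" for y \<nu>
  proof -
    have "hessian_form W a \<nu> - hessian_form W y \<nu>
      = (\<Sum>i\<in>UNIV. \<Sum>j\<in>UNIV. (partial j (partial i W) a - partial j (partial i W) y) * (\<nu> $ i) * (\<nu> $ j))"
      unfolding hessian_form_def sum_subtractf[symmetric] by (simp add: algebra_simps)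
    also have "\<dots> \<le> D y"
      unfolding D_def
    proof (intro sum_mono)
      fix i j
      have b: "\<bar>\<nu> $ l\<bar> \<le> 1" for l using component_le_norm_cart[of \<nu> l] \<nu> by simp
      have "(partial j (partial i W) a - partial j (partial i W) y) * (\<nu> $ i) * (\<nu> $ j)
        \<le> \<bar>(partial j (partial i W) a - partial j (partial i W) y) * (\<nu> $ i) * (\<nu> $ j)\<bar>" by simp
      also have "\<dots> = \<bar>partial j (partial i W) a - partial j (partial i W) y\<bar> * (\<bar>\<nu> $ i\<bar> * \<bar>\<nu> $ j\<bar>)"
        by (simp add: abs_mult)
      also have "\<dots> \<le> \<bar>partial j (partial i W) a - partial j (partial i W) y\<bar> * (1 * 1)"
        using b by (intro mult_left_mono mult_mono) auto
      finally show "(partial j (partial i W) a - partial j (partial i W) y) * (\<nu> $ i) * (\<nu> $ j)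
        \<le> \<bar>partial j (partial i W) y - partial j (partial i W) a\<bar>" by (simp add: abs_minus_commute)
    qed
    finally show ?thesis using D_small[OF y] c(2)[OF \<nu>] by linarith
  qed
  have "mono_on {0<..\<delta> / 2} (\<lambda>r. W (a + r *\<^sub>R \<nu>))" if \<nu>: "\<nu> \<in> sphere 0 1" for \<nu>
  proof -
    define g where "g r = W (a + r *\<^sub>R \<nu>)" for r
    define G where "G r = (\<Sum>i\<in>UNIV. \<nu> $ i * partial i W (a + r *\<^sub>R \<nu>))" for r
    have dg: "(g has_real_derivative G r) (at r)" for r
      using has_vector_derivative_line[OF Ck_on_one_has_derivative[of 0 W "a + r *\<^sub>R \<nu>"]] W_C1
      unfolding g_def[abs_def] G_def by (simp add: has_real_derivative_iff_has_vector_derivative)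
    have dG: "(G has_real_derivative hessian_form W (a + r *\<^sub>R \<nu>) \<nu>) (at r)" for r
    proof -
      have "((\<lambda>r. partial i W (a + r *\<^sub>R \<nu>)) has_real_derivative
          (\<Sum>j\<in>UNIV. \<nu> $ j * partial j (partial i W) (a + r *\<^sub>R \<nu>))) (at r)" for i
        using has_vector_derivative_line[OF Ck_on_one_has_derivative[of 0 "partial i W" "a + r *\<^sub>R \<nu>"]] C1[of i]
        by (simp add: has_real_derivative_iff_has_vector_derivative)
      from DERIV_sum[of UNIV "\<lambda>r i. \<nu> $ i * partial i W (a + r *\<^sub>R \<nu>)", OF DERIV_cmult[OF this]]
      show ?thesis
        unfolding G_def[abs_def] hessian_form_def by (simp add: sum_distrib_left mult_ac)
    qed
    \<comment> \<open>a is a minimum of W, hence 0 is one along the ray.\<close>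
    have G0: "G 0 = 0"
    proof (rule DERIV_local_min[OF dg[of 0] zero_less_one])
      show "\<forall>r. \<bar>0 - r\<bar> < 1 \<longrightarrow> g 0 \<le> g r" by (simp add: g_def W_a W_nonneg)
    qed
    have near: "norm (a + r *\<^sub>R \<nu> - a) < \<delta>" if "0 \<le> r" "r \<le> \<delta> / 2" for r
      using that \<nu> \<delta>(1) by simp
    have G_nonneg: "G r \<ge> 0" if r: "0 \<le> r" "r \<le> \<delta> / 2" for r
    proof -
      have "G 0 \<le> G r"
        by (rule DERIV_nonneg_imp_nondecreasing[OF r(1)])
          (use dG pos[OF \<nu> near] r in \<open>meson order_trans\<close>)
      then show ?thesis by (simp add: G0)
    qed
    show ?thesis
    proof (rule mono_onI)
      fix r s assume rs: "r \<in> {0<..\<delta> / 2}" "s \<in> {0<..\<delta> / 2}" "r \<le> s"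
      have "g r \<le> g s"
      proof (rule DERIV_nonneg_imp_nondecreasing[OF rs(3)])
        fix t assume "r \<le> t" "t \<le> s"
        then have "G t \<ge> 0" using rs by (intro G_nonneg) auto
        then show "\<exists>y. (g has_real_derivative y) (at t) \<and> 0 \<le> y" using dg by blast
      qed
      then show "W (a + r *\<^sub>R \<nu>) \<le> W (a + s *\<^sub>R \<nu>)" by (simp add: g_def)
    qed
  qed
  then show ?thesis using \<delta>(1) by (intro exI[of _ "\<delta> / 2"]) auto
qed

section \<open>Radially symmetric minimizers\<close>

text \<open>Otherwise F(N) would grow like the volume N^n, against
  \<open>energy_decay\<close>.\<close>

lemma potential_not_bounded_below:
  assumes "\<delta> > 0"
  shows "\<exists>x. norm x \<ge> r \<and> W (u x) < \<delta>"
proof (rule ccontr)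
  assume "\<not> (\<exists>x. norm x \<ge> r \<and> W (u x) < \<delta>)"
  then have W: "\<delta> \<le> W (u x)" if "norm x \<ge> r" for x using that by force
  let ?n = "CARD('n)"
  obtain N1 where N1: "real N1 > r" using reals_Archimedean2 by blast
  define V where "V = ball_volume 1"
  have V: "V > 0" unfolding V_def ball_volume_def using content_cball_pos[of 1 "0::real^'n"] by simp
  note i1 = integrable_indicator_cball[of _ "\<delta>"]
  have lower: "\<delta> * ball_volume N - \<delta> * ball_volume N1 \<le> F N" if "N \<ge> N1" for N
  proof -
    have "\<delta> * ball_volume N - \<delta> * ball_volume N1
      = (LBINT x. indicator (cball (0::real^'n) (real N)) x * \<delta> - indicator (cball (0::real^'n) (real N1)) x * \<delta>)"
      unfolding Bochner_Integration.integral_diff[OF i1 i1] integral_indicator_cball by simp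
    also have "\<dots> \<le> F N"
      unfolding F_def
    proof (rule integral_mono[OF Bochner_Integration.integrable_diff[OF i1 i1] integrable_e])
      fix x show "indicator (cball 0 (real N)) x * \<delta> - indicator (cball 0 (real N1)) x * \<delta> \<le> indicator (cball 0 (real N)) x * e x"
      proof (cases "norm x \<le> real N1")
        case True
        then show ?thesis using that e_nonneg[of x] by (simp add: indicator_def)
      next
        case False
        then have "\<delta> \<le> W (u x)" using N1 by (intro W) simp
        then have "\<delta> \<le> e x" using grad_sq_nonneg[of u x] by (simp add: energy_density_def)
        then show ?thesis using False by (simp add: indicator_def)
      qed
    qed
    finally show ?thesis .
  qed
  obtain N0 where N0: "\<And>N. N \<ge> N0 \<Longrightarrow> real N * F N \<le> \<delta> * V / 4 * real N ^ ?n"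
    using energy_decay[of "\<delta> * V / 4"] assms V by auto
  \<comment> \<open>N \<ge> 2 N1 leaves at least half of the volume outside the ball of radius N1;
    then \<delta> V N^n / 2 \<le> F(N) contradicts the bound with \<delta> V / 4.\<close>
  define N where "N = max (2 * N1) (max N0 1)"
  have N: "N \<ge> 2 * N1" "N \<ge> N0" "N \<ge> 1" by (auto simp: N_def)
  have n: "?n \<ge> 1" by (simp add: Suc_le_eq)
  have "2 * real N1 ^ ?n \<le> 2 ^ ?n * real N1 ^ ?n"
    using power_increasing[OF n, of "2::real"] by (intro mult_right_mono) auto
  also have "\<dots> = real (2 * N1) ^ ?n" by (simp add: power_mult_distrib)
  also have "\<dots> \<le> real N ^ ?n" using N by (intro power_mono) auto
  finally have half: "2 * real N1 ^ ?n \<le> real N ^ ?n" .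
  have "\<delta> * V * (2 * real N1 ^ ?n) \<le> \<delta> * V * real N ^ ?n"
    using half assms V by (intro mult_left_mono) auto
  then have "\<delta> * V * real N ^ ?n / 2 \<le> \<delta> * ball_volume N - \<delta> * ball_volume N1"
    using ball_volume_eq[of N] ball_volume_eq[of N1] by (simp add: V_def algebra_simps)
  also have "\<dots> \<le> F N" using N by (intro lower) auto
  also have "\<dots> \<le> real N * F N"
    using mult_right_mono[of 1 "real N" "F N"] N(3) F_nonneg[of N] by simp
  also have "\<dots> \<le> \<delta> * V * real N ^ ?n / 4" using N0[OF N(2)] by simp
  finally have "\<delta> * V * real N ^ ?n \<le> 0" by linarith
  moreover have "0 < \<delta> * V * real N ^ ?n" using assms V N(3) by simp
  ultimately show False by linarith
qed

lemma partial_u_C1: "Ck_on 1 UNIV (partial i u)"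
  using Ck_on_partial[of 1 UNIV u] u_C2 by (simp add: numeral_2_eq_2)

lemma W_u_has_vector_derivative:
  assumes "(c has_vector_derivative v) (at t)"
  shows "((\<lambda>t. W (c t)) has_real_derivative grad W (c t) \<bullet> v) (at t)"
proof -
  have "(W has_derivative (total_deriv W (c t))) (at (c t))"
    using W_C1 by (intro Ck_on_one_has_derivative[of 0]) simp
  from has_derivative_compose[OF assms[unfolded has_vector_derivative_def] this]
  have "((\<lambda>t. W (c t)) has_derivative (\<lambda>s. s * (grad W (c t) \<bullet> v))) (at t)"
    by (simp add: inner_vec_def grad_def sum_distrib_left mult_ac)
  then show ?thesis by (simp add: has_real_derivative_iff_has_vector_derivative has_vector_derivative_def)
qed

text \<open>Along a ray, H = |u'|^2/2 - W(u) has derivative -(n-1)/r |u'|^2. Since H is nonpositive at the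
  origin, it vanishes identically, for otherwise W(u) would stay away from 0 at infinity.\<close>

lemma radial_minimizer_constant:
  assumes n: "CARD('n) \<ge> 2" and rad: "radially_symmetric u"
    and u_eq: "\<And>x. laplacian u x = grad W (u x)"
  shows "u x = a"
proof -
  obtain i :: 'n where True by blast
  define b :: "real^'n" where "b = axis i 1"
  define P where "P r = partial i u (r *\<^sub>R b)" for r
  define P2 where "P2 r = partial i (partial i u) (r *\<^sub>R b)" for r
  have dU: "((\<lambda>r. u (r *\<^sub>R b)) has_vector_derivative P r) (at r)" for r
    using has_vector_derivative_partial[of u 0 i r] u_C1 by (simp add: P_def b_def)
  have dP: "(P has_vector_derivative P2 r) (at r)" for r
    using has_vector_derivative_partial[of "partial i u" 0 i r] partial_u_C1[of i]
    by (simp add: P_def[abs_def] P2_def b_def)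
  have norm_line: "norm (t *\<^sub>R b + s *\<^sub>R axis j 1) = sqrt (t\<^sup>2 + s\<^sup>2)" if "j \<noteq> i" for t s j
  proof -
    have "b \<bullet> axis j 1 = 0" "b \<bullet> b = 1" using that by (simp_all add: b_def inner_axis_axis)
    moreover have "axis j 1 \<bullet> (axis j 1 :: real^'n) = 1" by (simp add: inner_axis)
    ultimately have "(norm (t *\<^sub>R b + s *\<^sub>R axis j 1))\<^sup>2 = t\<^sup>2 + s\<^sup>2"
      unfolding norm_sq_lincomb by (simp add: power2_norm_eq_inner inner_commute)
    then show ?thesis by (metis norm_ge_zero real_sqrt_unique)
  qed
  have u_rad: "u x = u (norm x *\<^sub>R b)" for x
  proof -
    have "norm x = norm (norm x *\<^sub>R b)" by (simp add: b_def)
    then show ?thesis using rad unfolding radially_symmetric_def by blast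
  qed
  \<comment> \<open>With U the profile of u along b, a transversal displacement s turns u into
    U(sqrt(t^2 + s^2)), whose second derivative at s = 0 is U'(t) / t.\<close>
  have other: "partial j (partial j u) (t *\<^sub>R b) = (1 / t) *\<^sub>R P t" if t: "t > 0" and j: "j \<noteq> i" for t j
  proof -
    let ?r = "\<lambda>s. sqrt (t\<^sup>2 + s\<^sup>2)"
    have pos: "t\<^sup>2 + s\<^sup>2 > 0" for s using t by (simp add: add_pos_nonneg)
    have dsqrt: "(?r has_real_derivative s / ?r s) (at s)" for s
      using pos[of s] by (auto intro!: derivative_eq_intros simp: field_simps)
    have first: "partial j u (t *\<^sub>R b + s *\<^sub>R axis j 1) = (s / ?r s) *\<^sub>R P (?r s)" for s
    proof (rule partial_eqI)
      have "((\<lambda>r. s + r) has_real_derivative 1) (at 0)" by (auto intro!: derivative_eq_intros)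
      from DERIV_chain2[of "?r", OF _ this] dsqrt[of s]
      have "((\<lambda>r. ?r (s + r)) has_vector_derivative s / ?r s) (at 0)"
        by (simp add: has_real_derivative_iff_has_vector_derivative)
      from vector_diff_chain_at[OF this dU]
      have "((\<lambda>r. u (?r (s + r) *\<^sub>R b)) has_vector_derivative
          (s / ?r s) *\<^sub>R P (?r s)) (at 0)"
        by (simp add: o_def)
      moreover have "u (t *\<^sub>R b + s *\<^sub>R axis j 1 + r *\<^sub>R axis j 1) = u (?r (s + r) *\<^sub>R b)" for r
        using u_rad[of "t *\<^sub>R b + (s + r) *\<^sub>R axis j 1"] norm_line[OF j, of t "s + r"]
        by (simp add: scaleR_add_left add.assoc)
      ultimately show "((\<lambda>r. u (t *\<^sub>R b + s *\<^sub>R axis j 1 + r *\<^sub>R axis j 1)) has_vector_derivative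
          (s / ?r s) *\<^sub>R P (?r s)) (at 0)" by simp
    qed
    have "((\<lambda>s. s / ?r s) has_real_derivative 1 / t) (at 0)"
      using DERIV_divide[OF DERIV_ident dsqrt[of 0]] t by simp
    moreover have "((\<lambda>s. P (?r s)) has_vector_derivative 0) (at 0)"
      using vector_diff_chain_at[OF dsqrt[of 0, unfolded has_real_derivative_iff_has_vector_derivative] dP] by (simp add: o_def)
    ultimately have "((\<lambda>s. (s / ?r s) *\<^sub>R P (?r s)) has_vector_derivative (1 / t) *\<^sub>R P t) (at 0)"
      using has_vector_derivative_scaleR[of "\<lambda>s. s / ?r s" "1 / t" 0 UNIV "\<lambda>s. P (?r s)" 0] t by simp
    then show ?thesis by (intro partial_eqI) (simp add: first)
  qed
  have lap: "P2 t + ((real CARD('n) - 1) / t) *\<^sub>R P t = grad W (u (t *\<^sub>R b))" if "t > 0" for t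
  proof -
    have "laplacian u (t *\<^sub>R b) = P2 t + (\<Sum>j\<in>UNIV - {i}. partial j (partial j u) (t *\<^sub>R b))"
      unfolding laplacian_def P2_def by (rule sum.remove) auto
    also have "(\<Sum>j\<in>UNIV - {i}. partial j (partial j u) (t *\<^sub>R b)) = (\<Sum>j\<in>UNIV - {i}. (1 / t) *\<^sub>R P t)"
      using other[OF that] by (intro sum.cong) auto
    also have "\<dots> = ((real CARD('n) - 1) / t) *\<^sub>R P t"
    proof -
      have "real (card (UNIV - {i})) = real CARD('n) - 1" using n by (simp add: card_Diff_singleton)
      then show ?thesis unfolding sum_constant_scaleR by simp
    qed
    finally show ?thesis using u_eq by simp
  qed
  define H where "H t = 1/2 * (P t \<bullet> P t) - W (u (t *\<^sub>R b))" for t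
  have dH: "(H has_real_derivative P t \<bullet> P2 t - grad W (u (t *\<^sub>R b)) \<bullet> P t) (at t)" for t
  proof -
    have "((\<lambda>t. P t \<bullet> P t) has_real_derivative 2 * (P t \<bullet> P2 t)) (at t)"
      using has_derivative_inner[OF dP[unfolded has_vector_derivative_def] dP[unfolded has_vector_derivative_def], of t]
      unfolding has_real_derivative_iff_has_vector_derivative has_vector_derivative_def
      by (simp add: inner_commute algebra_simps)
    from DERIV_diff[OF DERIV_cmult[OF this, of "1/2"] W_u_has_vector_derivative[OF dU[of t]]]
    show ?thesis unfolding H_def[abs_def] by simp
  qed
  have dH_eq: "P t \<bullet> P2 t - grad W (u (t *\<^sub>R b)) \<bullet> P t = - ((real CARD('n) - 1) / t * (P t \<bullet> P t))" if "t > 0" for t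
    unfolding lap[OF that, symmetric] by (simp add: inner_add_left inner_add_right inner_commute)
  \<comment> \<open>u is even on the line through the origin, so its derivative at 0 equals its own
    negative.\<close>
  have P0: "P 0 = 0"
  proof -
    have "((\<lambda>r. - r) has_vector_derivative (- 1 :: real)) (at 0)" by (auto intro!: derivative_eq_intros)
    from vector_diff_chain_at[OF this, of "\<lambda>r. u (r *\<^sub>R b)" "P 0"] dU[of 0]
    have "((\<lambda>r. u ((- r) *\<^sub>R b)) has_vector_derivative - P 0) (at 0)" by (simp add: o_def)
    moreover have "u ((- r) *\<^sub>R b) = u (r *\<^sub>R b)" for r using u_rad[of "(- r) *\<^sub>R b"] u_rad[of "r *\<^sub>R b"] by simp
    ultimately have "((\<lambda>r. u (r *\<^sub>R b)) has_vector_derivative - P 0) (at 0)" by simp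
    from vector_derivative_unique_at[OF this dU[of 0]] have "- P 0 = P 0" .
    then have "2 *\<^sub>R P 0 = 0" unfolding scaleR_2 by (metis ab_left_minus)
    then show ?thesis by simp
  qed
  have dec: "H t \<le> H s" if "0 \<le> s" "s \<le> t" for s t
  proof (rule DERIV_nonpos_imp_nonincreasing[OF that(2)])
    fix r assume r: "s \<le> r" "r \<le> t"
    have "P r \<bullet> P2 r - grad W (u (r *\<^sub>R b)) \<bullet> P r \<le> 0"
    proof (cases "r = 0")
      case True
      then show ?thesis by (simp add: P0)
    next
      case False
      then have "r > 0" using r that by simp
      then show ?thesis using n by (simp add: dH_eq)
    qed
    then show "\<exists>y. (H has_real_derivative y) (at r) \<and> y \<le> 0" using dH by blast
  qed
  have H0: "H t \<le> 0" if "t \<ge> 0" for t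
    using dec[OF _ that] W_nonneg[of "u 0"] P0 by (force simp: H_def)
  have H_eq: "H t = 0" if "t \<ge> 0" for t
  proof (rule ccontr)
    assume "H t \<noteq> 0"
    then have neg: "H t < 0" using H0[OF that] by simp
    have "- H t \<le> W (u x)" if "norm x \<ge> t" for x
    proof -
      have "H (norm x) \<le> H t" using \<open>t \<ge> 0\<close> that by (rule dec)
      moreover have "H (norm x) = 1/2 * (P (norm x) \<bullet> P (norm x)) - W (u x)"
        using u_rad[of x] by (simp add: H_def)
      ultimately show ?thesis using inner_ge_zero[of "P (norm x)"] by linarith
    qed
    then show False using potential_not_bounded_below[of "- H t" t] neg by force
  qed
  have "u (t *\<^sub>R b) = a" if t: "t > 0" for t
  proof -
    have "((\<lambda>t. 0) has_real_derivative P t \<bullet> P2 t - grad W (u (t *\<^sub>R b)) \<bullet> P t) (at t)"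
      by (rule has_field_derivative_transform_within_open[OF dH, of "{0<..}"]) (use t H_eq in auto)
    \<comment> \<open>H vanishes on the half-line and so does its derivative; as n > 1 this gives P
      t = 0, and H = 0 then leaves W(u) = 0.\<close>
    from DERIV_unique[OF this DERIV_const] have "(real CARD('n) - 1) / t * (P t \<bullet> P t) = 0"
      using dH_eq[OF t] by simp
    then have "P t = 0" using n t by simp
    then have "W (u (t *\<^sub>R b)) = 0" using H_eq[of t] t by (simp add: H_def)
    then show ?thesis using W_pos[of "u (t *\<^sub>R b)"] by force
  qed
  moreover have "u (0 *\<^sub>R b) = a"
  proof -
    have "W (u (0 *\<^sub>R b)) = 0" using H_eq[of 0] P0 by (simp add: H_def)
    then show ?thesis using W_pos[of "u (0 *\<^sub>R b)"] by force
  qed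
  ultimately show ?thesis using u_rad[of x] by (cases "norm x = 0") auto
qed

end

section \<open>Pohozaev's identity and Modica's bound\<close>

definition second_diff :: "('a::ab_group_add \<Rightarrow> 'b::ab_group_add) \<Rightarrow> 'a \<Rightarrow> 'a \<Rightarrow> 'a \<Rightarrow> 'b" where
  "second_diff f x v w = f (x + v + w) - f (x + v) - f (x + w) + f x"

text \<open>The mean value inequality is applied twice: to G(y) = f(y + s e_j) - f(y) along e_i, and
  to the i-th partial of f along e_j.\<close>

lemma second_difference:
  fixes f :: "real^'n \<Rightarrow> 'b::real_normed_vector"
  assumes f: "Ck_on 2 UNIV f" and "\<epsilon> > 0"
  shows "\<exists>\<delta>>0. \<forall>s. 0 < s \<longrightarrow> s < \<delta> \<longrightarrow>
    norm (second_diff f x (s *\<^sub>R axis i 1) (s *\<^sub>R axis j 1)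
      - s\<^sup>2 *\<^sub>R partial j (partial i f) x) \<le> \<epsilon> * s\<^sup>2"
proof -
  have f2: "Ck_on (Suc (Suc 0)) UNIV f" using f by (simp add: numeral_2_eq_2)
  have C1: "has_partials_on UNIV (partial i f)" "continuous_on UNIV (partial j (partial i f))" using f2 by auto
  have df: "(f has_derivative total_deriv f y) (at y)" for y
    by (rule Ck_on_one_has_derivative[OF f2])
  have "isCont (partial j (partial i f)) x" using C1(2) by (simp add: continuous_on_eq_continuous_at)
  then obtain \<delta> where \<delta>: "\<delta> > 0"
    "\<And>y. dist y x < \<delta> \<Longrightarrow> dist (partial j (partial i f) y) (partial j (partial i f) x) < \<epsilon>"
    using \<open>\<epsilon> > 0\<close> unfolding continuous_at_eps_delta by blast
  let ?A = "partial j (partial i f) x"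
  show ?thesis
  proof (intro exI[of _ "\<delta> / 2"] conjI allI impI)
    fix s :: real assume s: "0 < s" "s < \<delta> / 2"
    define G where "G y = f (y + s *\<^sub>R axis j 1) - f y" for y
    have dG: "(G has_derivative (\<lambda>h. (total_deriv f (y + s *\<^sub>R axis j 1) h)
        - (total_deriv f y h))) (at y)" for y
    proof -
      have "((\<lambda>y. y + s *\<^sub>R axis j 1) has_derivative (\<lambda>h. h)) (at y)" by (auto intro!: derivative_eq_intros)
      from has_derivative_diff[OF has_derivative_compose[OF this df] df]
      show ?thesis unfolding G_def[abs_def] .
    qed
    have hp: "has_partials_on UNIV G"
      unfolding has_partials_on_def
      by (intro allI ballI differentiableI_vector[OF has_vector_derivative_line[OF dG]])
    have pG: "partial i G y = partial i f (y + s *\<^sub>R axis j 1) - partial i f y" for y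
      using partial_has_derivative[OF dG] by simp
    have "norm (G (x + s *\<^sub>R axis i 1) - G x - s *\<^sub>R (s *\<^sub>R ?A)) \<le> (\<epsilon> * s) * \<bar>s\<bar>"
    proof (rule partial_increment[OF hp])
      fix t assume t: "\<bar>t\<bar> \<le> \<bar>s\<bar>"
      have "norm (partial i f (x + t *\<^sub>R axis i 1 + s *\<^sub>R axis j 1) - partial i f (x + t *\<^sub>R axis i 1) - s *\<^sub>R ?A) \<le> \<epsilon> * \<bar>s\<bar>"
      proof (rule partial_increment[OF C1(1)])
        fix r assume r: "\<bar>r\<bar> \<le> \<bar>s\<bar>"
        have "norm (t *\<^sub>R axis i 1 + r *\<^sub>R axis j (1::real)) \<le> \<bar>t\<bar> + \<bar>r\<bar>"
          by (rule order_trans[OF norm_triangle_ineq]) simp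
        then have "dist (x + t *\<^sub>R axis i 1 + r *\<^sub>R axis j 1) x < \<delta>"
          using t r s by (simp add: dist_norm add.assoc)
        from \<delta>(2)[OF this]
        show "norm (partial j (partial i f) (x + t *\<^sub>R axis i 1 + r *\<^sub>R axis j 1) - ?A) \<le> \<epsilon>"
          by (simp add: dist_norm)
      qed
      then show "norm (partial i G (x + t *\<^sub>R axis i 1) - s *\<^sub>R ?A) \<le> \<epsilon> * s"
        using s by (simp add: pG)
    qed
    then show "norm (second_diff f x (s *\<^sub>R axis i 1) (s *\<^sub>R axis j 1)
        - s\<^sup>2 *\<^sub>R ?A) \<le> \<epsilon> * s\<^sup>2"
      using s by (simp add: second_diff_def G_def power2_eq_square algebra_simps)
  qed (use \<delta>(1) in simp)
qed

text \<open>Exchanging the two steps leaves the second difference unchanged, so both mixed partials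
  are its limit after division by s^2.\<close>

lemma partial_commute:
  fixes f :: "real^'n \<Rightarrow> 'b::real_normed_vector"
  assumes f: "Ck_on 2 UNIV f"
  shows "partial i (partial j f) x = partial j (partial i f) x"
proof -
  let ?A = "partial j (partial i f) x" and ?B = "partial i (partial j f) x"
  have "norm (?A - ?B) \<le> 0"
  proof (rule field_le_epsilon)
    fix e :: real assume "e > 0"
    obtain \<delta>1 where \<delta>1: "\<delta>1 > 0" "\<And>s. 0 < s \<Longrightarrow> s < \<delta>1 \<Longrightarrow>
      norm (second_diff f x (s *\<^sub>R axis i 1) (s *\<^sub>R axis j 1) - s\<^sup>2 *\<^sub>R ?A) \<le> e / 2 * s\<^sup>2"
      using second_difference[OF f, of "e / 2" x i j] \<open>e > 0\<close> by auto
    obtain \<delta>2 where \<delta>2: "\<delta>2 > 0" "\<And>s. 0 < s \<Longrightarrow> s < \<delta>2 \<Longrightarrow>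
      norm (second_diff f x (s *\<^sub>R axis j 1) (s *\<^sub>R axis i 1) - s\<^sup>2 *\<^sub>R ?B) \<le> e / 2 * s\<^sup>2"
      using second_difference[OF f, of "e / 2" x j i] \<open>e > 0\<close> by auto
    define s where "s = min \<delta>1 \<delta>2 / 2"
    have s: "0 < s" "s < \<delta>1" "s < \<delta>2" using \<delta>1(1) \<delta>2(1) by (auto simp: s_def)
    let ?D = "second_diff f x (s *\<^sub>R axis i 1) (s *\<^sub>R axis j 1)"
    have 1: "norm (?D - s\<^sup>2 *\<^sub>R ?A) \<le> e / 2 * s\<^sup>2" using s by (intro \<delta>1(2))
    have 2: "norm (?D - s\<^sup>2 *\<^sub>R ?B) \<le> e / 2 * s\<^sup>2"
      using \<delta>2(2)[OF s(1,3)] by (simp add: second_diff_def algebra_simps)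
    have "s\<^sup>2 * norm (?A - ?B) = norm ((?D - s\<^sup>2 *\<^sub>R ?B) - (?D - s\<^sup>2 *\<^sub>R ?A))"
      by (simp add: scaleR_diff_right[symmetric] del: scaleR_diff_right)
    also have "\<dots> \<le> e / 2 * s\<^sup>2 + e / 2 * s\<^sup>2"
      by (intro order_trans[OF norm_triangle_ineq4] add_mono 1 2)
    finally have "s\<^sup>2 * norm (?A - ?B) \<le> s\<^sup>2 * e" by (simp add: mult.commute)
    then show "norm (?A - ?B) \<le> 0 + e" using s(1) by (simp add: mult_le_cancel_left_pos)
  qed
  then show ?thesis by simp
qed

section \<open>Calculus rules for C^1 functions\<close>

lemma axis_sum_mult [simp]: "(\<Sum>i\<in>UNIV. (axis j (1::real) $ i) * F i) = (F j :: real)"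
  using axis_sum_scaleR[of j F] by simp

lemma partial_const [simp]: "partial i (\<lambda>x. c) x = 0"
  by (rule partial_eqI) simp

lemma partial_scaleR:
  fixes f :: "real^'n \<Rightarrow> real"
  assumes "Ck_on 1 UNIV f" "Ck_on 1 UNIV g"
  shows "partial i (\<lambda>x. f x *\<^sub>R g x) x = f x *\<^sub>R partial i g x + partial i f x *\<^sub>R g x"
  using partial_has_derivative[OF has_derivative_scaleR[OF Ck_on_one_has_derivative[of 0 f x]
        Ck_on_one_has_derivative[of 0 g x]], of i] assms by simp

lemma C1_inner:
  fixes f g :: "real^'n \<Rightarrow> 'b::real_inner"
  assumes "Ck_on 1 UNIV f" "Ck_on 1 UNIV g"
  shows "Ck_on 1 UNIV (\<lambda>x. f x \<bullet> g x)"
    and "partial i (\<lambda>x. f x \<bullet> g x) x = f x \<bullet> partial i g x + partial i f x \<bullet> g x"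
proof -
  have d: "((\<lambda>x. f x \<bullet> g x) has_derivative (\<lambda>h. f x \<bullet> total_deriv g x h +
      total_deriv f x h \<bullet> g x)) (at x)" for x
    using assms by (intro has_derivative_inner Ck_on_one_has_derivative[of 0]) simp_all
  have c: "continuous_on UNIV f" "continuous_on UNIV g" "\<And>i. continuous_on UNIV (partial i f)" "\<And>i. continuous_on UNIV (partial i g)"
    using assms by auto
  show "Ck_on 1 UNIV (\<lambda>x. f x \<bullet> g x)"
    by (rule C1I[OF d]) (unfold axis_sum_scaleR, intro continuous_on_add continuous_on_inner c)
  show "partial i (\<lambda>x. f x \<bullet> g x) x = f x \<bullet> partial i g x + partial i f x \<bullet> g x"
    using partial_has_derivative[OF d] by simp
qed

lemma C1_sum:
  assumes "finite S" "\<And>j. j \<in> S \<Longrightarrow> Ck_on 1 UNIV (f j)"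
  shows "Ck_on 1 UNIV (\<lambda>x. \<Sum>j\<in>S. f j x) \<and> partial i (\<lambda>x. \<Sum>j\<in>S. f j x) x = (\<Sum>j\<in>S. partial i (f j) x)"
  using assms
proof (induction S rule: finite_induct)
  case empty
  show ?case using Ck_on_const[of 1 0] by simp
next
  case (insert k S)
  then show ?case using Ck_on_add[of 1 "f k"] partial_add[of "f k"] by simp
qed

lemma C1_nth:
  "Ck_on 1 UNIV (\<lambda>x::real^'n. x $ j)" "partial i (\<lambda>x::real^'n. x $ j) x = (if i = j then 1 else 0)"
proof -
  show "Ck_on 1 UNIV (\<lambda>x::real^'n. x $ j)" by (rule Ck_on_linear[OF bounded_linear_vec_nth])
  show "partial i (\<lambda>x::real^'n. x $ j) x = (if i = j then 1 else 0)"
    using partial_has_derivative[OF bounded_linear_imp_has_derivative[OF bounded_linear_vec_nth[of j]], of i x]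
    by (simp add: axis_def)
qed

context single_well_minimizer
begin

text \<open>The generator of dilations applied to u, that is |x| times its radial
  derivative.\<close>

definition Q :: "real^'n \<Rightarrow> real^'m" where
  "Q x = (\<Sum>j\<in>UNIV. (x $ j) *\<^sub>R partial j u x)"

lemma C1_Q: "Ck_on 1 UNIV Q"
  and partial_Q: "partial i Q x = (\<Sum>j\<in>UNIV. (x $ j) *\<^sub>R partial i (partial j u) x) + partial i u x"
proof -
  have C: "Ck_on 1 UNIV (\<lambda>x. (x $ j) *\<^sub>R partial j u x)" for j
    by (rule Ck_on_scaleR[OF C1_nth(1) partial_u_C1])
  note s = C1_sum[of UNIV "\<lambda>j x. (x $ j) *\<^sub>R partial j u x", OF finite C]
  show "Ck_on 1 UNIV Q" using s unfolding Q_def[abs_def] by blast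
  have "partial i Q x = (\<Sum>j\<in>UNIV. partial i (\<lambda>x. (x $ j) *\<^sub>R partial j u x) x)"
    using s unfolding Q_def[abs_def] by blast
  also have "\<dots> = (\<Sum>j\<in>UNIV. (x $ j) *\<^sub>R partial i (partial j u) x + (if i = j then 1 else 0) *\<^sub>R partial j u x)"
    unfolding partial_scaleR[OF C1_nth(1) partial_u_C1] C1_nth(2) ..
  also have "\<dots> = (\<Sum>j\<in>UNIV. (x $ j) *\<^sub>R partial i (partial j u) x) + (\<Sum>j\<in>UNIV. if i = j then partial j u x else 0)"
    unfolding sum.distrib by (intro arg_cong2[of _ _ _ _ "(+)"] sum.cong) auto
  finally show "partial i Q x = (\<Sum>j\<in>UNIV. (x $ j) *\<^sub>R partial i (partial j u) x) + partial i u x" by simp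
qed

lemma C1_W_u: "Ck_on 1 UNIV (\<lambda>x. W (u x))"
  and partial_W_u: "partial i (\<lambda>x. W (u x)) x = grad W (u x) \<bullet> partial i u x"
proof -
  have du: "(u has_derivative total_deriv u x) (at x)" for x using u_C1 by (intro Ck_on_one_has_derivative[of 0]) simp
  have dW: "(W has_derivative (\<lambda>h. grad W y \<bullet> h)) (at y)" for y
    using Ck_on_one_has_derivative[of 0 W y] W_C1 by (simp add: inner_vec_def grad_def mult.commute)
  have d: "((\<lambda>x. W (u x)) has_derivative (\<lambda>h. grad W (u x) \<bullet> total_deriv u x h)) (at x)" for x
    by (rule has_derivative_compose[OF du dW])
  have cg: "continuous_on UNIV (grad W)"
    unfolding grad_def[abs_def] using W_C1 by (intro continuous_on_vec_lambda) auto
  have cP: "continuous_on UNIV (partial i u)" for i using u_C1 by simp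
  show "Ck_on 1 UNIV (\<lambda>x. W (u x))"
    by (rule C1I[OF d]) (unfold axis_sum_scaleR, intro continuous_on_inner cP
        continuous_on_compose2[OF cg u_cont] subset_UNIV)
  show "partial i (\<lambda>x. W (u x)) x = grad W (u x) \<bullet> partial i u x"
    using partial_has_derivative[OF d] by simp
qed

lemma C1_e: "Ck_on 1 UNIV e"
  and partial_e: "partial i e x = (\<Sum>j\<in>UNIV. partial j u x \<bullet> partial i (partial j u) x) + grad W (u x) \<bullet> partial i u x"
proof -
  let ?g = "\<lambda>x. \<Sum>j\<in>UNIV. partial j u x \<bullet> partial j u x"
  have eq: "e = (\<lambda>x. (1/2) *\<^sub>R ?g x + W (u x))"
    by (simp add: energy_density_def[abs_def] grad_sq_def power2_norm_eq_inner)
  note s = C1_sum[of UNIV "\<lambda>j x. partial j u x \<bullet> partial j u x", OF finite C1_inner(1)[OF partial_u_C1 partial_u_C1]]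
  have sC: "Ck_on 1 UNIV ?g" using s by blast
  have C: "Ck_on 1 UNIV (\<lambda>x. (1/2) *\<^sub>R ?g x)" by (rule Ck_on_scaleR[OF Ck_on_const sC])
  show "Ck_on 1 UNIV e" unfolding eq by (rule Ck_on_add[OF C C1_W_u])
  have "partial i e x = partial i (\<lambda>x. (1/2) *\<^sub>R ?g x) x + grad W (u x) \<bullet> partial i u x"
    unfolding eq partial_add[OF C C1_W_u] partial_W_u ..
  also have "partial i (\<lambda>x. (1/2) *\<^sub>R ?g x) x = (1/2) * partial i ?g x"
    unfolding partial_scaleR[OF Ck_on_const sC] by simp
  also have "partial i ?g x = (\<Sum>j\<in>UNIV. partial i (\<lambda>x. partial j u x \<bullet> partial j u x) x)" using s by blast
  also have "\<dots> = (\<Sum>j\<in>UNIV. 2 * (partial j u x \<bullet> partial i (partial j u) x))"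
    unfolding C1_inner(2)[OF partial_u_C1 partial_u_C1] by (simp add: inner_commute)
  also have "1/2 * \<dots> = (\<Sum>j\<in>UNIV. partial j u x \<bullet> partial i (partial j u) x)"
    by (simp add: sum_distrib_left[symmetric])
  finally show "partial i e x = (\<Sum>j\<in>UNIV. partial j u x \<bullet> partial i (partial j u) x) + grad W (u x) \<bullet> partial i u x" .
qed

text \<open>Pohozaev's identity: the stress tensor P_i . P_j - e delta_ij is divergence free, and it is
  tested with the radial field q(|x|^2) x.\<close>

lemma pohozaev:
  assumes u_eq: "\<And>x. laplacian u x = grad W (u x)"
    and q: "\<And>s. s \<ge> 0 \<Longrightarrow> (q has_real_derivative q' s) (at s)" "continuous_on {0..} q'"
    and supp: "\<And>s. s > r\<^sup>2 \<Longrightarrow> q s = 0" and "r \<ge> 0"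
  defines "I \<equiv> \<lambda>x. 2 * q' ((norm x)\<^sup>2) * ((norm (Q x))\<^sup>2 - (norm x)\<^sup>2 * e x)
      + q ((norm x)\<^sup>2) * (grad_sq u x - real CARD('n) * e x)"
  shows "integrable lborel I" and "(LBINT x. I x) = 0"
proof -
  let ?P = "\<lambda>i. partial i u"
  define \<eta> where "\<eta> x = q ((norm x)\<^sup>2)" for x :: "real^'n"
  have d\<eta>: "(\<eta> has_derivative (\<lambda>h. q' ((norm x)\<^sup>2) * (2 * (x \<bullet> h)))) (at x)" for x
  proof -
    have "((\<lambda>x::real^'n. (norm x)\<^sup>2) has_derivative (\<lambda>h. 2 * (x \<bullet> h))) (at x)"
      using norm_sq_has_derivative[of 0 x] by simp
    from has_derivative_compose[OF this q(1)[unfolded has_field_derivative_def]]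
    show ?thesis unfolding \<eta>_def[abs_def] by simp
  qed
  have \<eta>_C1: "Ck_on 1 UNIV \<eta>"
  proof (rule C1I[OF d\<eta>])
    fix i
    have "continuous_on UNIV (\<lambda>x::real^'n. q' ((norm x)\<^sup>2))"
      by (intro continuous_on_compose2[OF q(2)] continuous_intros) auto
    then show "continuous_on UNIV (\<lambda>x::real^'n. q' ((norm x)\<^sup>2) * (2 * (x \<bullet> axis i 1)))"
      by (intro continuous_on_mult continuous_on_inner continuous_on_const continuous_on_id)
  qed
  have p\<eta>: "partial i \<eta> x = 2 * q' ((norm x)\<^sup>2) * x $ i" for i x
    using partial_has_derivative[OF d\<eta>, of i x] by (simp add: inner_axis)
  \<comment> \<open>Contraction of the stress tensor with the radial field; its divergence is
    \<open>I\<close>.\<close>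
  define Y where "Y i x = \<eta> x *\<^sub>R (?P i x \<bullet> Q x + (- 1) *\<^sub>R ((x $ i) *\<^sub>R e x))" for i x
  have Z_C1: "Ck_on 1 UNIV (\<lambda>x. (- 1) *\<^sub>R ((x $ i) *\<^sub>R e x))" for i
    by (intro Ck_on_scaleR Ck_on_const C1_nth C1_e)
  have X_C1: "Ck_on 1 UNIV (\<lambda>x. ?P i x \<bullet> Q x + (- 1) *\<^sub>R ((x $ i) *\<^sub>R e x))" for i
    by (intro Ck_on_add C1_inner partial_u_C1 C1_Q Z_C1)
  have Y_C1: "Ck_on 1 UNIV (Y i)" for i
    unfolding Y_def[abs_def] by (rule Ck_on_scaleR[OF \<eta>_C1 X_C1])
  have supp\<eta>: "\<eta> x = 0" if "norm x > r" for x
    unfolding \<eta>_def using that \<open>r \<ge> 0\<close> by (intro supp power_strict_mono) auto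
  have Y_supp: "supported r (Y i)" for i using supp\<eta> by (simp add: Y_def)
  have pZ: "partial i (\<lambda>x. (- 1) *\<^sub>R ((x $ i) *\<^sub>R e x)) x = - ((x $ i) * partial i e x + e x)" for i x
    unfolding partial_scaleR[OF Ck_on_const Ck_on_scaleR[OF C1_nth(1) C1_e]] partial_scaleR[OF C1_nth(1) C1_e]
      C1_nth(2) partial_const by simp
  have pX: "partial i (\<lambda>x. ?P i x \<bullet> Q x + (- 1) *\<^sub>R ((x $ i) *\<^sub>R e x)) x
      = ?P i x \<bullet> partial i Q x + partial i (?P i) x \<bullet> Q x - ((x $ i) * partial i e x + e x)" for i x
    unfolding partial_add[OF C1_inner(1)[OF partial_u_C1 C1_Q] Z_C1] C1_inner(2)[OF partial_u_C1 C1_Q] pZ by simp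
  have pY: "partial i (Y i) x = \<eta> x * (?P i x \<bullet> partial i Q x + partial i (?P i) x \<bullet> Q x - ((x $ i) * partial i e x + e x))
      + 2 * q' ((norm x)\<^sup>2) * x $ i * (?P i x \<bullet> Q x - (x $ i) * e x)" for i x
    unfolding Y_def[abs_def] partial_scaleR[OF \<eta>_C1 X_C1] pX p\<eta> by simp
  have I_eq: "I x = (\<Sum>i\<in>UNIV. partial i (Y i) x)" for x
  proof -
    \<comment> \<open>This sum of second derivatives occurs in both \<open>a1\<close> and
      \<open>a3\<close> and cancels, as do the terms grad W . Q of \<open>a2\<close>, obtained from
      the equation, and of \<open>a3\<close>. Beside the terms with q', only |Du|^2 - n e
      remains.\<close>
    let ?S = "\<Sum>i\<in>UNIV. \<Sum>j\<in>UNIV. x $ i * (?P j x \<bullet> partial i (?P j) x)"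
    have a1: "(\<Sum>i\<in>UNIV. ?P i x \<bullet> partial i Q x) = ?S + grad_sq u x"
    proof -
      have "(\<Sum>i\<in>UNIV. ?P i x \<bullet> partial i Q x)
        = (\<Sum>i\<in>UNIV. \<Sum>j\<in>UNIV. x $ j * (?P i x \<bullet> partial j (?P i) x)) + grad_sq u x"
        unfolding partial_Q grad_sq_def power2_norm_eq_inner
        by (simp add: inner_add_right inner_sum_right sum.distrib partial_commute[OF u_C2])
      also have "(\<Sum>i\<in>UNIV. \<Sum>j\<in>UNIV. x $ j * (?P i x \<bullet> partial j (?P i) x)) = ?S" by (rule sum.swap)
      finally show ?thesis .
    qed
    have a2: "(\<Sum>i\<in>UNIV. partial i (?P i) x \<bullet> Q x) = grad W (u x) \<bullet> Q x"
      using u_eq[of x] by (simp add: laplacian_def inner_sum_left[symmetric])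
    have a3: "(\<Sum>i\<in>UNIV. x $ i * partial i e x) = ?S + grad W (u x) \<bullet> Q x"
      unfolding partial_e Q_def by (simp add: distrib_left sum.distrib sum_distrib_left inner_sum_right)
    have a4: "(\<Sum>i\<in>UNIV. x $ i * (?P i x \<bullet> Q x)) = (norm (Q x))\<^sup>2"
    proof -
      have "(\<Sum>i\<in>UNIV. x $ i * (?P i x \<bullet> Q x)) = (\<Sum>i\<in>UNIV. (x $ i) *\<^sub>R ?P i x) \<bullet> Q x"
        by (simp add: inner_sum_left)
      then show ?thesis by (simp add: Q_def[symmetric] power2_norm_eq_inner)
    qed
    have a5: "(\<Sum>i\<in>UNIV. x $ i * (x $ i * e x)) = (norm x)\<^sup>2 * e x"
      by (simp add: power2_norm_eq_inner inner_vec_def sum_distrib_right mult.assoc)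
    have "(\<Sum>i\<in>UNIV. partial i (Y i) x)
      = \<eta> x * ((\<Sum>i\<in>UNIV. ?P i x \<bullet> partial i Q x) + (\<Sum>i\<in>UNIV. partial i (?P i) x \<bullet> Q x)
          - ((\<Sum>i\<in>UNIV. x $ i * partial i e x) + real CARD('n) * e x))
        + 2 * q' ((norm x)\<^sup>2) * ((\<Sum>i\<in>UNIV. x $ i * (?P i x \<bullet> Q x)) - (\<Sum>i\<in>UNIV. x $ i * (x $ i * e x)))"
      unfolding pY sum.distrib sum_distrib_left[symmetric] sum_subtractf[symmetric]
      by (simp add: sum.distrib sum_subtractf sum_distrib_left algebra_simps)
    also have "\<dots> = I x"
      unfolding a1 a2 a3 a4 a5 by (simp add: I_def \<eta>_def)
    finally show ?thesis by simp
  qed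
  have int: "integrable lborel (partial i (Y i))" for i
    using Y_C1[of i] supported_partial[OF Y_supp[of i], of i]
    by (intro integrable_continuous_compact_support[of _ r]) auto
  show "integrable lborel I" unfolding I_eq by (intro Bochner_Integration.integrable_sum int)
  show "(LBINT x. I x) = 0"
    unfolding I_eq using int integral_partial_eq_0[OF Y_C1 Y_supp] by (subst Bochner_Integration.integral_sum) auto
qed

text \<open>With the weight q(s) = (1 + s)^(-(n-1)/2), cut off between radius N and 2N, Modica's bound turns
  Pohozaev's identity into a local bound for the energy by N^(1-n) F(2N), which tends to 0.\<close>

lemma modica_minimizer_constant:
  assumes n: "CARD('n) \<ge> 2" and u_eq: "\<And>x. laplacian u x = grad W (u x)"
    and modica: "\<And>x. (1/2) * grad_sq u x \<le> W (u x)"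
  shows "u x = a"
proof -
  define m where "m = real CARD('n) - 1"
  have m: "m > 0" using n by (simp add: m_def)
  define p where "p s = (1 + s) powr (- (m / 2))" for s :: real
  have p_pos: "p s > 0" if "s \<ge> 0" for s using that by (simp add: p_def)
  have dp: "(p has_real_derivative - (m / 2) * p s / (1 + s)) (at s)" if "s \<ge> 0" for s
    unfolding p_def[abs_def] using that
    by (auto intro!: derivative_eq_intros simp: powr_diff)
  have p_cont: "continuous_on {0..} p"
    unfolding p_def[abs_def] by (intro continuous_intros) auto
  \<comment> \<open>Sends [N^2, 4 N^2] to [0, 1] in the variable s = |x|^2.\<close>
  define t where "t N s = (s - (real N)\<^sup>2) / (3 * (real N)\<^sup>2)" for N s
  define q where "q N s = p s * step_fun (t N s)" for N s
  define q' where "q' N s = - (m / 2) * p s / (1 + s) * step_fun (t N s) + p s * (step_fun' (t N s) / (3 * (real N)\<^sup>2))" for N s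
  have t_cont: "continuous_on A (t N)" for A N
    unfolding t_def[abs_def] divide_inverse by (intro continuous_intros)
  have step_cont: "continuous_on A (\<lambda>s. step_fun (t N s))" "continuous_on A (\<lambda>s. step_fun' (t N s))" for A N
    by (intro continuous_on_compose2[OF continuous_on_step_fun(1) t_cont]
        continuous_on_compose2[OF continuous_on_step_fun(2) t_cont] subset_UNIV)+
  have dq: "(q N has_real_derivative q' N s) (at s)" if "s \<ge> 0" for N s
  proof -
    have "((\<lambda>s. s - (real N)\<^sup>2) has_real_derivative 1) (at s)" by (auto intro!: derivative_eq_intros)
    from DERIV_cdivide[OF this] have "(t N has_real_derivative 1 / (3 * (real N)\<^sup>2)) (at s)"
      unfolding t_def[abs_def] .
    from DERIV_mult[OF dp[OF that] DERIV_chain2[OF step_fun_has_derivative this]]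
    show ?thesis unfolding q_def[abs_def] q'_def by (simp add: algebra_simps)
  qed
  have q'_cont: "continuous_on {0..} (q' N)" for N
    unfolding q'_def[abs_def] divide_inverse
    by (intro continuous_intros p_cont step_cont) auto
  have t_ge1: "t N s \<ge> 1" if "s \<ge> (2 * real N)\<^sup>2" "N \<ge> 1" for N s
    using that by (simp add: t_def pos_le_divide_eq power_mult_distrib)
  have t_le0: "t N s \<le> 0" if "s \<le> (real N)\<^sup>2" for N s
    using that by (simp add: t_def divide_le_0_iff)
  \<comment> \<open>The density that survives because p uses 1 + s and not s: 2 s p' + m p = m p /
    (1 + s) > 0.\<close>
  define k where "k x = p ((norm x)\<^sup>2) / (1 + (norm x)\<^sup>2) * e x" for x
  have k_nonneg: "k x \<ge> 0" for x unfolding k_def using p_pos[of "(norm x)\<^sup>2"] e_nonneg[of x] by simp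
  have k_cont: "continuous_on UNIV k"
  proof -
    have "1 + (norm x)\<^sup>2 \<noteq> 0" for x :: "real^'n" using zero_le_power2[of "norm x"] by linarith
    then show ?thesis unfolding k_def[abs_def]
      by (intro continuous_intros continuous_on_compose2[OF p_cont] e_cont) auto
  qed
  have bound: "m * (LBINT x. indicator (cball 0 (real R)) x * k x) \<le> 11 * real N powr (- m) * F (2 * N)"
    if N: "N \<ge> R" "N \<ge> 1" for N R
  proof -
    have supp: "q N s = 0" if "s > (2 * real N)\<^sup>2" for s
      using t_ge1[of N s] that N by (simp add: q_def step_fun_bounds)
    define I where "I = (\<lambda>x. 2 * q' N ((norm x)\<^sup>2) * ((norm (Q x))\<^sup>2 - (norm x)\<^sup>2 * e x)
        + q N ((norm x)\<^sup>2) * (grad_sq u x - real CARD('n) * e x))"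
    have r: "2 * real N \<ge> 0" by simp
    have poho: "integrable lborel I" "(LBINT x. I x) = 0"
      unfolding I_def by (rule pohozaev(1)[OF u_eq dq q'_cont supp r] pohozaev(2)[OF u_eq dq q'_cont supp r]; assumption)+
    have pw: "m * (indicator (cball 0 (real R)) x * k x)
        - 11 * real N powr (- m) * (indicator (cball 0 (real (2 * N))) x * e x)
      \<le> - I x" for x
    proof -
      define s where "s = (norm x)\<^sup>2"
      have s: "s \<ge> 0" by (simp add: s_def)
      have p: "p s > 0" by (rule p_pos[OF s])
      have c: "0 \<le> step_fun (t N s)" "step_fun (t N s) \<le> 1" by (rule step_fun_bounds)+
      have q0: "q N s \<ge> 0" using p c by (simp add: q_def)
      have q'0: "q' N s \<le> 0"
        unfolding q'_def using p s c m step_fun_bounds(4)[of "t N s"]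
        by (intro add_nonpos_nonpos mult_nonpos_nonneg mult_nonneg_nonpos divide_nonpos_nonneg) auto
      \<comment> \<open>Modica's bound enters here: |Du|^2 \<le> e turns the factor -n into -(n -
        1).\<close>
      have g: "grad_sq u x - real CARD('n) * e x \<le> - (m * e x)"
      proof -
        have "grad_sq u x \<le> e x" using modica[of x] by (simp add: energy_density_def)
        moreover have "m * e x = real CARD('n) * e x - e x" by (simp add: m_def left_diff_distrib)
        ultimately show ?thesis by linarith
      qed
      have "2 * q' N s * ((norm (Q x))\<^sup>2 - s * e x) + q N s * (grad_sq u x - real CARD('n) * e x)
        \<le> - (2 * q' N s * s * e x) + q N s * (- (m * e x))"
      proof (intro add_mono mult_left_mono g q0)
        \<comment> \<open>The weight decreases, so the radial derivative has a favourable sign and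
          is dropped.\<close>
        have "2 * q' N s * (norm (Q x))\<^sup>2 \<le> 0" using q'0 by (intro mult_nonpos_nonneg[of "2 * q' N s"]) simp_all
        then show "2 * q' N s * ((norm (Q x))\<^sup>2 - s * e x) \<le> - (2 * q' N s * s * e x)"
          by (simp add: algebra_simps)
      qed
      also have "\<dots> = - ((2 * q' N s * s + m * q N s) * e x)" by (simp add: algebra_simps)
      finally have 1: "(2 * q' N s * s + m * q N s) * e x \<le>
        - (2 * q' N s * ((norm (Q x))\<^sup>2 - s * e x) + q N s * (grad_sq u x - real CARD('n) * e x))" by linarith
      have s1: "1 + s > 0" using s by simp
      have eq: "2 * q' N s * s + m * q N s
        = m * (p s / (1 + s) * step_fun (t N s)) + 2 * s * p s * step_fun' (t N s) / (3 * (real N)\<^sup>2)"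
      proof -
        have "m * (p s * step_fun (t N s)) = m * (p s / (1 + s) * step_fun (t N s)) * (1 + s)"
          using s1 by (simp add: field_simps)
        moreover define X where "X = p s / (1 + s) * step_fun (t N s)"
        ultimately have mq: "m * q N s = m * X + m * X * s"
          by (simp only: q_def distrib_left mult_1_right)
        define D where "D = step_fun' (t N s) / (3 * (real N)\<^sup>2)"
        have q'_eq: "q' N s = - (m / 2) * X + p s * D" by (simp add: q'_def X_def D_def)
        have "2 * q' N s * s + m * q N s = m * X + 2 * s * p s * D"
          unfolding mq q'_eq by (simp add: algebra_simps)
        then show ?thesis by (simp add: X_def D_def)
      qed
      \<comment> \<open>Only N^2 < s < 4 N^2 contributes; there the step has slope at most 4 in size
        and p \<le> N^(-m), so the constant is 2 * 4 * 4 / 3 = 32/3 < 11.\<close>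
      have 2: "2 * s * p s * step_fun' (t N s) / (3 * (real N)\<^sup>2) * e x
        \<ge> - (11 * real N powr (- m) * (indicator (cball 0 (real (2 * N))) x * e x))"
      proof (cases "s \<le> (real N)\<^sup>2 \<or> s \<ge> (2 * real N)\<^sup>2")
        case True
        then have "step_fun' (t N s) = 0" using t_ge1[of N s] t_le0[of s N] N step_fun_bounds(7) by blast
        then show ?thesis using e_nonneg[of x] by (simp add: indicator_def)
      next
        case False
        have "norm x \<le> 2 * real N"
          using False by (intro power2_le_imp_le[of "norm x"]) (auto simp: s_def)
        then have ind: "indicator (cball 0 (real (2 * N))) x = (1::real)" by simp
        have N2: "(real N)\<^sup>2 > 0" using N by simp
        have "p s \<le> ((real N)\<^sup>2) powr (- (m / 2))"
          unfolding p_def using False N2 m by (intro powr_mono2') auto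
        also have "\<dots> = real N powr (- m)"
          using N by (simp add: powr_powr flip: powr_numeral)
        finally have pN: "p s \<le> real N powr (- m)" .
        have "2 * s * p s * (- step_fun' (t N s)) / (3 * (real N)\<^sup>2) \<le> 2 * (4 * (real N)\<^sup>2) * p s * 4 / (3 * (real N)\<^sup>2)"
          using False s p step_fun_bounds(3,4)[of "t N s"]
          by (intro divide_right_mono mult_mono) (auto simp: power_mult_distrib)
        also have "\<dots> = 32 / 3 * p s" using N2 by simp
        also have "\<dots> \<le> 11 * real N powr (- m)" using pN p by linarith
        finally have "2 * s * p s * (- step_fun' (t N s)) / (3 * (real N)\<^sup>2) * e x \<le> 11 * real N powr (- m) * e x"
          using e_nonneg by (rule mult_right_mono)
        then show ?thesis unfolding ind by simp
      qed
      have 3: "indicator (cball 0 (real R)) x * k x \<le> p s / (1 + s) * step_fun (t N s) * e x"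
      proof (cases "norm x \<le> real R")
        case True
        then have "norm x \<le> real N" using N by simp
        then have "s \<le> (real N)\<^sup>2" unfolding s_def by (intro power_mono) auto
        then have "step_fun (t N s) = 1" using t_le0 step_fun_bounds(5) by blast
        then show ?thesis using True by (simp add: k_def s_def)
      next
        case False
        then show ?thesis using p s1 c e_nonneg[of x] by (simp add: indicator_def)
      qed
      have "m * (indicator (cball 0 (real R)) x * k x) \<le> m * (p s / (1 + s) * step_fun (t N s) * e x)"
        using 3 m by (intro mult_left_mono) auto
      moreover have "(2 * q' N s * s + m * q N s) * e x = m * (p s / (1 + s) * step_fun (t N s) * e x)
          + 2 * s * p s * step_fun' (t N s) / (3 * (real N)\<^sup>2) * e x"
        unfolding eq by (simp only: distrib_right mult.assoc)
      ultimately have "m * (indicator (cball 0 (real R)) x * k x)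
          - 11 * real N powr (- m) * (indicator (cball 0 (real (2 * N))) x * e x)
        \<le> (2 * q' N s * s + m * q N s) * e x" using 2 by linarith
      also note 1
      finally show ?thesis unfolding s_def I_def .
    qed
    have ik: "integrable lborel (\<lambda>x. indicator (cball 0 (real R)) x * k x)"
      by (intro integrable_indicator_continuous[of _ _ "real R"] k_cont) auto
    note i2 = integrable_mult_right[OF ik, of m] integrable_mult_right[OF integrable_e[of "2 * N"], of "11 * real N powr (- m)"]
    have "(LBINT x. m * (indicator (cball 0 (real R)) x * k x)
        - 11 * real N powr (- m) * (indicator (cball 0 (real (2 * N))) x * e x)) \<le> (LBINT x. - I x)"
      by (rule integral_mono[OF Bochner_Integration.integrable_diff[OF i2] Bochner_Integration.integrable_minus[OF poho(1)] pw])
    also have "\<dots> = 0" using poho(2) by simp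
    finally show ?thesis
      unfolding Bochner_Integration.integral_diff[OF i2] F_def integral_mult_right_zero by simp
  qed
  have zero: "k y = 0" for y
  proof -
    obtain R0 where R0: "norm y < real R0" using reals_Archimedean2 by blast
    define R where "R = Suc R0"
    have R: "real R = real R0 + 1" by (simp add: R_def)
    let ?J = "LBINT x. indicator (cball 0 (real R)) x * k x"
    have J: "m * ?J \<le> 0"
    proof (rule field_le_epsilon)
      fix \<epsilon> :: real assume "\<epsilon> > 0"
      \<comment> \<open>The denominator absorbs the 11 of \<open>bound\<close> and the 2^n that
        comes from the radius 2 N.\<close>
      define \<epsilon>' where "\<epsilon>' = \<epsilon> / (11 * 2 ^ CARD('n))"
      have \<epsilon>': "\<epsilon>' > 0" using \<open>\<epsilon> > 0\<close> by (simp add: \<epsilon>'_def)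
      obtain N0 where N0: "\<And>N. N \<ge> N0 \<Longrightarrow> real N * F N \<le> \<epsilon>' * real N ^ CARD('n)"
        using energy_decay[OF \<epsilon>'] by blast
      define N where "N = max (max N0 R) 1"
      have N: "N \<ge> R" "N \<ge> 1" "2 * N \<ge> N0" by (auto simp: N_def)
      have N1: "real N > 0" using N by simp
      have npow: "real N ^ CARD('n) = real N powr m * real N"
        using N1 n by (simp add: m_def powr_diff powr_realpow)
      have "real (2 * N) * F (2 * N) \<le> \<epsilon>' * real (2 * N) ^ CARD('n)" by (rule N0[OF N(3)])
      also have "\<dots> = \<epsilon>' * 2 ^ CARD('n) * real N powr m * real N"
        by (simp add: power_mult_distrib npow)
      finally have "(2 * F (2 * N)) * real N \<le> (\<epsilon>' * 2 ^ CARD('n) * real N powr m) * real N" by (simp add: mult_ac)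
      then have "2 * F (2 * N) \<le> \<epsilon>' * 2 ^ CARD('n) * real N powr m" using N1 by simp
      then have "F (2 * N) \<le> \<epsilon>' * 2 ^ CARD('n) * real N powr m" using F_nonneg[of "2 * N"] by linarith
      then have "11 * real N powr (- m) * F (2 * N) \<le> 11 * real N powr (- m) * (\<epsilon>' * 2 ^ CARD('n) * real N powr m)"
        by (intro mult_left_mono) auto
      also have "\<dots> = \<epsilon> * (real N powr (- m) * real N powr m)" by (simp add: \<epsilon>'_def)
      also have "\<dots> = \<epsilon>" using N1 by (simp flip: powr_add)
      finally show "m * ?J \<le> 0 + \<epsilon>" using bound[OF N(1,2)] by linarith
    qed
    \<comment> \<open>A continuous cutoff replaces the indicator, so that a vanishing integral gives
      vanishing at every point; R = R0 + 1 leaves room for its transition.\<close>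
    define h where "h x = cutoff R0 x * k x" for x
    have hR: "h x \<le> indicator (cball 0 (real R)) x * k x" for x
    proof (cases "norm x \<le> real R")
      case True
      then show ?thesis using cutoff_props(2)[of R0 x] k_nonneg[of x] by (simp add: h_def mult_left_le_one_le cutoff_props(1))
    next
      case False
      then have "cutoff R0 x = 0" using cutoff_props(4)[of R0 x] by (simp add: R)
      then show ?thesis using False by (simp add: h_def)
    qed
    have h_cont: "continuous_on UNIV h"
      unfolding h_def[abs_def] by (intro continuous_on_mult continuous_on_cutoff k_cont)
    have h0: "h x \<ge> 0" for x unfolding h_def by (intro mult_nonneg_nonneg cutoff_props(1) k_nonneg)
    have h_supp: "supported (real R) h"
    proof (intro allI impI)
      fix x :: "real^'n" assume "norm x > real R"
      then show "h x = 0" using hR[of x] h0[of x] by (simp add: indicator_def)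
    qed
    have h_int: "integrable lborel h" by (rule integrable_continuous_compact_support[OF h_cont h_supp])
    have "(LBINT x. h x) \<le> ?J"
      by (intro integral_mono h_int hR integrable_indicator_continuous[of _ _ "real R"] k_cont) auto
    also have "?J \<le> 0" using J m by (simp add: mult_le_0_iff)
    finally have "h y = 0" by (rule continuous_nonneg_integral_le_0[OF h_cont h0 h_int])
    moreover have "cutoff R0 y = 1"
      using R0 cutoff_props(3)[of y R0] by simp
    ultimately show "k y = 0" by (simp add: h_def)
  qed
  have "e x = 0"
  proof -
    have "p ((norm x)\<^sup>2) > 0" "1 + (norm x)\<^sup>2 > 0" using p_pos[of "(norm x)\<^sup>2"] by (auto intro: add_pos_nonneg)
    then show ?thesis using zero[of x] by (simp add: k_def)
  qed
  then have "W (u x) = 0"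
    using W_nonneg[of "u x"] grad_sq_nonneg[of u x] by (simp add: energy_density_def)
  then show ?thesis using W_pos[of "u x"] by force
qed

end

theorem theorem1p3:
  fixes W :: "real^'m::finite \<Rightarrow> real"
    and u :: "real^'n::finite \<Rightarrow> real^'m"
    and a :: "real^'m"
  assumes n_ge: "CARD('n) \<ge> 2"
    and W_C1: "Ck_on 1 UNIV W"
    and W_pos: "\<forall>y. y \<noteq> a \<longrightarrow> W y > 0"
    and W_a: "W a = 0"
    and u_C2: "Ck_on 2 UNIV u"
    and u_bdd: "bounded (range u)"
    and u_eq: "\<forall>x. laplacian u x = grad W (u x)"
    and u_min: "globally_minimizing W u"
    and extra:
      "(CARD('m) = 1 \<and> C11_loc W)
       \<or> radially_symmetric u
       \<or> (\<forall>x. (1/2) * grad_sq u x \<le> W (u x))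
       \<or> (CARD('n) = 2 \<and> (\<exists>r0>0. \<forall>\<nu>\<in>sphere (0::real^'m) 1.
             strict_mono_on {0<..r0} (\<lambda>r. W (a + r *\<^sub>R \<nu>))))
       \<or> (CARD('n) = 2 \<and> C11_loc W \<and> (\<exists>r0>0. \<forall>\<nu>\<in>sphere (0::real^'m) 1.
             mono_on {0<..r0} (\<lambda>r. W (a + r *\<^sub>R \<nu>))))
       \<or> (CARD('n) = 2 \<and> CARD('m) = 1)
       \<or> (Ck_on 2 UNIV W \<and> (\<forall>\<nu>\<in>sphere (0::real^'m) 1. hessian_form W a \<nu> > 0))"
  shows "\<forall>x. u x = a"
proof -
  obtain B where "\<And>x. norm (u x) \<le> B" using u_bdd by (auto simp: bounded_iff)
  then have M: "norm (u x - a) \<le> B + norm a" for x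
    by (rule order_trans[OF norm_triangle_ineq4 add_right_mono])
  interpret single_well_minimizer W u a "B + norm a"
    using W_C1 W_pos W_a u_C2 M u_min by unfold_locales auto
  \<comment> \<open>Serves the two conditions along rays and, through
    \<open>nondegenerate_well_monotone\<close>, the Hessian condition.\<close>
  have mono_case: "u x = a" if "\<exists>r0>0. \<forall>\<nu>\<in>sphere (0::real^'m) 1. mono_on {0<..r0} (\<lambda>r. W (a + r *\<^sub>R \<nu>))" for x
    using that monotone_well_minimizer_constant by blast
  show ?thesis
    using extra
  proof (elim disjE conjE)
    assume "radially_symmetric u"
    then show ?thesis using radial_minimizer_constant[OF n_ge] u_eq by blast
  next
    assume "\<forall>x. (1/2) * grad_sq u x \<le> W (u x)"
    then show ?thesis using modica_minimizer_constant[OF n_ge] u_eq by blast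
  next
    assume "\<exists>r0>0. \<forall>\<nu>\<in>sphere (0::real^'m) 1. strict_mono_on {0<..r0} (\<lambda>r. W (a + r *\<^sub>R \<nu>))"
    then show ?thesis using mono_case strict_mono_on_imp_mono_on by blast
  next
    assume "Ck_on 2 UNIV W" "\<forall>\<nu>\<in>sphere (0::real^'m) 1. hessian_form W a \<nu> > 0"
    then show ?thesis using mono_case nondegenerate_well_monotone by blast
  qed (use scalar_minimizer_constant mono_case in blast)+
qed

end
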